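(* There exists an absolute constant $C>0$ such that the following holds for every $n\ge 1$ and all 1-dependent random variables $X_1,\dots,X_n$ with values in $\{0,1,2,\dots\}$. Suppose that for $k=1,\dots,n$ $$\nu_1(k)\le \tfrac1{100},\qquad \nu_2(k)\le \nu_1(k),\qquad \nu_4(k)<\infty,$$ and $$\lambda:=\sum_{k=1}^n\nu_1(k)-1.52\sum_{k=1}^n\nu_2(k)-12\sum_{k=2}^n \mathrm{E}X_{k-1}X_k>0 .$$ Then $$\|F_n-\mathrm{Pois}(\Gamma_1)\|\le C R_0\{1+\Gamma_1\min(1,\lambda^{-1})\}\min(1,\lambda^{-1}),$$ $$\|F_n-\mathrm{Pois}(\Gamma_1)(I+\Gamma_2(I_1-I)^2)\|\le C\{1+\Gamma_1\min(1,\lambda^{-1})\}\bigl(R_0^2\min(1,\lambda^{-2})+R_1\min(1,\lambda^{-3/2})\bigr).$$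
   Context: 1-dependence: for all $1\le s<t$ with $t-s>1$, the sigma-algebras generated by $X_1,\dots,X_s$ and by $X_t,X_{t+1},\dots$ are independent. $F_n$ is the distribution of $S_n=X_1+\dots+X_n$. Convention: $X_k\equiv0$ (hence $\nu_j(k)=0$) for $k\le 0$; empty sums are $0$. Factorial moments: $\nu_j(k)=\mathrm{E}X_k(X_k-1)\cdots(X_k-j+1)$. For random variables $Y_1,Y_2,\dots$ define $\widehat{\mathrm E}(Y_1)=\mathrm EY_1$ and, for $k\ge2$, $\widehat{\mathrm E}(Y_1,\dots,Y_k)=\mathrm EY_1\cdots Y_k-\sum_{j=1}^{k-1}\widehat{\mathrm E}(Y_1,\dots,Y_j)\,\mathrm EY_{j+1}\cdots Y_k$. Similarly $\widehat{\mathrm E}^{+}(Y_1)=\mathrm EY_1$ and $\widehat{\mathrm E}^{+}(Y_1,\dots,Y_k)=\mathrm EY_1\cdots Y_k+\sum_{j=1}^{k-1}\widehat{\mathrm E}^{+}(Y_1,\dots,Y_j)\,\mathrm EY_{j+1}\cdots Y_k$. Also $\widehat{\mathrm E}^{+}_2(X_{k-1},X_k)=\widehat{\mathrm E}^{+}(X_{k-1}(X_{k-1}-1),X_k)+\widehat{\mathrm E}^{+}(X_{k-1},X_k(X_k-1))$. $\Gamma_1=\mathrm ES_n=\sum_{k=1}^n\nu_1(k)$ and $\Gamma_2=\frac12(\mathrm{Var}\,S_n-\mathrm ES_n)=\frac12\sum_{k=1}^n(\nu_2(k)-\nu_1^2(k))+\sum_{k=2}^n\widehat{\mathrm E}(X_{k-1},X_k)$.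 Remainder terms: $$R_0=\sum_{k=1}^n\{\nu_2(k)+\nu_1^2(k)+\mathrm EX_{k-1}X_k\},$$ $$R_1=\sum_{k=1}^n\Big\{\nu_1^3(k)+\nu_1(k)\nu_2(k)+\nu_3(k)+[\nu_1(k-2)+\nu_1(k-1)+\nu_1(k)]\mathrm EX_{k-1}X_k+\widehat{\mathrm E}^{+}_2(X_{k-1},X_k)+\widehat{\mathrm E}^{+}(X_{k-2},X_{k-1},X_k)\Big\}.$$ Measures: $I_a$ is the unit mass at $a$, $I=I_0$; products and powers of measures are convolutions, $M^0=I$, $\exp\{M\}=\sum_{k\ge0}M^k/k!$; $\|M\|=\sum_{k\in\mathbb Z}|M\{k\}|$ is the total variation norm. $\mathrm{Pois}(\Gamma_1)=\exp\{\Gamma_1(I_1-I)\}$. *)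

theory Defs
  imports "HOL-Probability.Probability"
begin

text \<open>
  A finite signed measure on the integers is represented by its point masses, i.e. by an
  (absolutely summable) function \<open>M :: int \<Rightarrow> real\<close>, where \<open>M k\<close> is the mass of \<open>{k}\<close>.
\<close>

type_synonym smeasure = "int \<Rightarrow> real"

definition unit_mass :: "int \<Rightarrow> smeasure" where
  "unit_mass a = (\<lambda>k. if k = a then 1 else 0)"

definition conv :: "smeasure \<Rightarrow> smeasure \<Rightarrow> smeasure" where
  "conv M N = (\<lambda>k. \<Sum>\<^sub>\<infinity>j. M j * N (k - j))"

definition conv_power :: "smeasure \<Rightarrow> nat \<Rightarrow> smeasure" where
  "conv_power M m = (conv M ^^ m) (unit_mass 0)"

text \<open>
  The exponential series converges absolutely in total variation for a finite signed measure;
  hence its sum is also given by the point masses, as below.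
\<close>

definition conv_exp :: "smeasure \<Rightarrow> smeasure" where
  "conv_exp M = (\<lambda>k. \<Sum>m. conv_power M m k / fact m)"

definition tv_norm :: "smeasure \<Rightarrow> real" where
  "tv_norm M = (\<Sum>\<^sub>\<infinity>k. \<bar>M k\<bar>)"

definition Pois :: "real \<Rightarrow> smeasure" where
  "Pois r = conv_exp (\<lambda>k. r * (unit_mass 1 k - unit_mass 0 k))"

definition Pois2 :: "real \<Rightarrow> real \<Rightarrow> smeasure" where
  "Pois2 r g = conv (Pois r)
     (\<lambda>k. unit_mass 0 k + g * conv_power (\<lambda>i. unit_mass 1 i - unit_mass 0 i) 2 k)"

lemma conv_unit_diff:
  "conv (\<lambda>k. r * (unit_mass 1 k - unit_mass 0 k)) N k = r * (N (k - 1) - N k)"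
proof -
  have "conv (\<lambda>k. r * (unit_mass 1 k - unit_mass 0 k)) N k
      = (\<Sum>\<^sub>\<infinity>j\<in>{0,1}. r * (unit_mass 1 j - unit_mass 0 j) * N (k - j))"
    unfolding conv_def by (rule infsum_cong_neutral) (auto simp: unit_mass_def)
  then show ?thesis by (simp add: unit_mass_def algebra_simps)
qed

lemma conv_power_unit_diff:
  "conv_power (\<lambda>k. r * (unit_mass 1 k - unit_mass 0 k)) m k =
     (if k < 0 then 0 else r ^ m * (-1) ^ (m + nat k) * real (m choose nat k))"
proof (induction m arbitrary: k)
  case 0
  then show ?case by (auto simp: conv_power_def unit_mass_def binomial_eq_0)
next
  case (Suc m)
  have *: "conv_power (\<lambda>k. r * (unit_mass 1 k - unit_mass 0 k)) (Suc m) k =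
     r * (conv_power (\<lambda>k. r * (unit_mass 1 k - unit_mass 0 k)) m (k - 1)
        - conv_power (\<lambda>k. r * (unit_mass 1 k - unit_mass 0 k)) m k)"
    by (simp add: conv_power_def conv_unit_diff)
  show ?case
  proof (cases "k \<le> 0")
    case True
    then show ?thesis unfolding * Suc.IH by (cases "k = 0") auto
  next
    case False
    then obtain j where j: "k = int (Suc j)"
      by (metis not_le_imp_less zero_less_imp_eq_int gr0_implies_Suc)
    have n: "nat (int (Suc j)) = Suc j" "nat (int (Suc j) - 1) = j" by auto
    show ?thesis using *[unfolded Suc.IH, unfolded j n] unfolding j n
      by (simp add: algebra_simps del: of_nat_Suc)
  qed
qed

lemma Pois_eq: "Pois r k = (if k < 0 then 0 else exp (- r) * r ^ nat k / fact (nat k))"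
proof (cases "k < 0")
  case True
  then show ?thesis by (simp add: Pois_def conv_exp_def conv_power_unit_diff)
next
  case False
  define j where "j = nat k"
  let ?f = "\<lambda>m. r ^ m * (-1) ^ (m + j) * real (m choose j) / fact m"
  have "(\<lambda>i. r ^ j / fact j * ((- r) ^ i / fact i)) sums (r ^ j / fact j * exp (- r))"
    using exp_converges[of "- r"] by (intro sums_mult) (simp add: field_simps scaleR_conv_of_real)
  moreover have "r ^ j / fact j * ((- r) ^ i / fact i) = ?f (i + j)" for i
  proof -
    have "real (i + j choose j) = fact (i + j) / (fact j * fact i)"
      using binomial_fact[of j "i + j", where ?'a = real] by simp
    moreover have "(- r) ^ i = r ^ i * (-1) ^ (i + j + j)"
      using power_mult_distrib[of "-1" r i] by (simp add: power_add mult.assoc flip: power_mult_distrib)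
    ultimately show ?thesis by (simp add: power_add field_simps)
  qed
  ultimately have "(\<lambda>i. ?f (i + j)) sums (r ^ j / fact j * exp (- r))" by simp
  then have "?f sums (r ^ j / fact j * exp (- r))"
    by (subst (asm) sums_iff_shift) (simp add: binomial_eq_0)
  then show ?thesis using False
    by (simp add: Pois_def conv_exp_def conv_power_unit_diff sums_iff j_def mult.commute)
qed

lemma Pois_poisson_pmf: "r > 0 \<Longrightarrow> Pois r (int k) = pmf (poisson_pmf r) k"
  by (simp add: Pois_eq)


definition generated_sigma :: "'a measure \<Rightarrow> (nat \<Rightarrow> 'a \<Rightarrow> nat) \<Rightarrow> nat set \<Rightarrow> 'a set set" where
  "generated_sigma M X J = sigma_sets (space M) {X i -` A \<inter> space M | i A. i \<in> J}"

definition one_dependent :: "'a measure \<Rightarrow> nat \<Rightarrow> (nat \<Rightarrow> 'a \<Rightarrow> nat) \<Rightarrow> bool" where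
  "one_dependent M n X \<longleftrightarrow>
     (\<forall>k\<in>{1..n}. X k \<in> measurable M (count_space UNIV)) \<and>
     (\<forall>s t. 1 \<le> s \<and> s + 1 < t \<and> t \<le> n \<longrightarrow>
        prob_space.indep_set M (generated_sigma M X {1..s}) (generated_sigma M X {t..n}))"


definition falling :: "nat \<Rightarrow> nat \<Rightarrow> real" where
  "falling j x = (\<Prod>i<j. real x - real i)"

definition \<nu> :: "'a measure \<Rightarrow> (nat \<Rightarrow> 'a \<Rightarrow> nat) \<Rightarrow> nat \<Rightarrow> nat \<Rightarrow> real" where
  "\<nu> M X j k = prob_space.expectation M (\<lambda>\<omega>. falling j (X k \<omega>))"

text \<open>
  \<open>hatE M [Y\<^sub>1, \<dots>, Y\<^sub>k]\<close> and \<open>hatE_plus M [Y\<^sub>1, \<dots>, Y\<^sub>k]\<close>, for \<open>k \<ge> 1\<close>; the values at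
  the empty list are irrelevant.
\<close>

definition mixed_moment :: "'a measure \<Rightarrow> ('a \<Rightarrow> real) list \<Rightarrow> real" where
  "mixed_moment M Ys = prob_space.expectation M (\<lambda>\<omega>. \<Prod>Y\<leftarrow>Ys. Y \<omega>)"

function hatE :: "'a measure \<Rightarrow> ('a \<Rightarrow> real) list \<Rightarrow> real" where
  "hatE M Ys = mixed_moment M Ys
     - (\<Sum>j\<in>{1..<length Ys}. hatE M (take j Ys) * mixed_moment M (drop j Ys))"
  by auto
termination by (relation "Wellfounded.measure (\<lambda>(M, Ys). length Ys)") auto

function hatE_plus :: "'a measure \<Rightarrow> ('a \<Rightarrow> real) list \<Rightarrow> real" where
  "hatE_plus M Ys = mixed_moment M Ys
     + (\<Sum>j\<in>{1..<length Ys}. hatE_plus M (take j Ys) * mixed_moment M (drop j Ys))"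
  by auto
termination by (relation "Wellfounded.measure (\<lambda>(M, Ys). length Ys)") auto

declare hatE.simps [simp del] hatE_plus.simps [simp del]

definition hatE_plus2 :: "'a measure \<Rightarrow> ('a \<Rightarrow> nat) \<Rightarrow> ('a \<Rightarrow> nat) \<Rightarrow> real" where
  "hatE_plus2 M Y Z =
     hatE_plus M [\<lambda>\<omega>. real (Y \<omega>) * (real (Y \<omega>) - 1), \<lambda>\<omega>. real (Z \<omega>)] +
     hatE_plus M [\<lambda>\<omega>. real (Y \<omega>), \<lambda>\<omega>. real (Z \<omega>) * (real (Z \<omega>) - 1)]"


definition S_n :: "(nat \<Rightarrow> 'a \<Rightarrow> nat) \<Rightarrow> nat \<Rightarrow> 'a \<Rightarrow> nat" where
  "S_n X n \<omega> = (\<Sum>k=1..n. X k \<omega>)"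

definition F_n :: "'a measure \<Rightarrow> (nat \<Rightarrow> 'a \<Rightarrow> nat) \<Rightarrow> nat \<Rightarrow> smeasure" where
  "F_n M X n = (\<lambda>k. measure (distr M (count_space UNIV) (\<lambda>\<omega>. int (S_n X n \<omega>))) {k})"

definition \<Gamma>1 :: "'a measure \<Rightarrow> (nat \<Rightarrow> 'a \<Rightarrow> nat) \<Rightarrow> nat \<Rightarrow> real" where
  "\<Gamma>1 M X n = prob_space.expectation M (\<lambda>\<omega>. real (S_n X n \<omega>))"

definition \<Gamma>2 :: "'a measure \<Rightarrow> (nat \<Rightarrow> 'a \<Rightarrow> nat) \<Rightarrow> nat \<Rightarrow> real" where
  "\<Gamma>2 M X n = 1/2 * (prob_space.variance M (\<lambda>\<omega>. real (S_n X n \<omega>))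
                     - prob_space.expectation M (\<lambda>\<omega>. real (S_n X n \<omega>)))"

lemma hatE_pair:
  "hatE M [Y, Z] = prob_space.expectation M (\<lambda>\<omega>. Y \<omega> * Z \<omega>)
     - prob_space.expectation M Y * prob_space.expectation M Z"
  by (simp add: hatE.simps[of M "[Y, Z]"] hatE.simps[of M "[Y]"] mixed_moment_def)

lemma (in prob_space) one_dependent_uncorrelated:
  assumes "one_dependent M n X" "1 \<le> i" "i + 1 < j" "j \<le> n"
  assumes "integrable M (\<lambda>\<omega>. real (X i \<omega>))" "integrable M (\<lambda>\<omega>. real (X j \<omega>))"
  shows "expectation (\<lambda>\<omega>. real (X i \<omega>) * real (X j \<omega>))
       = expectation (\<lambda>\<omega>. real (X i \<omega>)) * expectation (\<lambda>\<omega>. real (X j \<omega>))"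
proof (rule indep_var_lebesgue_integral)
  have rv: "random_variable (count_space UNIV) (X i)" "random_variable (count_space UNIV) (X j)"
    using assms(1-4) by (auto simp: one_dependent_def)
  have ind: "indep_set (generated_sigma M X {1..i}) (generated_sigma M X {j..n})"
    using assms(1-4) by (auto simp: one_dependent_def)
  have sub: "sigma_sets (space M) {X k -` A \<inter> space M |A. A \<in> sets (count_space UNIV)}
      \<subseteq> generated_sigma M X J" if "k \<in> J" for k J
    unfolding generated_sigma_def using that by (intro sigma_sets_mono') auto
  have "indep_var (count_space UNIV) (X i) (count_space UNIV) (X j)"
    unfolding indep_var_eq
  proof (intro conjI rv)
    have "i \<in> {1..i}" "j \<in> {j..n}" using assms(2,4) by auto
    from sub[OF this(1)] sub[OF this(2)] ind
    show "indep_set (sigma_sets (space M) {X i -` A \<inter> space M |A. A \<in> sets (count_space UNIV)})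
        (sigma_sets (space M) {X j -` A \<inter> space M |A. A \<in> sets (count_space UNIV)})"
      unfolding indep_sets2_eq by blast
  qed
  from indep_var_compose[OF this, of real borel real borel]
  show "indep_var borel (\<lambda>\<omega>. real (X i \<omega>)) borel (\<lambda>\<omega>. real (X j \<omega>))"
    by (simp add: comp_def)
qed (use assms in auto)

lemma (in prob_space)
  assumes dep: "one_dependent M n X"
  assumes sq: "\<And>k. k \<in> {1..n} \<Longrightarrow> integrable M (\<lambda>\<omega>. (real (X k \<omega>))\<^sup>2)"
  shows \<Gamma>1_eq: "\<Gamma>1 M X n = (\<Sum>k=1..n. \<nu> M X 1 k)"
    and \<Gamma>2_eq: "\<Gamma>2 M X n = 1/2 * (\<Sum>k=1..n. \<nu> M X 2 k - (\<nu> M X 1 k)\<^sup>2)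
       + (\<Sum>k=2..n. hatE M [\<lambda>\<omega>. real (X (k-1) \<omega>), \<lambda>\<omega>. real (X k \<omega>)])"
proof -
  let ?Y = "\<lambda>k \<omega>. real (X k \<omega>)"
  have meas: "?Y k \<in> borel_measurable M" if "k \<in> {1..n}" for k
  proof -
    have "X k \<in> measurable M (count_space UNIV)" using dep that by (simp add: one_dependent_def)
    then show ?thesis by (rule measurable_compose) simp
  qed
  have int: "integrable M (?Y k)" if "k \<in> {1..n}" for k
    using square_integrable_imp_integrable[OF meas[OF that]] sq[OF that] by simp
  have int2: "integrable M (\<lambda>\<omega>. ?Y i \<omega> * ?Y j \<omega>)" if "i \<in> {1..n}" "j \<in> {1..n}" for i j
  proof (rule Bochner_Integration.integrable_bound)
    show "integrable M (\<lambda>\<omega>. (?Y i \<omega>)\<^sup>2 + (?Y j \<omega>)\<^sup>2)" using sq that by auto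
    show "(\<lambda>\<omega>. ?Y i \<omega> * ?Y j \<omega>) \<in> borel_measurable M" using meas that by auto
    have "a * b \<le> a\<^sup>2 + b\<^sup>2" for a b :: real
    proof -
      have "2 * (a * b) \<le> a\<^sup>2 + b\<^sup>2" using sum_squares_bound[of a b] by (simp add: mult.assoc)
      moreover have "0 \<le> a\<^sup>2 + b\<^sup>2" by simp
      ultimately show ?thesis by linarith
    qed
    then show "AE \<omega> in M. norm (?Y i \<omega> * ?Y j \<omega>) \<le> norm ((?Y i \<omega>)\<^sup>2 + (?Y j \<omega>)\<^sup>2)"
      by (auto simp: abs_mult)
  qed
  have nu1: "\<nu> M X 1 k = expectation (?Y k)" for k by (simp add: \<nu>_def falling_def)
  have nu2: "\<nu> M X 2 k = expectation (\<lambda>\<omega>. ?Y k \<omega> * ?Y k \<omega>) - expectation (?Y k)"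
    if "k \<in> {1..n}" for k
  proof -
    have "falling 2 x = real x * real x - real x" for x
      by (simp add: falling_def numeral_2_eq_2 algebra_simps)
    then show ?thesis using int[OF that] int2[OF that that] by (simp add: \<nu>_def)
  qed
  have S: "real (S_n X n \<omega>) = (\<Sum>k=1..n. ?Y k \<omega>)" for \<omega> by (simp add: S_n_def)
  have ES: "expectation (\<lambda>\<omega>. real (S_n X n \<omega>)) = (\<Sum>k=1..n. expectation (?Y k))"
    unfolding S by (intro Bochner_Integration.integral_sum int)
  then show "\<Gamma>1 M X n = (\<Sum>k=1..n. \<nu> M X 1 k)" unfolding \<Gamma>1_def nu1 .
  define c where "c i j = expectation (\<lambda>\<omega>. ?Y i \<omega> * ?Y j \<omega>) - expectation (?Y i) * expectation (?Y j)" for i j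
  have c_sym: "c i j = c j i" for i j by (simp add: c_def mult.commute)
  have c0: "c i j = 0" if "1 \<le> i" "i + 1 < j" "j \<le> n" for i j
    using one_dependent_uncorrelated[OF dep that int int] that by (simp add: c_def)
  have SS: "(real (S_n X n \<omega>))\<^sup>2 = (\<Sum>i=1..n. \<Sum>j=1..n. ?Y i \<omega> * ?Y j \<omega>)" for \<omega>
    unfolding S power2_eq_square by (rule sum_product)
  have "variance (\<lambda>\<omega>. real (S_n X n \<omega>)) =
      expectation (\<lambda>\<omega>. (real (S_n X n \<omega>))\<^sup>2) - (expectation (\<lambda>\<omega>. real (S_n X n \<omega>)))\<^sup>2"
  proof (rule variance_eq)
    show "integrable M (\<lambda>\<omega>. real (S_n X n \<omega>))" unfolding S by (intro Bochner_Integration.integrable_sum int)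
    show "integrable M (\<lambda>\<omega>. (real (S_n X n \<omega>))\<^sup>2)"
      unfolding SS by (intro Bochner_Integration.integrable_sum int2)
  qed
  also have "expectation (\<lambda>\<omega>. (real (S_n X n \<omega>))\<^sup>2) = (\<Sum>i=1..n. \<Sum>j=1..n. expectation (\<lambda>\<omega>. ?Y i \<omega> * ?Y j \<omega>))"
  proof -
    have "expectation (\<lambda>\<omega>. \<Sum>i=1..n. \<Sum>j=1..n. ?Y i \<omega> * ?Y j \<omega>)
        = (\<Sum>i=1..n. expectation (\<lambda>\<omega>. \<Sum>j=1..n. ?Y i \<omega> * ?Y j \<omega>))"
      by (intro Bochner_Integration.integral_sum Bochner_Integration.integrable_sum int2)
    also have "\<dots> = (\<Sum>i=1..n. \<Sum>j=1..n. expectation (\<lambda>\<omega>. ?Y i \<omega> * ?Y j \<omega>))"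
      by (intro sum.cong refl Bochner_Integration.integral_sum int2)
    finally show ?thesis unfolding SS .
  qed
  also have "(expectation (\<lambda>\<omega>. real (S_n X n \<omega>)))\<^sup>2
      = (\<Sum>i=1..n. \<Sum>j=1..n. expectation (?Y i) * expectation (?Y j))"
    unfolding ES power2_eq_square by (rule sum_product)
  finally have var: "variance (\<lambda>\<omega>. real (S_n X n \<omega>)) = (\<Sum>i=1..n. \<Sum>j=1..n. c i j)"
    by (simp add: c_def sum_subtractf)
  have dbl: "(\<Sum>i=1..m. \<Sum>j=1..m. c i j) = (\<Sum>k=1..m. c k k) + 2 * (\<Sum>k=2..m. c (k-1) k)" if "m \<le> n" for m
    using that
  proof (induction m)
    case (Suc m)
    have last: "(\<Sum>i=1..m. c i (Suc m)) = (if m = 0 then 0 else c m (Suc m))"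
    proof (cases m)
      case (Suc l)
      have "(\<Sum>i=1..l. c i (Suc m)) = 0"
        using Suc.prems \<open>m = Suc l\<close> \<open>Suc m \<le> n\<close> by (intro sum.neutral ballI c0) auto
      then show ?thesis using Suc by simp
    qed simp
    have "(\<Sum>i=1..Suc m. \<Sum>j=1..Suc m. c i j) =
        (\<Sum>i=1..m. \<Sum>j=1..m. c i j) + (\<Sum>i=1..m. c i (Suc m)) + (\<Sum>j=1..m. c (Suc m) j) + c (Suc m) (Suc m)"
      by (simp add: sum.distrib)
    also have "(\<Sum>j=1..m. c (Suc m) j) = (\<Sum>i=1..m. c i (Suc m))"
      by (intro sum.cong refl c_sym)
    finally show ?case using Suc.IH Suc.prems last by (cases m) simp_all
  qed simp
  have "\<Gamma>2 M X n = 1/2 * ((\<Sum>k=1..n. c k k) - (\<Sum>k=1..n. expectation (?Y k))) + (\<Sum>k=2..n. c (k-1) k)"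
    unfolding \<Gamma>2_def var unfolding dbl[OF order_refl] ES by (simp add: algebra_simps)
  also have "(\<Sum>k=1..n. c k k) - (\<Sum>k=1..n. expectation (?Y k)) = (\<Sum>k=1..n. \<nu> M X 2 k - (\<nu> M X 1 k)\<^sup>2)"
    unfolding sum_subtractf[symmetric]
    by (intro sum.cong refl) (simp only: nu1 nu2, simp add: c_def power2_eq_square)
  also have "(\<Sum>k=2..n. c (k-1) k) = (\<Sum>k=2..n. hatE M [?Y (k-1), ?Y k])"
    by (simp add: c_def hatE_pair)
  finally show "\<Gamma>2 M X n = 1/2 * (\<Sum>k=1..n. \<nu> M X 2 k - (\<nu> M X 1 k)\<^sup>2)
       + (\<Sum>k=2..n. hatE M [\<lambda>\<omega>. real (X (k-1) \<omega>), \<lambda>\<omega>. real (X k \<omega>)])" .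
qed

definition EXX :: "'a measure \<Rightarrow> (nat \<Rightarrow> 'a \<Rightarrow> nat) \<Rightarrow> nat \<Rightarrow> real" where
  "EXX M X k = prob_space.expectation M (\<lambda>\<omega>. real (X (k-1) \<omega>) * real (X k \<omega>))"

definition lam :: "'a measure \<Rightarrow> (nat \<Rightarrow> 'a \<Rightarrow> nat) \<Rightarrow> nat \<Rightarrow> real" where
  "lam M X n = (\<Sum>k=1..n. \<nu> M X 1 k) - 1.52 * (\<Sum>k=1..n. \<nu> M X 2 k) - 12 * (\<Sum>k=2..n. EXX M X k)"

text \<open>
  In the remainder terms the indices \<open>k - 1\<close> and \<open>k - 2\<close> are truncated at \<open>0\<close>. As \<open>X 0\<close> will be
  required to be identically \<open>0\<close>, this realises the convention that \<open>X\<^sub>k\<close> vanishes for all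
  integers \<open>k \<le> 0\<close>.
\<close>

definition R0 :: "'a measure \<Rightarrow> (nat \<Rightarrow> 'a \<Rightarrow> nat) \<Rightarrow> nat \<Rightarrow> real" where
  "R0 M X n = (\<Sum>k=1..n. \<nu> M X 2 k + (\<nu> M X 1 k)^2 + EXX M X k)"

definition R1 :: "'a measure \<Rightarrow> (nat \<Rightarrow> 'a \<Rightarrow> nat) \<Rightarrow> nat \<Rightarrow> real" where
  "R1 M X n = (\<Sum>k=1..n.
       (\<nu> M X 1 k)^3 + \<nu> M X 1 k * \<nu> M X 2 k + \<nu> M X 3 k
     + (\<nu> M X 1 (k-2) + \<nu> M X 1 (k-1) + \<nu> M X 1 k) * EXX M X k
     + hatE_plus2 M (X (k-1)) (X k)
     + hatE_plus M [\<lambda>\<omega>. real (X (k-2) \<omega>), \<lambda>\<omega>. real (X (k-1) \<omega>), \<lambda>\<omega>. real (X k \<omega>)])"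

text \<open>
  \<open>valid_constant TYPE('a) C\<close>: both estimates hold with the constant \<open>C\<close> for all \<open>n\<close> and all
  1-dependent random variables defined on a probability space with carrier type \<open>'a\<close>.
  HOL cannot quantify over types inside a formula, so an absolute constant, independent of the
  underlying probability space, is expressed in two parts: a valid \<open>C > 0\<close> exists for the type
  \<open>nat\<close> (which carries every joint law of finitely many \<open>nat\<close>-valued variables), and each
  constant valid for \<open>nat\<close> is valid for an arbitrary type \<open>'a\<close>.

  \<open>integrable\<close> of the nonnegative \<open>falling 4 (X k \<omega>)\<close> expresses finiteness of the fourth
  factorial moment; all other expectations below then exist as well.
\<close>

definition valid_constant :: "'a itself \<Rightarrow> real \<Rightarrow> bool" where
  "valid_constant _ C \<longleftrightarrow>
    (\<forall>n\<ge>1. \<forall>(M :: 'a measure) X.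
       prob_space M \<and> one_dependent M n X \<and> X 0 = (\<lambda>_. 0) \<and>
       (\<forall>k\<in>{1..n}. \<nu> M X 1 k \<le> 1/100 \<and> \<nu> M X 2 k \<le> \<nu> M X 1 k \<and>
                   integrable M (\<lambda>\<omega>. falling 4 (X k \<omega>))) \<and>
       lam M X n > 0 \<longrightarrow>
       tv_norm (\<lambda>k. F_n M X n k - Pois (\<Gamma>1 M X n) k)
         \<le> C * R0 M X n * (1 + \<Gamma>1 M X n * min 1 (1 / lam M X n)) * min 1 (1 / lam M X n) \<and>
       tv_norm (\<lambda>k. F_n M X n k - Pois2 (\<Gamma>1 M X n) (\<Gamma>2 M X n) k)
         \<le> C * (1 + \<Gamma>1 M X n * min 1 (1 / lam M X n)) *
           ((R0 M X n)^2 * min 1 (lam M X n powr (-2)) + R1 M X n * min 1 (lam M X n powr (-3/2))))"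

end

theory Submission
  imports Defs "HOL-Computational_Algebra.Formal_Power_Series"
begin

text \<open>
  Measures on the nonnegative integers form the Banach algebra \<open>l1\<close> under convolution and the
  total variation norm, and all estimates are made there, without characteristic functions.
  With \<open>u = I\<^sub>1 - I\<close> and \<open>Z\<^sub>k\<close> the unit mass at \<open>X\<^sub>k\<close> minus \<open>I\<close>, 1-dependence gives the
  renewal equation \<open>F\<^sub>k = F\<^sub>k\<^sub>-\<^sub>1 + \<Sum>\<^sub>j\<^sub>\<le>\<^sub>k F\<^sub>j\<^sub>-\<^sub>2 * E (Z\<^sub>j \<cdots> Z\<^sub>k)\<close>. As the means are at most \<open>1/100\<close>, it is
  solved by a product of factors \<open>\<phi>\<^sub>k\<close> close to \<open>I\<close> (Heinrich's method), and
  \<open>\<phi>\<^sub>k = exp (\<nu>\<^sub>1(k) u) (I + u\<^sup>2 \<sigma>\<^sub>k)\<close>, where \<open>\<sigma>\<^sub>k = g\<^sub>k I + u \<rho>\<^sub>k\<close>, the numbers \<open>g\<^sub>k\<close> add up to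
  \<open>\<Gamma>\<^sub>2\<close>, and the norms of \<open>\<sigma>\<^sub>k\<close> and \<open>\<rho>\<^sub>k\<close> are controlled by \<open>R\<^sub>0\<close> and \<open>R\<^sub>1\<close>. Expanding the product of the
  \<open>I + u\<^sup>2 \<sigma>\<^sub>k\<close> leaves terms \<open>u\<^sup>2\<^sup>r exp (\<Gamma>\<^sub>1 u) e\<^sub>r\<close> with \<open>norm e\<^sub>r \<le> s\<^sup>r / r!\<close> and
  \<open>s = \<Sum> norm \<sigma>\<^sub>k\<close>. Orthogonality of the Charlier polynomials gives
  \<open>norm (u\<^sup>m exp (\<Gamma>\<^sub>1 u)) \<le> sqrt (m! / \<Gamma>\<^sub>1\<^sup>m)\<close>, so the series over \<open>r\<close> is dominated by a geometric one
  with ratio \<open>2 s / \<Gamma>\<^sub>1\<close>, which \<open>\<lambda> > 0\<close> forces to be at most \<open>19/20\<close>.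
\<close>

subsection \<open>The Banach algebra of absolutely summable sequences\<close>

text \<open>A remainder is worth only as much as the power of \<open>u\<close> it carries, because
  it is the powers of \<open>u\<close> that meet the Poisson factor and gain negative powers of its
  mean. Hence every expansion is an exact identity with \<open>u\<close> factored out, and norms are
  taken only of the cofactors. Splitting off an exponential from each factor removes the first-order
  term, so that \<open>u^2\<close> is the lowest power left; commutativity then collects all powers
  of \<open>u\<close> in front of one Poisson law. The constants 1.52 and 12 belong to the ratio of
  the geometric series: the norm of \<sigma>(k) is at most about 0.57 \<nu>2(k) + 4.91 E X(k-1)X(k)
  plus squares of means. Twice the sum of this has to stay below the Poisson mean, with room for the
  squares, which the bound 1/100 reduces to about a ninth of that mean. The same 1/100 beats the
  norm 2 of \<open>u\<close>: a block of p factors \<open>Z\<close> has a mean of order 5^(-p), so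
  all Heinrich factors stay within 1/10 of \<open>I\<close>. The estimates come out with the Poisson
  mean in the place of \<lambda>, and \<lambda> is at most that mean.\<close>

typedef l1 = "{f :: real fps. summable (\<lambda>n. \<bar>fps_nth f n\<bar>)}"
  by (rule exI[of _ 0]) simp

setup_lifting type_definition_l1

text \<open>The Cauchy product of the absolute values dominates, which yields closure under products
  and submultiplicativity of the norm together.\<close>

lemma summable_abs_fps_mult:
  fixes f g :: "real fps"
  assumes "summable (\<lambda>n. \<bar>fps_nth f n\<bar>)" "summable (\<lambda>n. \<bar>fps_nth g n\<bar>)"
  shows "summable (\<lambda>n. \<bar>fps_nth (f * g) n\<bar>)"
    and "(\<Sum>n. \<bar>fps_nth (f * g) n\<bar>) \<le> (\<Sum>n. \<bar>fps_nth f n\<bar>) * (\<Sum>n. \<bar>fps_nth g n\<bar>)"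
proof -
  let ?p = "\<lambda>k. \<Sum>i\<le>k. \<bar>fps_nth f i\<bar> * \<bar>fps_nth g (k - i)\<bar>"
  have p: "summable ?p" "(\<Sum>k. ?p k) = (\<Sum>n. \<bar>fps_nth f n\<bar>) * (\<Sum>n. \<bar>fps_nth g n\<bar>)"
    using summable_Cauchy_product[of "\<lambda>n. \<bar>fps_nth f n\<bar>" "\<lambda>n. \<bar>fps_nth g n\<bar>"]
      Cauchy_product[of "\<lambda>n. \<bar>fps_nth f n\<bar>" "\<lambda>n. \<bar>fps_nth g n\<bar>"] assms by simp_all
  have le: "\<bar>fps_nth (f * g) k\<bar> \<le> ?p k" for k
    unfolding fps_mult_nth atLeast0AtMost by (rule order_trans[OF sum_abs]) (simp add: abs_mult)
  show s: "summable (\<lambda>n. \<bar>fps_nth (f * g) n\<bar>)"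
    by (rule summable_comparison_test[OF _ p(1)]) (use le in auto)
  show "(\<Sum>n. \<bar>fps_nth (f * g) n\<bar>) \<le> (\<Sum>n. \<bar>fps_nth f n\<bar>) * (\<Sum>n. \<bar>fps_nth g n\<bar>)"
    using suminf_le[OF le s p(1)] p(2) by simp
qed

lemma summable_abs_add:
  fixes f g :: "nat \<Rightarrow> real"
  assumes "summable (\<lambda>n. \<bar>f n\<bar>)" "summable (\<lambda>n. \<bar>g n\<bar>)"
  shows "summable (\<lambda>n. \<bar>f n + g n\<bar>)"
  by (rule summable_comparison_test[OF _ summable_add[OF assms]]) auto

lemma summable_abs_diff:
  fixes f g :: "nat \<Rightarrow> real"
  assumes "summable (\<lambda>n. \<bar>f n\<bar>)" "summable (\<lambda>n. \<bar>g n\<bar>)"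
  shows "summable (\<lambda>n. \<bar>f n - g n\<bar>)"
  using summable_abs_add[of f "\<lambda>n. - g n"] assms by simp

text \<open>With formal power series as representatives the ring laws transfer; only closure under
  products needs a real argument.\<close>

instantiation l1 :: comm_ring_1
begin

lift_definition zero_l1 :: l1 is 0 by simp
lift_definition one_l1 :: l1 is 1
  by (rule summable_finite[of "{0}"]) auto
lift_definition plus_l1 :: "l1 \<Rightarrow> l1 \<Rightarrow> l1" is "(+)" by (simp add: summable_abs_add)
lift_definition minus_l1 :: "l1 \<Rightarrow> l1 \<Rightarrow> l1" is "(-)" by (simp add: summable_abs_diff)
lift_definition uminus_l1 :: "l1 \<Rightarrow> l1" is uminus by simp
lift_definition times_l1 :: "l1 \<Rightarrow> l1 \<Rightarrow> l1" is "(*)" by (rule summable_abs_fps_mult)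

instance by standard (transfer, simp add: algebra_simps)+

end

lift_definition coord :: "l1 \<Rightarrow> nat \<Rightarrow> real" is fps_nth .

lemma l1_eqI: "(\<And>n. coord f n = coord g n) \<Longrightarrow> f = g"
  by transfer (simp add: fps_eq_iff)

lemma summable_coord: "summable (\<lambda>n. \<bar>coord f n\<bar>)"
  by transfer

lemma ex_l1:
  assumes "summable (\<lambda>n. \<bar>f n\<bar>)"
  shows "\<exists>g. coord g = f"
  using assms by (intro exI[of _ "Abs_l1 (Abs_fps f)"]) (simp add: coord.rep_eq Abs_l1_inverse fps_nth_Abs_fps[abs_def])

lemma coord_add [simp]: "coord (f + g) n = coord f n + coord g n"
  by transfer simp
lemma coord_diff [simp]: "coord (f - g) n = coord f n - coord g n"
  by transfer simp
lemma coord_zero [simp]: "coord 0 n = 0"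
  by transfer simp
lemma coord_one: "coord 1 n = (if n = 0 then 1 else 0)"
  by transfer simp
lemma coord_mult: "coord (f * g) n = (\<Sum>i\<le>n. coord f i * coord g (n - i))"
  by transfer (simp add: fps_mult_nth atLeast0AtMost)

instantiation l1 :: real_algebra_1
begin

lift_definition scaleR_l1 :: "real \<Rightarrow> l1 \<Rightarrow> l1" is "\<lambda>c f. fps_const c * f"
  by (simp add: abs_mult summable_mult)

instance
proof
  fix a b :: real and x y z :: l1
  show "a *\<^sub>R (x + y) = a *\<^sub>R x + a *\<^sub>R y" "(a + b) *\<^sub>R x = a *\<^sub>R x + b *\<^sub>R x"
    "a *\<^sub>R b *\<^sub>R x = (a * b) *\<^sub>R x" "1 *\<^sub>R x = x"
    by (transfer; simp add: algebra_simps fps_const_add[symmetric] fps_const_mult[symmetric]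
        del: fps_const_add fps_const_mult)+
  show "(a *\<^sub>R x) * y = a *\<^sub>R (x * y)" "x * (a *\<^sub>R y) = a *\<^sub>R (x * y)"
    by (transfer; simp add: algebra_simps)+
qed

end

instantiation l1 :: real_normed_algebra_1
begin

lift_definition norm_l1 :: "l1 \<Rightarrow> real" is "\<lambda>f. \<Sum>n. \<bar>fps_nth f n\<bar>" .
definition dist_l1 :: "l1 \<Rightarrow> l1 \<Rightarrow> real" where "dist_l1 f g = norm (f - g)"
definition sgn_l1 :: "l1 \<Rightarrow> l1" where "sgn_l1 f = f /\<^sub>R norm f"
definition uniformity_l1 :: "(l1 \<times> l1) filter"
  where "uniformity_l1 = (INF e\<in>{0<..}. principal {(x, y). dist x y < e})"
definition open_l1 :: "l1 set \<Rightarrow> bool"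
  where "open_l1 S = (\<forall>x\<in>S. \<forall>\<^sub>F (x', y) in uniformity. x' = x \<longrightarrow> y \<in> S)"

instance
proof
  fix a :: real and x y :: l1
  show "(norm x = 0) = (x = 0)"
    by transfer (simp add: suminf_eq_zero_iff fps_eq_iff)
  show "norm (x + y) \<le> norm x + norm y"
  proof transfer
    fix x y :: "real fps"
    assume s: "summable (\<lambda>n. \<bar>fps_nth x n\<bar>)" "summable (\<lambda>n. \<bar>fps_nth y n\<bar>)"
    show "(\<Sum>n. \<bar>fps_nth (x + y) n\<bar>) \<le> (\<Sum>n. \<bar>fps_nth x n\<bar>) + (\<Sum>n. \<bar>fps_nth y n\<bar>)"
      unfolding suminf_add[OF s]
      by (rule suminf_le) (auto intro: summable_abs_add summable_add s)
  qed
  show "norm (a *\<^sub>R x) = \<bar>a\<bar> * norm x"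
    by transfer (simp add: abs_mult suminf_mult)
  show "norm (x * y) \<le> norm x * norm y"
    by transfer (rule summable_abs_fps_mult)
  show "norm (1 :: l1) = 1"
  proof transfer
    show "(\<Sum>n. \<bar>fps_nth (1 :: real fps) n\<bar>) = 1"
      by (subst suminf_finite[of "{0}"]) auto
  qed
qed (simp_all add: dist_l1_def sgn_l1_def uniformity_l1_def open_l1_def)

end

lemma norm_l1_eq: "norm f = (\<Sum>n. \<bar>coord f n\<bar>)"
  by transfer simp

lemma coord_scaleR [simp]: "coord (c *\<^sub>R f) n = c * coord f n"
  by transfer simp

lemma sum_abs_coord_le: "(\<Sum>i<n. \<bar>coord f i\<bar>) \<le> norm f"
  unfolding norm_l1_eq by (intro sum_le_suminf summable_coord) auto

lemma abs_coord_le: "\<bar>coord f i\<bar> \<le> norm f"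
proof -
  have "0 \<le> (\<Sum>i<i. \<bar>coord f i\<bar>)" by (rule sum_nonneg) simp
  then show ?thesis using sum_abs_coord_le[of f "Suc i"] by (simp only: sum.lessThan_Suc)
qed

lemma bounded_linear_coord: "bounded_linear (\<lambda>f. coord f i)"
  by (rule bounded_linear_intro[of _ 1]) (auto simp: abs_coord_le)

lemma norm_l1_leI:
  assumes "\<And>n. (\<Sum>i<n. \<bar>coord f i\<bar>) \<le> B"
  shows "norm f \<le> B"
  unfolding norm_l1_eq using suminf_le_const[OF summable_coord] assms by blast

text \<open>Coordinates converge, and the Cauchy bound passes to the limit in each finite partial
  sum. As it is uniform in the length \<open>K\<close>, it is a bound for the norm.\<close>

instance l1 :: banach
proof
  fix F :: "nat \<Rightarrow> l1"
  assume C: "Cauchy F"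
  define g where "g i = lim (\<lambda>n. coord (F n) i)" for i
  have g: "(\<lambda>n. coord (F n) i) \<longlonglongrightarrow> g i" for i
    unfolding g_def using bounded_linear.Cauchy[OF bounded_linear_coord C]
    by (intro iffD1[OF convergent_LIMSEQ_iff] Cauchy_convergent)
  have bnd: "\<exists>N. \<forall>m\<ge>N. \<forall>K. (\<Sum>i<K. \<bar>coord (F m) i - g i\<bar>) \<le> e" if "e > 0" for e
  proof -
    obtain N where N: "\<And>m n. m \<ge> N \<Longrightarrow> n \<ge> N \<Longrightarrow> norm (F m - F n) < e"
      using CauchyD[OF C \<open>e > 0\<close>] by blast
    have "(\<Sum>i<K. \<bar>coord (F m) i - g i\<bar>) \<le> e" if "m \<ge> N" for m K
    proof (rule tendsto_upperbound)
      show "(\<lambda>n. \<Sum>i<K. \<bar>coord (F m) i - coord (F n) i\<bar>) \<longlonglongrightarrow> (\<Sum>i<K. \<bar>coord (F m) i - g i\<bar>)"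
        by (intro tendsto_intros g)
      show "\<forall>\<^sub>F n in sequentially. (\<Sum>i<K. \<bar>coord (F m) i - coord (F n) i\<bar>) \<le> e"
        using eventually_ge_at_top[of N]
      proof eventually_elim
        case (elim n)
        show ?case using sum_abs_coord_le[where f = "F m - F n" and n = K] N[OF that elim] by simp
      qed
    qed simp
    then show ?thesis by blast
  qed
  obtain N where N: "\<And>K. (\<Sum>i<K. \<bar>coord (F N) i - g i\<bar>) \<le> 1"
    using bnd[of 1] by auto
  have "summable (\<lambda>i. \<bar>coord (F N) i - g i\<bar>)"
    by (rule summableI_nonneg_bounded[of _ 1]) (use N in auto)
  from summable_abs_diff[OF summable_coord[of "F N"] this]
  obtain G where G: "coord G = g" using ex_l1[of g] by auto
  have "F \<longlonglongrightarrow> G"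
  proof (rule LIMSEQ_I)
    fix e :: real assume "e > 0"
    then obtain N where N: "\<And>m K. m \<ge> N \<Longrightarrow> (\<Sum>i<K. \<bar>coord (F m) i - g i\<bar>) \<le> e / 2"
      using bnd[of "e / 2"] by auto
    have "norm (F m - G) < e" if "m \<ge> N" for m
      using norm_l1_leI[of "F m - G" "e / 2"] N[OF that] \<open>e > 0\<close> by (force simp: G)
    then show "\<exists>no. \<forall>n\<ge>no. norm (F n - G) < e" by blast
  qed
  then show "convergent F" by (rule convergentI)
qed

section \<open>Separability of the algebra\<close>

definition trunc :: "(nat \<Rightarrow> real) \<Rightarrow> nat \<Rightarrow> l1" where
  "trunc f N = (SOME g. coord g = (\<lambda>i. if i < N then f i else 0))"

lemma coord_trunc: "coord (trunc f N) = (\<lambda>i. if i < N then f i else 0)"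
  unfolding trunc_def
proof (rule someI_ex, rule ex_l1)
  show "summable (\<lambda>n. \<bar>if n < N then f n else 0\<bar>)"
    by (rule summable_finite[of "{..<N}"]) auto
qed

lemma l1_countable_dense:
  obtains D :: "l1 set" where "countable D" "\<And>f e. e > 0 \<Longrightarrow> \<exists>g\<in>D. norm (f - g) < e"
proof
  let ?D = "(\<lambda>xs :: rat list. trunc (\<lambda>i. of_rat (xs ! i)) (length xs)) ` UNIV"
  show "countable ?D" by simp
  fix f :: l1 and e :: real assume e: "e > 0"
  have "(\<lambda>n. \<Sum>i<n. \<bar>coord f i\<bar>) \<longlonglongrightarrow> norm f"
    unfolding norm_l1_eq using summable_LIMSEQ[OF summable_coord] .
  from LIMSEQ_D[OF this, of "e/3"] e obtain N
    where N: "\<And>n. n \<ge> N \<Longrightarrow> norm ((\<Sum>i<n. \<bar>coord f i\<bar>) - norm f) < e/3" by auto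
  \<comment> \<open>The first \<open>N\<close> coordinates together are off by at most
    \<open>e / 3\<close>; \<open>Suc N\<close> keeps the quotient meaningful for
    \<open>N = 0\<close>.\<close>
  define d where "d = e / (3 * real (Suc N))"
  have d: "d > 0" using e by (simp add: d_def)
  have "\<exists>q :: rat. \<bar>coord f i - of_rat q\<bar> < d" for i
  proof -
    obtain q where "coord f i - d < of_rat q" "of_rat q < coord f i + d"
      using of_rat_dense[of "coord f i - d" "coord f i + d"] d by auto
    then show ?thesis by (intro exI[of _ q]) auto
  qed
  then obtain q where q: "\<And>i. \<bar>coord f i - of_rat (q i)\<bar> < d" by metis
  let ?xs = "map q [0..<N]"
  let ?g = "trunc (\<lambda>i. of_rat (?xs ! i)) (length ?xs)"
  have "norm (f - ?g) \<le> 2 * (e / 3)"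
  proof (rule norm_l1_leI)
    fix n
    have "(\<Sum>i<n. \<bar>coord (f - ?g) i\<bar>) \<le> (\<Sum>i<max n N. \<bar>coord (f - ?g) i\<bar>)"
      by (intro sum_mono2) auto
    also have "{..<max n N} = {..<N} \<union> {N..<max n N}" by auto
    also have "(\<Sum>i\<in>{..<N} \<union> {N..<max n N}. \<bar>coord (f - ?g) i\<bar>)
        = (\<Sum>i<N. \<bar>coord (f - ?g) i\<bar>) + (\<Sum>i\<in>{N..<max n N}. \<bar>coord (f - ?g) i\<bar>)"
      by (rule sum.union_disjoint) auto
    also have "(\<Sum>i<N. \<bar>coord (f - ?g) i\<bar>) \<le> (\<Sum>i<N. d)"
      by (intro sum_mono) (use q in \<open>auto simp: coord_trunc intro: less_imp_le\<close>)
    also have "\<dots> \<le> e / 3"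
      using e by (simp add: d_def field_simps)
    also have "(\<Sum>i\<in>{N..<max n N}. \<bar>coord (f - ?g) i\<bar>) = (\<Sum>i\<in>{N..<max n N}. \<bar>coord f i\<bar>)"
      by (intro sum.cong) (auto simp: coord_trunc)
    also have "\<dots> = (\<Sum>i<max n N. \<bar>coord f i\<bar>) - (\<Sum>i<N. \<bar>coord f i\<bar>)"
      using sum_diff_nat_ivl[of 0 N "max n N" "\<lambda>i. \<bar>coord f i\<bar>"] by (simp add: lessThan_atLeast0)
    also have "\<dots> \<le> norm f - (\<Sum>i<N. \<bar>coord f i\<bar>)"
      using sum_abs_coord_le[where n = "max n N"] by simp
    also have "\<dots> \<le> e / 3" using N[OF order_refl] unfolding real_norm_def by linarith
    finally show "(\<Sum>i<n. \<bar>coord (f - ?g) i\<bar>) \<le> 2 * (e / 3)" by simp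
  qed
  moreover have "?g \<in> ?D" by (rule image_eqI[of _ _ ?xs]) auto
  ultimately show "\<exists>g\<in>?D. norm (f - g) < e" using e by (intro bexI[of _ ?g]) simp_all
qed

text \<open>Bochner integrals of random elements of \<open>l1\<close>, and measurability of their
  products, need this class.\<close>

instance l1 :: second_countable_topology
proof
  obtain D :: "l1 set" where D: "countable D" "\<And>f e. e > 0 \<Longrightarrow> \<exists>g\<in>D. norm (f - g) < e"
    using l1_countable_dense by blast
  let ?B = "(\<lambda>(g, n). ball g (1 / real (Suc n))) ` (D \<times> UNIV)"
  have "topological_basis ?B"
  proof (rule topological_basisI)
    fix S and f :: l1 assume "open S" "f \<in> S"
    then obtain e where e: "e > 0" "ball f e \<subseteq> S" by (meson open_contains_ball)
    obtain n where n: "1 / real (Suc n) < e / 2" using nat_approx_posE[of "e / 2"] e by auto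
    obtain g where g: "g \<in> D" "norm (f - g) < 1 / real (Suc n)" using D(2)[of "1 / real (Suc n)" f] by auto
    have "ball g (1 / real (Suc n)) \<subseteq> ball f e"
    proof
      fix h assume "h \<in> ball g (1 / real (Suc n))"
      then show "h \<in> ball f e"
        using dist_triangle[of f h g] g(2) n by (simp add: dist_norm)
    qed
    then show "\<exists>B'\<in>?B. f \<in> B' \<and> B' \<subseteq> S"
      using g e(2) by (intro bexI[of _ "ball g (1 / real (Suc n))"]) (auto simp: dist_norm norm_minus_commute)
  qed auto
  then have "open = generate_topology ?B" "countable ?B"
    using topological_basis_imp_subbasis D(1) by auto
  then show "\<exists>B :: l1 set set. countable B \<and> open = generate_topology B" by blast
qed

subsection \<open>Smoothness of the Poisson distribution\<close>

text \<open>\<open>shift ^ x\<close> is the unit mass at \<open>x\<close>, so the mean of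
  \<open>shift ^ X\<close> is the law of \<open>X\<close>, in the guise of its generating
  function.\<close>

lift_definition shift :: l1 is fps_X
  by (rule summable_finite[of "{1}"]) auto

lemma coord_shift_mult: "coord (shift * f) n = (if n = 0 then 0 else coord f (n - 1))"
  by transfer simp

lemma coord_shift_power: "coord (shift ^ k) n = (if n = k then 1 else 0)"
  by (induction k arbitrary: n) (auto simp: coord_one coord_shift_mult)

lemma norm_shift_power: "norm (shift ^ k) = 1"
  unfolding norm_l1_eq coord_shift_power by (subst suminf_finite[of "{k}"]) auto

lemma norm_shift: "norm shift = 1"
  using norm_shift_power[of 1] by simp

definition diffu :: l1 where "diffu = shift - 1"

lemma norm_diffu_le: "norm diffu \<le> 2"
  using norm_triangle_ineq4[of shift 1] by (simp add: diffu_def norm_shift)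

lemma coord_diffu_mult:
  "coord (diffu * f) n = (if n = 0 then 0 else coord f (n - 1)) - coord f n"
  by (simp add: diffu_def left_diff_distrib coord_shift_mult)

lemma coord_exp_shift: "coord (exp (of_real r * shift)) k = r ^ k / fact k"
proof -
  have "(\<lambda>n. (of_real r * shift) ^ n /\<^sub>R fact n) sums exp (of_real r * shift)"
    by (rule exp_converges)
  from bounded_linear.sums[OF bounded_linear_coord this]
  have "(\<lambda>n. coord ((of_real r * shift) ^ n /\<^sub>R fact n) k) sums coord (exp (of_real r * shift)) k" .
  moreover have "coord ((of_real r * shift) ^ n /\<^sub>R fact n) k = (if n = k then r ^ k / fact k else 0)" for n
    by (auto simp: power_mult_distrib of_real_def scaleR_power coord_shift_power field_simps)
  ultimately have "(\<lambda>n. if n = k then r ^ k / fact k else 0) sums coord (exp (of_real r * shift)) k"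
    by simp
  moreover have "(\<lambda>n. if n = k then r ^ k / fact k else 0) sums (r ^ k / fact k)"
    by (rule sums_single)
  ultimately show ?thesis by (rule sums_unique2)
qed

abbreviation poisson_l1 :: "real \<Rightarrow> l1" where
  "poisson_l1 r \<equiv> exp (of_real r * diffu)"

lemma coord_poisson_l1: "coord (poisson_l1 r) k = exp (- r) * r ^ k / fact k"
proof -
  have "poisson_l1 r = exp (of_real r * shift + of_real (- r))"
    by (simp add: diffu_def algebra_simps)
  also have "\<dots> = exp (of_real r * shift) * exp (of_real (- r))"
    by (rule exp_add_commuting) (simp add: mult.commute)
  also have "exp (of_real (- r)) = (of_real (exp (- r)) :: l1)"
    by (rule exp_of_real)
  also have "exp (of_real r * shift) * of_real (exp (- r)) = exp (- r) *\<^sub>R exp (of_real r * shift)"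
    by (simp add: scaleR_conv_of_real mult.commute)
  finally show ?thesis by (simp add: coord_exp_shift)
qed

section \<open>Charlier polynomials as densities with respect to the Poisson weights\<close>

context
  fixes r :: real
  assumes r: "r > 0"
begin

text \<open>The recursion is what one more factor \<open>diffu\<close> does to a density, because
  \<open>p (k - 1)\<close> is \<open>k / r\<close> times \<open>p k\<close>. At \<open>k = 0\<close>
  the coefficient \<open>real k\<close> removes the term with the truncated index.\<close>

private fun charlier :: "nat \<Rightarrow> nat \<Rightarrow> real" where
  "charlier 0 k = 1"
| "charlier (Suc m) k = real k / r * charlier m (k - 1) - charlier m k"

text \<open>The lowering relation of the family, obtained from the raising recursion by induction;
  \<open>k = 0\<close> is apart because of truncated subtraction.\<close>

private lemma charlier_Suc_diff:
  "charlier (Suc m) (Suc k) - charlier (Suc m) k = (real m + 1) / r * charlier m k"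
proof (induction m arbitrary: k)
  case (Suc m)
  have IH: "charlier (Suc m) (Suc k) = charlier (Suc m) k + (real m + 1) / r * charlier m k" for k
    using Suc[of k] by simp
  show ?case
  proof (cases k)
    case 0
    show ?thesis
    proof -
      have z: "charlier (Suc m) 0 = - charlier m 0" by simp
      have "charlier (Suc (Suc m)) (Suc 0) - charlier (Suc (Suc m)) 0
          = 1 / r * charlier (Suc m) 0 - (charlier (Suc m) (Suc 0) - charlier (Suc m) 0)"
        unfolding charlier.simps(2)[of "Suc m"] by simp
      also have "\<dots> = (real (Suc m) + 1) / r * charlier (Suc m) 0"
        unfolding Suc.IH unfolding z using r by (simp add: field_simps)
      finally show ?thesis using 0 by simp
    qed
  next
    case (Suc l)
    have e: "charlier (Suc m) (Suc l) = (real l + 1) / r * charlier m l - charlier m (Suc l)"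
      by simp
    have "charlier (Suc (Suc m)) (Suc (Suc l)) - charlier (Suc (Suc m)) (Suc l)
      = (real l + 2) / r * charlier (Suc m) (Suc l) - charlier (Suc m) (Suc (Suc l))
        - ((real l + 1) / r * charlier (Suc m) l - charlier (Suc m) (Suc l))"
      unfolding charlier.simps(2)[of "Suc m"] by (simp add: add.commute)
    also have "\<dots> = (real l + 1) / r * (charlier (Suc m) (Suc l) - charlier (Suc m) l)
        + charlier (Suc m) (Suc l) / r - (charlier (Suc m) (Suc (Suc l)) - charlier (Suc m) (Suc l))"
      using r by (simp add: field_simps)
    also have "\<dots> = (real m + 1) / r * ((real l + 1) / r * charlier m l - charlier m (Suc l))
        + charlier (Suc m) (Suc l) / r"
      unfolding Suc.IH using r by (simp add: field_simps del: charlier.simps(2))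
    also have "\<dots> = (real (Suc m) + 1) / r * charlier (Suc m) (Suc l)"
      unfolding e[symmetric] using r by (simp add: field_simps del: charlier.simps(2))
    finally show ?thesis using Suc by simp
  qed
qed (use r in \<open>simp add: field_simps\<close>)

private lemma abs_charlier_le: "\<bar>charlier m k\<bar> \<le> (real k / r + 1) ^ m"
proof (induction m arbitrary: k)
  case (Suc m)
  have "\<bar>charlier (Suc m) k\<bar> \<le> real k / r * \<bar>charlier m (k - 1)\<bar> + \<bar>charlier m k\<bar>"
    using r by (simp add: abs_mult order_trans[OF abs_triangle_ineq4])
  also have "\<dots> \<le> real k / r * (real k / r + 1) ^ m + (real k / r + 1) ^ m"
  proof (intro add_mono mult_left_mono)
    have "\<bar>charlier m (k - 1)\<bar> \<le> (real (k - 1) / r + 1) ^ m" by (rule Suc)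
    also have "\<dots> \<le> (real k / r + 1) ^ m"
      using r by (intro power_mono add_right_mono divide_right_mono) auto
    finally show "\<bar>charlier m (k - 1)\<bar> \<le> (real k / r + 1) ^ m" .
  qed (use r Suc in auto)
  finally show ?case by (simp add: algebra_simps)
qed simp

private definition p :: "nat \<Rightarrow> real" where
  "p k = exp (- r) * r ^ k / fact k"

private lemma p_Suc: "p k = (real k + 1) / r * p (Suc k)"
proof -
  have "exp (- r) * x / y = z / r * (exp (- r) * (r * x) / (z * y))" if "z \<noteq> 0" "y \<noteq> 0" for x y z
    using that r by (simp add: field_simps)
  from this[of "real k + 1" "fact k" "r ^ k"] show ?thesis
    by (simp add: p_def algebra_simps)
qed

private lemma p_nonneg: "p k \<ge> 0"
  using r by (simp add: p_def)

private lemma p_sums: "p sums 1"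
proof -
  have "(\<lambda>k. exp (- r) * (r ^ k / fact k)) sums (exp (- r) * exp r)"
    using exp_converges[of r] by (intro sums_mult) (simp add: field_simps)
  then show ?thesis by (simp add: exp_minus p_def[abs_def])
qed

private lemma coord_power_mult_poisson:
  "coord (diffu ^ m * poisson_l1 r) k = p k * charlier m k"
proof (induction m arbitrary: k)
  case 0
  show ?case by (simp add: coord_poisson_l1 p_def)
next
  case (Suc m)
  show ?case
  proof (cases k)
    case (Suc l)
    have "coord (diffu ^ Suc m * poisson_l1 r) k = p l * charlier m l - p k * charlier m k"
      by (simp add: Suc mult.assoc coord_diffu_mult Suc.IH)
    also have "\<dots> = p k * charlier (Suc m) k"
      unfolding p_Suc[of l] unfolding Suc by (simp add: algebra_simps)
    finally show ?thesis .
  qed (simp add: mult.assoc coord_diffu_mult Suc.IH)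
qed

text \<open>A single term of the exponential series bounds the power by \<open>fact m\<close> times
  an exponential in \<open>k / r\<close>, and that merely changes the Poisson parameter to
  \<open>r * exp (1/r)\<close>.\<close>

private lemma summable_p_poly:
  assumes "\<And>k. \<bar>f k\<bar> \<le> (real k / r + 1) ^ m"
  shows "summable (\<lambda>k. p k * f k)"
proof (rule summable_comparison_test)
  have "summable (\<lambda>k. (exp (- r) * fact m * exp 1) * ((r * exp (1/r)) ^ k / fact k))"
    using summable_exp[of "r * exp (1/r)"] by (intro summable_mult) (simp add: field_simps)
  then show "summable (\<lambda>k. fact m * exp (real k / r + 1) * p k)"
    by (simp add: p_def power_mult_distrib exp_add exp_of_nat_mult[symmetric] field_simps)
  have "\<bar>f k\<bar> \<le> fact m * exp (real k / r + 1)" for k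
  proof -
    have "(real k / r + 1) ^ m / fact m \<le> exp (real k / r + 1)"
    proof -
      have "(\<Sum>i\<in>{m}. (real k / r + 1) ^ i /\<^sub>R fact i) \<le> (\<Sum>i. (real k / r + 1) ^ i /\<^sub>R fact i)"
        by (rule sum_le_suminf[OF summable_exp_generic]) (use r in auto)
      then show ?thesis by (simp add: exp_def field_simps)
    qed
    then show ?thesis using assms[of k] by (simp add: field_simps)
  qed
  then show "\<exists>N. \<forall>k\<ge>N. norm (p k * f k) \<le> fact m * exp (real k / r + 1) * p k"
    using p_nonneg by (auto simp: abs_mult mult.commute[of "p _"] intro!: mult_right_mono exI[of _ 0])
qed

text \<open>The raising map, which sends \<open>f\<close> to \<open>k / r * f (k - 1) - f k\<close>,
  is adjoint to the forward difference for the weights \<open>p\<close>.\<close>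

private lemma summation_by_parts:
  assumes f: "summable (\<lambda>k. p k * (f k * g k))"
    and g: "summable (\<lambda>k. p k * (f k * g (Suc k)))"
  shows "(\<lambda>k. p k * ((real k / r * f (k - 1) - f k) * g k)) sums (\<Sum>k. p k * (f k * (g (Suc k) - g k)))"
proof -
  have "(\<lambda>k. p (Suc k) * (real (Suc k) / r * f k * g (Suc k))) = (\<lambda>k. p k * (f k * g (Suc k)))"
    by (intro ext, subst (2) p_Suc) (simp add: algebra_simps)
  then have "(\<lambda>k. p (Suc k) * (real (Suc k) / r * f (Suc k - 1) * g (Suc k))) sums (\<Sum>k. p k * (f k * g (Suc k)))"
    using summable_sums[OF g] by simp
  then have "(\<lambda>k. p k * (real k / r * f (k - 1) * g k)) sums (\<Sum>k. p k * (f k * g (Suc k)))"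
    by (subst (asm) sums_Suc_iff) simp
  from sums_diff[OF this summable_sums[OF f]]
  show ?thesis
    using suminf_diff[OF g f] by (simp add: algebra_simps)
qed

private lemma summable_charlier2: "summable (\<lambda>k. p k * (charlier m k * charlier m' k))"
  by (rule summable_p_poly[of _ "m + m'"])
    (use r in \<open>auto simp: abs_mult power_add intro!: mult_mono abs_charlier_le\<close>)

text \<open>Moving one raising step to the other factor lowers that factor and gives
  \<open>(m + 1) / r\<close> times the previous second moment.\<close>

private lemma charlier_square: "(\<lambda>k. p k * (charlier m k)\<^sup>2) sums (fact m / r ^ m)"
proof (induction m)
  case 0
  show ?case using p_sums by simp
next
  case (Suc m)
  have C: "charlier (Suc m) (Suc k) = charlier (Suc m) k + (real m + 1) / r * charlier m k" for k
    using charlier_Suc_diff[of m k] by simp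
  have 1: "summable (\<lambda>k. p k * (charlier m k * charlier (Suc m) k))"
    by (rule summable_charlier2)
  have 2: "summable (\<lambda>k. p k * (charlier m k * charlier (Suc m) (Suc k)))"
  proof -
    have "summable (\<lambda>k. p k * (charlier m k * charlier (Suc m) k)
        + (real m + 1) / r * (p k * (charlier m k * charlier m k)))"
      by (intro summable_add summable_mult summable_charlier2)
    then show ?thesis unfolding C by (simp add: algebra_simps del: charlier.simps)
  qed
  have "(\<Sum>k. p k * (charlier m k * (charlier (Suc m) (Suc k) - charlier (Suc m) k)))
      = (\<Sum>k. (real m + 1) / r * (p k * (charlier m k)\<^sup>2))"
    unfolding charlier_Suc_diff by (intro suminf_cong) (simp add: power2_eq_square)
  also have "\<dots> = (real m + 1) / r * (fact m / r ^ m)"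
    using suminf_mult[of "\<lambda>k. p k * (charlier m k)\<^sup>2" "(real m + 1) / r"] Suc by (simp add: sums_iff)
  finally show ?case
    using summation_by_parts[OF 1 2] by (simp add: power2_eq_square field_simps)
qed

text \<open>Cauchy-Schwarz against the probability weights \<open>p\<close>, used pointwise as c
  \<le> c^2 / (2B) + B / 2 with \<open>B\<close> the root mean square; both halves then sum to
  \<open>B / 2\<close>.\<close>

lemma norm_diffu_power_poisson_le: "norm (diffu ^ m * poisson_l1 r) \<le> sqrt (fact m / r ^ m)"
proof -
  define B where "B = sqrt (fact m / r ^ m)"
  have B: "B > 0" "B\<^sup>2 = fact m / r ^ m" using r by (auto simp: B_def)
  have s: "(\<lambda>k. 1 / (2 * B) * (p k * (charlier m k)\<^sup>2) + B / 2 * p k) sums (1 / (2 * B) * B\<^sup>2 + B / 2 * 1)"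
    unfolding B(2) by (intro sums_add sums_mult charlier_square p_sums)
  have le: "\<bar>coord (diffu ^ m * poisson_l1 r) k\<bar> \<le> 1 / (2 * B) * (p k * (charlier m k)\<^sup>2) + B / 2 * p k" for k
  proof -
    have "0 \<le> (\<bar>charlier m k\<bar> - B)\<^sup>2" by simp
    then have "2 * B * \<bar>charlier m k\<bar> \<le> (charlier m k)\<^sup>2 + B\<^sup>2"
      by (simp add: power2_eq_square algebra_simps)
    then have "\<bar>charlier m k\<bar> \<le> 1 / (2 * B) * (charlier m k)\<^sup>2 + B / 2"
      using B(1) by (simp add: field_simps power2_eq_square)
    from mult_left_mono[OF this p_nonneg[of k]] show ?thesis
      unfolding coord_power_mult_poisson using p_nonneg[of k] by (simp add: abs_mult algebra_simps)
  qed
  have "norm (diffu ^ m * poisson_l1 r) \<le> 1 / (2 * B) * B\<^sup>2 + B / 2 * 1"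
    unfolding norm_l1_eq sums_unique[OF s]
    by (rule suminf_le[OF le summable_coord]) (use s in \<open>simp add: sums_iff\<close>)
  also have "\<dots> = B" using B(1) by (simp add: power2_eq_square)
  finally show ?thesis by (simp add: B_def)
qed

text \<open>The trivial bound, for small \<open>r\<close>, where the Charlier bound blows
  up.\<close>

lemma norm_diffu_power_poisson_le': "norm (diffu ^ m * poisson_l1 r) \<le> 2 ^ m"
proof -
  have "norm (diffu ^ m * poisson_l1 r) \<le> norm diffu ^ m * norm (poisson_l1 r)"
    by (intro order_trans[OF norm_mult_ineq] mult_right_mono norm_power_ineq) auto
  also have "norm (poisson_l1 r) \<le> 1"
    using norm_diffu_power_poisson_le[of 0] by simp
  finally show ?thesis
    using power_mono[OF norm_diffu_le, of m] by (simp add: mult_left_mono order_trans)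
qed

end

subsection \<open>Inverses and exponentials in a commutative Banach algebra\<close>

text \<open>A total function, so that Heinrich's factors can be defined by recursion before anything
  is known about their size; it inverts \<open>x\<close> once \<open>x\<close> is close to
  1.\<close>

definition neumann_inv :: "'a::{real_normed_algebra_1, comm_ring_1, banach} \<Rightarrow> 'a" where
  "neumann_inv x = (\<Sum>n. (1 - x) ^ n)"

lemma neumann_inv:
  fixes x :: "'a::{real_normed_algebra_1, comm_ring_1, banach}"
  assumes "norm (x - 1) \<le> 1/10"
  shows "x * neumann_inv x = 1" "norm (neumann_inv x) \<le> 10/9"
proof -
  let ?y = "1 - x"
  have n: "norm (?y ^ k) \<le> (1/10) ^ k" for k
    by (rule order_trans[OF norm_power_ineq power_mono]) (use assms in \<open>auto simp: norm_minus_commute\<close>)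
  have g: "summable (\<lambda>k. (1/10 :: real) ^ k)" by (simp add: summable_geometric)
  have sn: "summable (\<lambda>k. norm (?y ^ k))"
    by (rule summable_comparison_test[OF _ g]) (use n in auto)
  then have s: "summable (\<lambda>k. ?y ^ k)" by (rule summable_norm_cancel)
  have "?y * neumann_inv x = neumann_inv x - 1"
    using suminf_split_head[OF s] suminf_mult[OF s, of ?y] by (simp add: neumann_inv_def)
  then show "x * neumann_inv x = 1" by (simp add: algebra_simps)
  have "norm (neumann_inv x) \<le> (\<Sum>k. norm (?y ^ k))"
    unfolding neumann_inv_def by (rule summable_norm[OF sn])
  also have "\<dots> \<le> (\<Sum>k. (1/10) ^ k)" by (rule suminf_le[OF n sn g])
  also have "\<dots> = 10/9" by (subst suminf_geometric) auto
  finally show "norm (neumann_inv x) \<le> 10/9" .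
qed

lemma neumann_inv_1: "neumann_inv 1 = (1 :: 'a::{real_normed_algebra_1, comm_ring_1, banach})"
  using neumann_inv(1)[of "1 :: 'a"] by simp

text \<open>The tail is an exact multiple of \<open>x ^ k\<close>; if \<open>x\<close> is a multiple
  of \<open>u\<close>, the power of \<open>u\<close> survives.\<close>

lemma exp_remainder:
  fixes x :: "'a::{real_normed_algebra_1, banach}"
  obtains w where "exp x = (\<Sum>n<k. x ^ n /\<^sub>R fact n) + x ^ k * w" "norm w \<le> exp (norm x)"
proof
  let ?f = "\<lambda>n. x ^ n /\<^sub>R fact (n + k)"
  have le: "norm (?f n) \<le> norm x ^ n /\<^sub>R fact n" for n
    by (auto simp: divide_inverse_commute[symmetric] intro!: frac_le norm_power_ineq fact_mono)
  have se: "summable (\<lambda>n. norm x ^ n /\<^sub>R fact n)" by (rule summable_exp_generic)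
  have sn: "summable (\<lambda>n. norm (?f n))"
    by (rule summable_comparison_test[OF _ se]) (use le in auto)
  have "exp x = (\<Sum>n<k. x ^ n /\<^sub>R fact n) + (\<Sum>n. x ^ (n + k) /\<^sub>R fact (n + k))"
    unfolding exp_def using suminf_split_initial_segment[OF summable_exp_generic[of x], of k] by simp
  also have "(\<Sum>n. x ^ (n + k) /\<^sub>R fact (n + k)) = x ^ k * (\<Sum>n. ?f n)"
  proof -
    have "x ^ (n + k) /\<^sub>R fact (n + k) = x ^ k * ?f n" for n
      using power_add[of x k n] by (simp add: add.commute[of k])
    then show ?thesis using suminf_mult[OF summable_norm_cancel[OF sn], of "x ^ k"] by simp
  qed
  finally show "exp x = (\<Sum>n<k. x ^ n /\<^sub>R fact n) + x ^ k * (\<Sum>n. ?f n)" .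
  show "norm (\<Sum>n. ?f n) \<le> exp (norm x)"
    unfolding exp_def
    by (rule order_trans[OF summable_norm[OF sn] suminf_le[OF le sn se]])
qed

text \<open>Expansions of the exponential that is split off, to orders 0, 1 and 3. In the last one
  the first-order terms cancel. The norm of the exponent is at most 1/50, and 103/100 bounds
  \<open>exp (1/50)\<close>.\<close>

lemma exp_neg_small:
  fixes u :: "'a::{real_normed_algebra_1, comm_ring_1, banach}"
  assumes u: "norm u \<le> 2" and a: "0 \<le> a" "a \<le> 1/100"
  shows "norm (exp (of_real (- a) * u)) \<le> 103/100"
    and "\<exists>w. exp (of_real (- a) * u) = 1 + u * (of_real a * w) \<and> norm w \<le> 103/100"
    and "\<exists>w. (1 + of_real a * u) * exp (of_real (- a) * u)
           = 1 - u * u * of_real (a\<^sup>2 / 2) + u * u * u * (of_real (a ^ 3) * w) \<and> norm w \<le> 2"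
proof -
  let ?x = "of_real (- a) * u"
  have nau: "norm (of_real (- a) * u) \<le> 1/50" "norm (of_real a * u) \<le> 1/50"
    using order_trans[OF norm_mult_ineq, of "of_real a :: 'a" u "1/50"] mult_mono[OF a(2) u] a(1) by auto
  have "exp (norm ?x) \<le> exp (1/50)" using nau by simp
  also have "\<dots> \<le> 1 + 1/50 + (1/50)\<^sup>2" by (rule exp_bound) auto
  finally have e': "exp (norm ?x) \<le> 103/100" by (simp add: power2_eq_square)
  show "norm (exp ?x) \<le> 103/100" using norm_exp[of ?x] e' by linarith
  obtain w where w: "exp ?x = (\<Sum>n<1. ?x ^ n /\<^sub>R fact n) + ?x ^ 1 * w" "norm w \<le> exp (norm ?x)"
    using exp_remainder by blast
  show "\<exists>w. exp ?x = 1 + u * (of_real a * w) \<and> norm w \<le> 103/100"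
    by (rule exI[of _ "- w"]) (use w e' in \<open>simp add: mult.assoc mult.left_commute\<close>)
  obtain v where v: "exp ?x = (\<Sum>n<3. ?x ^ n /\<^sub>R fact n) + ?x ^ 3 * v" "norm v \<le> exp (norm ?x)"
    using exp_remainder by blast
  define \<alpha> where "\<alpha> = (of_real a :: 'a)"
  \<comment> \<open>One half as a ring element with \<open>h + h = 1\<close>: the second-order
    terms, minus a full square plus half of one, then combine by ring arithmetic alone.\<close>
  define h where "h = (of_real (1/2) :: 'a)"
  have hh: "h + h = 1" unfolding h_def of_real_add[symmetric] by simp
  have ev: "exp ?x = 1 - \<alpha> * u + h * \<alpha> * \<alpha> * u * u - \<alpha> * \<alpha> * \<alpha> * u * u * u * v"
    using v(1) by (simp add: numeral_3_eq_3 \<alpha>_def h_def scaleR_conv_of_real algebra_simps)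
  have "(1 + \<alpha> * u) * exp ?x = 1 - (h + h) * \<alpha> * \<alpha> * u * u + h * \<alpha> * \<alpha> * u * u
       + \<alpha> * \<alpha> * \<alpha> * u * u * u * (h - v * (1 + \<alpha> * u))"
    unfolding ev hh by (simp add: algebra_simps)
  also have "\<dots> = 1 - u * u * (\<alpha> * \<alpha> * h) + u * u * u * (\<alpha> * \<alpha> * \<alpha> * (h - v * (1 + \<alpha> * u)))"
    by (simp add: algebra_simps)
  finally have eq: "(1 + of_real a * u) * exp ?x
           = 1 - u * u * of_real (a\<^sup>2 / 2) + u * u * u * (of_real (a ^ 3) * (h - v * (1 + \<alpha> * u)))"
    unfolding \<alpha>_def h_def of_real_mult[symmetric] by (simp add: power2_eq_square power3_eq_cube)
  have "norm (1 + \<alpha> * u) \<le> 51/50"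
    using norm_triangle_ineq[of 1 "\<alpha> * u"] nau(2) by (simp add: \<alpha>_def)
  then have "norm (v * (1 + \<alpha> * u)) \<le> 103/100 * (51/50)"
    using v(2) e' by (intro order_trans[OF norm_mult_ineq] mult_mono) auto
  then have "norm (h - v * (1 + \<alpha> * u)) \<le> 2"
    using norm_triangle_ineq4[of h "v * (1 + \<alpha> * u)"] by (simp add: h_def)
  with eq show "\<exists>w. (1 + of_real a * u) * exp ?x
           = 1 - u * u * of_real (a\<^sup>2 / 2) + u * u * u * (of_real (a ^ 3) * w) \<and> norm w \<le> 2"
    by blast
qed

text \<open>The \<open>e r\<close> are the elementary symmetric functions of the \<open>s k\<close>:
  the \<open>r\<close>-th power of the sum of the norms contains each of their products
  \<open>fact r\<close> times.\<close>

lemma prod_one_plus_expansion: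
  fixes v :: "'a::{real_normed_algebra_1, comm_ring_1}" and s :: "nat \<Rightarrow> 'a"
  shows "\<exists>e. (\<Prod>k=1..n. 1 + v * s k) = (\<Sum>r\<le>n. v ^ r * e r) \<and> e 0 = 1 \<and> e 1 = (\<Sum>k=1..n. s k)
     \<and> (\<forall>r>n. e r = 0) \<and> (\<forall>r. norm (e r) \<le> (\<Sum>k=1..n. norm (s k)) ^ r / fact r)"
proof (induction n)
  case 0
  show ?case by (rule exI[of _ "\<lambda>r. if r = 0 then 1 else 0"]) auto
next
  case (Suc n)
  then obtain e where e: "(\<Prod>k=1..n. 1 + v * s k) = (\<Sum>r\<le>n. v ^ r * e r)" "e 0 = 1"
    "e 1 = (\<Sum>k=1..n. s k)" "\<And>r. r > n \<Longrightarrow> e r = 0"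
    "\<And>r. norm (e r) \<le> (\<Sum>k=1..n. norm (s k)) ^ r / fact r" by blast
  define S where "S = (\<Sum>k=1..n. norm (s k))"
  define t where "t = norm (s (Suc n))"
  have S: "S \<ge> 0" "t \<ge> 0" by (auto simp: S_def t_def intro: sum_nonneg)
  let ?e = "\<lambda>r. if r = 0 then 1 else e r + s (Suc n) * e (r - 1)"
  have "(\<Prod>k=1..Suc n. 1 + v * s k) = (\<Sum>r\<le>Suc n. v ^ r * e r) + v * s (Suc n) * (\<Sum>r\<le>n. v ^ r * e r)"
    using e(1,4) by (simp add: algebra_simps)
  also have "\<dots> = e 0 + (\<Sum>r\<le>n. v ^ Suc r * (e (Suc r) + s (Suc n) * e r))"
    by (simp only: sum.atMost_Suc_shift) (simp add: sum_distrib_left sum.distrib algebra_simps)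
  also have "\<dots> = (\<Sum>r\<le>Suc n. v ^ r * ?e r)"
    by (simp only: sum.atMost_Suc_shift) (simp add: e(2))
  finally have 1: "(\<Prod>k=1..Suc n. 1 + v * s k) = (\<Sum>r\<le>Suc n. v ^ r * ?e r)" .
  have 2: "norm (?e r) \<le> (S + t) ^ r / fact r" for r
  proof (cases r)
    case (Suc q)
    \<comment> \<open>The first two binomial terms, by Bernoulli's inequality scaled with
      \<open>S\<close>; they match the two parts of the recursion for \<open>?e\<close>.\<close>
    have "S ^ Suc q + real (Suc q) * t * S ^ q \<le> (S + t) ^ Suc q"
    proof (cases "S = 0")
      case True then show ?thesis using S by (cases q) auto
    next
      case False
      then have "S > 0" using S by simp
      have "1 + real (Suc q) * (t / S) \<le> (1 + t / S) ^ Suc q"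
        by (rule Bernoulli_inequality) (use S \<open>S > 0\<close> in \<open>auto intro: order_trans[of _ 0]\<close>)
      from mult_left_mono[OF this, of "S ^ Suc q"]
      have "S ^ Suc q + real (Suc q) * t * S ^ q \<le> (S * (1 + t / S)) ^ Suc q"
        unfolding power_mult_distrib using \<open>S > 0\<close> by (simp add: algebra_simps)
      then show ?thesis using \<open>S > 0\<close> by (simp add: algebra_simps)
    qed
    then have "S ^ Suc q / fact (Suc q) + real (Suc q) * t * S ^ q / fact (Suc q) \<le> (S + t) ^ Suc q / fact (Suc q)"
      unfolding add_divide_distrib[symmetric] by (rule divide_right_mono) simp
    moreover have "real (Suc q) * t * S ^ q / fact (Suc q) = t * (S ^ q / fact q)"
      by (simp add: field_simps del: of_nat_Suc)
    moreover have "norm (?e r) \<le> S ^ Suc q / fact (Suc q) + t * (S ^ q / fact q)"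
    proof -
      have "norm (?e r) \<le> norm (e (Suc q)) + t * norm (e q)"
        unfolding t_def using Suc norm_triangle_ineq[of "e (Suc q)" "s (Suc n) * e q"] norm_mult_ineq[of "s (Suc n)" "e q"]
        by simp
      also have "\<dots> \<le> S ^ Suc q / fact (Suc q) + t * (S ^ q / fact q)"
        unfolding S_def using S(2) by (intro add_mono e(5) mult_left_mono)
      finally show ?thesis .
    qed
    ultimately show ?thesis unfolding Suc by linarith
  qed simp
  show ?case
    by (rule exI[of _ ?e]) (use 1 2 e in \<open>auto simp: S_def t_def\<close>)
qed

subsection \<open>Heinrich's factors and their expansions\<close>

text \<open>Size of the mean of \<open>p\<close> consecutive factors \<open>Z\<close>: each has norm
  at most 2 and every second one contributes 1/100, which is about (2/10)^p. The factor 10 pays for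
  odd \<open>p\<close>; the value 1 at 0 is kept sharp because it multiplies the leading
  terms.\<close>

definition decay :: "nat \<Rightarrow> real" where
  "decay p = (if p = 0 then 1 else 10 * (1/5) ^ p)"

lemma decay_nonneg: "decay p \<ge> 0"
  by (simp add: decay_def)

text \<open>Each inverse factor costs 10/9, so the terms beyond the first form a geometric series of
  ratio 2/9; the total tends to 30/7.\<close>

lemma sum_decay: "(\<Sum>q\<le>N. decay q * (10/9) ^ (q + 1)) = 30/7 - 200/63 * (2/9) ^ N"
proof (induction N)
  case (Suc N)
  have "decay (Suc N) * (10/9) ^ (Suc N + 1) = 10 * (10/9) * ((1/5) * (10/9)) ^ Suc N"
    unfolding power_mult_distrib by (simp add: decay_def)
  then have "decay (Suc N) * (10/9) ^ (Suc N + 1) = 200/81 * (2/9) ^ N" by simp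
  then show ?case unfolding sum.atMost_Suc Suc by simp
qed (simp add: decay_def)

lemma sum_decay_le: "(\<Sum>j<N. decay (N - Suc j) * (10/9) ^ (N - j + r)) \<le> (10/9) ^ r * (30/7)"
proof -
  have "(\<Sum>j<N. decay (N - Suc j) * (10/9) ^ (N - j + r))
      = (\<Sum>j<N. decay (N - Suc j) * (10/9) ^ (Suc (N - Suc j) + r))"
    by (intro sum.cong) (auto simp: Suc_diff_Suc)
  also have "\<dots> = (\<Sum>q<N. decay q * (10/9) ^ (Suc q + r))"
    by (rule sum.nat_diff_reindex)
  also have "\<dots> = (10/9) ^ r * (\<Sum>q<N. decay q * (10/9) ^ (q + 1))"
    by (simp add: sum_distrib_left power_add algebra_simps)
  also have "(\<Sum>q<N. decay q * (10/9) ^ (q + 1)) \<le> 30/7"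
    using sum_decay[of "N - 1"] by (cases N) (auto simp: lessThan_Suc_atMost)
  finally show ?thesis by simp
qed

text \<open>If \<phi>(k) denotes \<open>F k / F (k-1)\<close>, division of the renewal equation by
  \<open>F (k-1)\<close> turns \<open>F (j-2) / F (k-1)\<close> into the product of the inverses of
  \<phi>(i) for i = j-1, ..., k-1. The resulting recursion serves as the definition.\<close>

function heinrich :: "(nat \<Rightarrow> nat \<Rightarrow> 'a) \<Rightarrow> nat \<Rightarrow> 'a::{real_normed_algebra_1, comm_ring_1, banach}" where
  "heinrich m k = 1 + (\<Sum>j\<le>k. m j k * (\<Prod>i\<in>{j-1..<k}. neumann_inv (heinrich m i)))"
  by auto
termination by (relation "Wellfounded.measure snd") auto

declare heinrich.simps [simp del]

lemma norm_mult_le_mult: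
  fixes x y :: "'a::real_normed_algebra"
  shows "norm x \<le> X \<Longrightarrow> norm y \<le> Y \<Longrightarrow> norm (x * y) \<le> X * Y"
  using order_trans[OF norm_ge_zero, of x X]
  by (intro order_trans[OF norm_mult_ineq] mult_mono) auto

lemma norm_of_real_le: "x \<ge> 0 \<Longrightarrow> norm (of_real x :: 'a::real_normed_algebra_1) \<le> x"
  unfolding norm_of_real by simp

lemma mult_square_le_cubes: "0 \<le> x \<Longrightarrow> 0 \<le> y \<Longrightarrow> x * y * y \<le> x ^ 3 + (y :: real) ^ 3"
proof -
  assume xy: "0 \<le> x" "0 \<le> y"
  have "x * y * y \<le> max x y * max x y * max x y" using xy by (intro mult_mono) auto
  also have "\<dots> \<le> x ^ 3 + y ^ 3" using xy by (cases "x \<le> y") (auto simp: power3_eq_cube max_def)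
  finally show ?thesis .
qed

text \<open>Bookkeeping in bare reals: \<open>x\<close>, \<open>y\<close>, \<open>w\<close> are the
  values of \<open>a\<close> at k, k-1, k-2, a prime marks the index k-1, and \<open>R\<close> is
  \<open>rem k\<close>. On the left stand multiples of products occurring in \<open>R\<close>, apart
  from terms like \<open>x * y * y\<close>, which are split into cubes.\<close>

lemma
  fixes x y w b b' c d e e' t :: real
  assumes nn: "0 \<le> x" "0 \<le> y" "0 \<le> w" "0 \<le> b" "0 \<le> b'" "0 \<le> c" "0 \<le> d" "0 \<le> e" "0 \<le> e'" "0 \<le> t"
  defines "R \<equiv> x ^ 3 + y ^ 3 + x * b + c + (w + y + x) * e + d + y * b + x * b' + t + w * y * x + e' * x"
  shows remainder_bound1: "c * (10/9) + b / 2 * (5 * y) + x * y * (5 * y)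
     + x * ((5/9 * b' + 100/21 * (y * w) + 100/21 * e') * (10/9))
     + e * (5 * w * (10/9) + 5 * y) + d * ((10/9) * (10/9)) + 6 * t \<le> 20 * R"
    and remainder_bound2: "x ^ 3 * 2 + 20 * R + x * (103/100) * (5/9 * b + 100/21 * (x * y) + 100/21 * e) \<le> 30 * R"
proof -
  have z: "0 \<le> x ^ 3" "0 \<le> y ^ 3" "0 \<le> x * b" "0 \<le> w * e" "0 \<le> y * e" "0 \<le> x * e"
      "0 \<le> y * b" "0 \<le> x * b'" "0 \<le> w * y * x" "0 \<le> e' * x"
    using nn by auto
  have R: "R = x ^ 3 + y ^ 3 + x * b + c + (w * e + y * e + x * e) + d + y * b + x * b' + t + w * y * x + e' * x"
    unfolding R_def by (simp add: distrib_right)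
  have "c * (10/9) + b / 2 * (5 * y) + x * y * (5 * y)
     + x * ((5/9 * b' + 100/21 * (y * w) + 100/21 * e') * (10/9))
     + e * (5 * w * (10/9) + 5 * y) + d * ((10/9) * (10/9)) + 6 * t
    = 10/9 * c + 5/2 * (y * b) + 5 * (x * y * y) + 50/81 * (x * b') + 1000/189 * (w * y * x) + 1000/189 * (e' * x)
     + 50/9 * (w * e) + 5 * (y * e) + 100/81 * d + 6 * t"
    by (simp add: field_simps)
  also have "\<dots> \<le> 20 * R"
    unfolding R using z nn mult_square_le_cubes[OF nn(1,2)] by argo
  finally show "c * (10/9) + b / 2 * (5 * y) + x * y * (5 * y)
     + x * ((5/9 * b' + 100/21 * (y * w) + 100/21 * e') * (10/9))
     + e * (5 * w * (10/9) + 5 * y) + d * ((10/9) * (10/9)) + 6 * t \<le> 20 * R" .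
  have "x * (103/100) * (5/9 * b + 100/21 * (x * y) + 100/21 * e)
      = 103/180 * (x * b) + 103/21 * (y * x * x) + 103/21 * (x * e)"
    by (simp add: field_simps)
  also have "\<dots> \<le> 10 * R - x ^ 3 * 2"
    unfolding R using z nn mult_square_le_cubes[OF nn(2,1)] by argo
  finally show "x ^ 3 * 2 + 20 * R + x * (103/100) * (5/9 * b + 100/21 * (x * y) + 100/21 * e) \<le> 30 * R"
    by argo
qed

text \<open>The algebra, detached from probability. \<open>M1\<close>, \<open>M2\<close>,
  \<open>M3\<close> are \<open>m\<close> with one, two, three factors \<open>u\<close> removed. On
  the diagonal there is a single \<open>Z\<close>, so further powers of \<open>u\<close> come from
  \<open>A2\<close> and \<open>A3\<close>, and beside the diagonal from \<open>B3\<close>. The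
  numbers \<open>a\<close>, \<open>b\<close>, \<open>c\<close> are the first three factorial
  moments, \<open>e\<close> is the mixed moment of neighbours, \<open>d\<close> and \<open>t\<close>
  are mixed moments of third order.\<close>

locale expansion =
  fixes u :: "'a::{real_normed_algebra_1, comm_ring_1, banach}"
    and n :: nat
    and m M1 M2 M3 :: "nat \<Rightarrow> nat \<Rightarrow> 'a"
    and A2 A3 B3 :: "nat \<Rightarrow> 'a"
    and a b c e d t :: "nat \<Rightarrow> real"
  assumes norm_u: "norm u \<le> 2"
    and m_eq: "\<And>j k. j \<le> k \<Longrightarrow> k \<le> n \<Longrightarrow> m j k = u * M1 j k"
    and M1_eq: "\<And>j k. j < k \<Longrightarrow> k \<le> n \<Longrightarrow> M1 j k = u * M2 j k"
    and M2_eq: "\<And>j k. j + 1 < k \<Longrightarrow> k \<le> n \<Longrightarrow> M2 j k = u * M3 j k"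
    and M1_diag: "\<And>k. k \<le> n \<Longrightarrow> M1 k k = of_real (a k) + u * A2 k"
    and A2_eq: "\<And>k. k \<le> n \<Longrightarrow> A2 k = of_real (b k / 2) + u * A3 k"
    and M2_diag: "\<And>k. Suc k \<le> n \<Longrightarrow> M2 k (Suc k) = of_real (e (Suc k)) + u * B3 (Suc k)"
    and norm_M1: "\<And>j k. j \<le> k \<Longrightarrow> k \<le> n \<Longrightarrow> norm (M1 j k) \<le> decay (k - j) * a k"
    and norm_M2: "\<And>j k. j < k \<Longrightarrow> k \<le> n \<Longrightarrow> norm (M2 j k) \<le> decay (k - j - 1) * e k"
    and norm_M3: "\<And>j k. j + 1 < k \<Longrightarrow> k \<le> n \<Longrightarrow> norm (M3 j k) \<le> decay (k - j - 2) * t k"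
    and norm_A2: "\<And>k. k \<le> n \<Longrightarrow> norm (A2 k) \<le> b k / 2"
    and norm_A3: "\<And>k. k \<le> n \<Longrightarrow> norm (A3 k) \<le> c k"
    and norm_B3: "\<And>k. k \<le> n \<Longrightarrow> norm (B3 k) \<le> d k"
    and a_bounds: "\<And>k. k \<le> n \<Longrightarrow> 0 \<le> a k \<and> a k \<le> 1/100"
    and nonneg: "\<And>k. k \<le> n \<Longrightarrow> 0 \<le> b k \<and> 0 \<le> c k \<and> 0 \<le> e k \<and> 0 \<le> d k \<and> 0 \<le> t k"
    and zero: "a 0 = 0" "b 0 = 0"
begin

definition "\<phi> k = heinrich m k"
definition "\<psi> k = neumann_inv (\<phi> k)"
definition "\<Psi> j k = (\<Prod>i\<in>{j-1..<k}. \<psi> i)"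
definition "\<theta> k = (\<Sum>j\<le>k. M1 j k * \<Psi> j k)"

lemma phi_eq: "\<phi> k = 1 + (\<Sum>j\<le>k. m j k * \<Psi> j k)"
  unfolding \<phi>_def \<Psi>_def \<psi>_def by (rule heinrich.simps)

lemma norm_Psi:
  assumes "\<And>i. i < k \<Longrightarrow> norm (\<psi> i) \<le> 10/9" "j \<le> k"
  shows "norm (\<Psi> j k) \<le> (10/9) ^ (k - j + 1)"
proof -
  have "norm (\<Psi> j k) \<le> (\<Prod>i\<in>{j-1..<k}. norm (\<psi> i))"
    unfolding \<Psi>_def by (rule norm_prod_le)
  also have "\<dots> \<le> (\<Prod>i\<in>{j-1..<k}. 10/9)"
    by (rule prod_mono) (use assms in auto)
  also have "\<dots> \<le> (10/9) ^ (k - j + 1)"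
    unfolding prod_constant card_atLeastLessThan by (rule power_increasing) (use assms(2) in auto)
  finally show ?thesis .
qed

text \<open>The values 0, 1, 2 of \<open>r\<close> serve \<open>M1\<close>, \<open>M2\<close>,
  \<open>M3\<close>: decay starts only at distance \<open>r\<close> from the diagonal, while
  \<open>\<Psi> j k\<close> still has up to \<open>k - j + 1\<close> inverse factors; the surplus
  costs \<open>(10/9) ^ r\<close>.\<close>

lemma norm_sum_Psi_le:
  assumes "\<And>i. i < k \<Longrightarrow> norm (\<psi> i) \<le> 10/9" "x \<ge> 0" "r \<le> k + 1"
    and N: "\<And>j. j + r \<le> k \<Longrightarrow> norm (N j) \<le> decay (k - j - r) * x"
  shows "norm (\<Sum>j<k + 1 - r. N j * \<Psi> j k) \<le> (10/9) ^ r * (30/7) * x"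
proof -
  let ?N = "k + 1 - r"
  have "norm (N j * \<Psi> j k) \<le> x * (decay (?N - Suc j) * (10/9) ^ (?N - j + r))" if "j < ?N" for j
  proof -
    have e: "?N - Suc j = k - j - r" "?N - j + r = k - j + 1" using that assms(3) by auto
    have "norm (N j * \<Psi> j k) \<le> (decay (k - j - r) * x) * (10/9) ^ (k - j + 1)"
      using that assms(2) decay_nonneg[of "k - j - r"]
      by (intro order_trans[OF norm_mult_ineq] mult_mono N norm_Psi assms(1)) auto
    then show ?thesis unfolding e by (simp add: algebra_simps)
  qed
  then have "norm (\<Sum>j<?N. N j * \<Psi> j k) \<le> (\<Sum>j<?N. x * (decay (?N - Suc j) * (10/9) ^ (?N - j + r)))"
    by (intro sum_norm_le) auto
  also have "\<dots> \<le> x * ((10/9) ^ r * (30/7))"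
    unfolding sum_distrib_left[symmetric] by (intro mult_left_mono sum_decay_le assms)
  finally show ?thesis by (simp add: mult.commute)
qed

text \<open>Strong induction, since \<open>\<psi> i\<close> can be bounded only when
  \<open>\<phi> i\<close> is known to be near 1. It closes because 2 * 30/7 * 1/100 is below
  1/10.\<close>

lemma phi_theta:
  assumes "k \<le> n"
  shows "\<phi> k = 1 + u * \<theta> k" "norm (\<theta> k) \<le> 30/7 * a k" "norm (\<phi> k - 1) \<le> 1/10"
proof -
  have "k \<le> n \<Longrightarrow> \<phi> k = 1 + u * \<theta> k \<and> norm (\<theta> k) \<le> 30/7 * a k \<and> norm (\<phi> k - 1) \<le> 1/10" for k
  proof (induction k rule: less_induct)
    case (less k)
    have 1: "norm (\<psi> i) \<le> 10/9" if "i < k" for i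
    proof -
      have "norm (\<phi> i - 1) \<le> 1/10" using less.IH[OF that] that less.prems by linarith
      then show ?thesis unfolding \<psi>_def by (rule neumann_inv)
    qed
    have 2: "\<phi> k = 1 + u * \<theta> k"
      unfolding phi_eq \<theta>_def sum_distrib_left using less.prems by (simp add: m_eq mult.assoc)
    have "norm (\<Sum>j<k + 1 - 0. M1 j k * \<Psi> j k) \<le> (10/9) ^ 0 * (30/7) * a k"
      by (rule norm_sum_Psi_le) (use 1 a_bounds norm_M1 less.prems in auto)
    then have 3: "norm (\<theta> k) \<le> 30/7 * a k"
      by (simp add: \<theta>_def lessThan_Suc_atMost)
    have "norm (u * \<theta> k) \<le> 2 * (30/7 * a k)"
      by (intro order_trans[OF norm_mult_ineq] mult_mono 3 norm_u) auto
    then have "norm (\<phi> k - 1) \<le> 1/10" using a_bounds[OF less.prems] by (simp add: 2)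
    with 2 3 show ?case by simp
  qed
  from this[OF assms] show "\<phi> k = 1 + u * \<theta> k" "norm (\<theta> k) \<le> 30/7 * a k" "norm (\<phi> k - 1) \<le> 1/10"
    by blast+
qed

lemma phi_psi: "k \<le> n \<Longrightarrow> \<phi> k * \<psi> k = 1"
  and norm_psi: "k \<le> n \<Longrightarrow> norm (\<psi> k) \<le> 10/9"
  unfolding \<psi>_def by (rule neumann_inv[OF phi_theta(3)], assumption)+

lemma psi_eq: "k \<le> n \<Longrightarrow> \<psi> k = 1 - u * (\<theta> k * \<psi> k)"
  using phi_psi[of k] by (simp add: phi_theta(1) algebra_simps)

lemma theta_0: "\<theta> 0 = 0"
  using phi_theta(2)[of 0] zero by simp

lemma phi_0: "\<phi> 0 = 1" and psi_0: "\<psi> 0 = 1"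
  using phi_theta(1)[of 0] theta_0 by (auto simp: \<psi>_def neumann_inv_1)

lemma Psi_diag: "k \<ge> 1 \<Longrightarrow> \<Psi> k k = \<psi> (k - 1)"
  by (cases k) (auto simp: \<Psi>_def)

lemma Psi_subdiag: "\<Psi> k (Suc k) = \<psi> (k - 1) * \<psi> k"
proof (cases k)
  case (Suc l)
  then have "{k - 1..<Suc k} = {l, k}" by auto
  then show ?thesis using Suc by (simp add: \<Psi>_def)
qed (simp add: \<Psi>_def psi_0)

text \<open>The quotient of \<open>\<theta> k - of_real (a k)\<close> by \<open>u\<close>, written
  out because \<open>u\<close> cannot be cancelled in a general algebra.\<close>

definition "\<eta> k = A2 k * \<psi> (k - 1) - of_real (a k) * (\<theta> (k - 1) * \<psi> (k - 1)) + (\<Sum>j<k. M2 j k * \<Psi> j k)"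

lemma theta_eta:
  assumes "k \<le> n"
  shows "\<theta> k = of_real (a k) + u * \<eta> k"
proof (cases k)
  case 0
  have "norm (A2 0) \<le> 0" using norm_A2[of 0] zero by simp
  then show ?thesis using 0 zero theta_0 by (simp add: \<eta>_def)
next
  case (Suc l)
  have "\<theta> k = M1 k k * \<Psi> k k + (\<Sum>j<k. M1 j k * \<Psi> j k)"
    unfolding \<theta>_def lessThan_Suc_atMost[symmetric] by simp
  also have "(\<Sum>j<k. M1 j k * \<Psi> j k) = u * (\<Sum>j<k. M2 j k * \<Psi> j k)"
    unfolding sum_distrib_left using assms by (simp add: M1_eq mult.assoc)
  also have "M1 k k * \<Psi> k k = of_real (a k) * \<psi> l + u * (A2 k * \<psi> l)"
    using Suc assms by (simp add: M1_diag Psi_diag algebra_simps)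
  also have "of_real (a k) * \<psi> l = of_real (a k) - u * (of_real (a k) * (\<theta> l * \<psi> l))"
    using arg_cong[OF psi_eq[of l], of "\<lambda>z. of_real (a k) * z"] Suc assms by (simp add: algebra_simps)
  finally show ?thesis using Suc by (simp add: \<eta>_def algebra_simps)
qed

lemma norm_theta_psi: "k \<le> n \<Longrightarrow> norm (\<theta> k * \<psi> k) \<le> 5 * a k"
proof -
  assume k: "k \<le> n"
  have "norm (\<theta> k * \<psi> k) \<le> (30/7 * a k) * (10/9)"
    by (intro norm_mult_le_mult phi_theta norm_psi k)
  also have "\<dots> \<le> 5 * a k" using a_bounds[OF k] by simp
  finally show ?thesis .
qed

lemma norm_eta:
  assumes "k \<le> n"
  shows "norm (\<eta> k) \<le> 5/9 * b k + 100/21 * (a k * a (k - 1)) + 100/21 * e k"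
proof -
  have k: "k - 1 \<le> n" using assms by simp
  have 1: "norm (A2 k * \<psi> (k - 1)) \<le> b k / 2 * (10/9)"
    by (intro norm_mult_le_mult norm_A2 norm_psi assms k)
  have 2: "norm (of_real (a k) * (\<theta> (k - 1) * \<psi> (k - 1))) \<le> a k * ((30/7 * a (k-1)) * (10/9))"
    by (intro norm_mult_le_mult norm_of_real_le phi_theta norm_psi conjunct1[OF a_bounds] assms k)
  have "norm (\<Sum>j<k + 1 - 1. M2 j k * \<Psi> j k) \<le> (10/9) ^ 1 * (30/7) * e k"
    by (rule norm_sum_Psi_le) (use norm_psi nonneg norm_M2 assms in auto)
  then have 3: "norm (\<Sum>j<k. M2 j k * \<Psi> j k) \<le> 100/21 * e k" by simp
  show ?thesis unfolding \<eta>_def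
    using norm_triangle_ineq[of "A2 k * \<psi> (k - 1) - of_real (a k) * (\<theta> (k - 1) * \<psi> (k - 1))" "\<Sum>j<k. M2 j k * \<Psi> j k"]
      norm_triangle_ineq4[of "A2 k * \<psi> (k - 1)" "of_real (a k) * (\<theta> (k - 1) * \<psi> (k - 1))"] 1 2 3
    by (simp add: algebra_simps)
qed

text \<open>The scalar part of \<open>\<eta> k\<close>. As \<open>e k - a k * a (k - 1)\<close> is
  the covariance of neighbours, subtracting half of \<open>(a k)^2\<close> leaves the summands of
  \<open>\<Gamma>2\<close>.\<close>

definition "\<gamma> k = b k / 2 - a k * a (k - 1) + e k"

definition "\<kappa> k = A3 k * \<psi> (k-1) - of_real (b k / 2) * (\<theta> (k-1) * \<psi> (k-1))
   + of_real (a k) * of_real (a (k-1)) * (\<theta> (k-1) * \<psi> (k-1)) - of_real (a k) * (\<eta> (k-1) * \<psi> (k-1))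
   - of_real (e k) * (\<theta> (k-2) * \<psi> (k-2) * \<psi> (k-1) + \<theta> (k-1) * \<psi> (k-1))
   + B3 k * (\<psi> (k-2) * \<psi> (k-1)) + (\<Sum>j<k - 1. M3 j k * \<Psi> j k)"

text \<open>Every inverse is expanded one step only, \<psi> = 1 - u \<theta> \<psi>, with the
  bounded \<psi> itself left in the remainder; \<theta> = a + u \<eta> is inserted where a scalar
  has to be split off.\<close>

lemma eta_kappa:
  assumes "k \<le> n" "k \<ge> 1"
  shows "\<eta> k = of_real (\<gamma> k) + u * \<kappa> k"
proof -
  obtain l where l: "k = Suc l" using assms(2) by (cases k) auto
  have ln: "l \<le> n" "l - 1 \<le> n" using l assms(1) by auto
  define p where "p = \<psi> l"
  define q where "q = \<psi> (l - 1)"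
  define x where "x = \<theta> l"
  define y where "y = \<theta> (l - 1)"
  have p: "p = 1 - u * (x * p)" using psi_eq[OF ln(1)] by (simp add: p_def x_def)
  have q: "q = 1 - u * (y * q)" using psi_eq[OF ln(2)] by (simp add: q_def y_def)
  have x: "x = of_real (a l) + u * \<eta> l" using theta_eta[OF ln(1)] by (simp add: x_def)
  have 1: "A2 k * p = of_real (b k / 2) + u * (A3 k * p - of_real (b k / 2) * (x * p))"
  proof -
    have "A2 k * p = of_real (b k / 2) * p + u * (A3 k * p)"
      using A2_eq[OF assms(1)] by (simp add: algebra_simps)
    also have "of_real (b k / 2) * p = of_real (b k / 2) * (1 - u * (x * p))" using p by simp
    finally show ?thesis by (simp add: algebra_simps)
  qed
  have 2: "of_real (a k) * (x * p) = of_real (a k) * of_real (a l)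
      - u * (of_real (a k) * of_real (a l) * (x * p) - of_real (a k) * (\<eta> l * p))"
  proof -
    have "of_real (a k) * (x * p) = of_real (a k) * ((of_real (a l) + u * \<eta> l) * p)" using x by simp
    also have "\<dots> = of_real (a k) * of_real (a l) * p + u * (of_real (a k) * (\<eta> l * p))"
      by (simp add: algebra_simps)
    also have "of_real (a k) * of_real (a l) * p = of_real (a k) * of_real (a l) * (1 - u * (x * p))"
      using p by simp
    finally show ?thesis by (simp add: algebra_simps)
  qed
  have 3: "M2 l k * \<Psi> l k = of_real (e k) + u * (B3 k * (q * p) - of_real (e k) * (y * q * p + x * p))"
  proof -
    have "M2 l k * \<Psi> l k = of_real (e k) * (q * p) + u * (B3 k * (q * p))"
      using M2_diag[of l] assms by (simp add: l Psi_subdiag p_def q_def algebra_simps)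
    also have "q * p = (1 - u * (y * q)) * p" using q by simp
    also have "\<dots> = p - u * (y * q * p)" by (simp add: algebra_simps)
    also have "\<dots> = 1 - u * (x * p) - u * (y * q * p)" using p by simp
    also have "of_real (e k) * \<dots> + u * (B3 k * (1 - u * (x * p) - u * (y * q * p)))
       = of_real (e k) - u * (of_real (e k) * (y * q * p + x * p)) + u * (B3 k * (1 - u * (x * p) - u * (y * q * p)))"
      by (simp add: algebra_simps)
    \<comment> \<open>The rewriting hit the remainder term as well; there the product is folded
      back.\<close>
    also have "1 - u * (x * p) - u * (y * q * p) = q * p"
    proof -
      have "q * p = (1 - u * (y * q)) * p" using q by simp
      also have "\<dots> = p - u * (y * q * p)" by (simp add: algebra_simps)
      finally show ?thesis using p by simp
    qed
    finally show ?thesis by (simp add: algebra_simps)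
  qed
  have 4: "(\<Sum>j<k. M2 j k * \<Psi> j k) = M2 l k * \<Psi> l k + u * (\<Sum>j<l. M3 j k * \<Psi> j k)"
    using l assms(1) by (simp add: sum_distrib_left M2_eq mult.assoc)
  have l1: "k - 1 = l" "k - 2 = l - 1" using l by auto
  show ?thesis
    unfolding \<eta>_def \<kappa>_def \<gamma>_def 4 l1 p_def[symmetric] q_def[symmetric] x_def[symmetric] y_def[symmetric]
      1 2 3 by (simp add: algebra_simps)
qed

text \<open>The summand of \<open>R1\<close> with the means \<open>hatE_plus\<close> multiplied out,
  up to multiplicity and the extra cube at k-1, which stems from the product
  \<open>a k * a (k-1) * a (k-1)\<close>.\<close>

definition "rem k = a k ^ 3 + a (k-1) ^ 3 + a k * b k + c k + (a (k-2) + a (k-1) + a k) * e k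
   + d k + a (k-1) * b k + a k * b (k-1) + t k + a (k-2) * a (k-1) * a k + e (k-1) * a k"

lemma norm_kappa:
  assumes "k \<le> n"
  shows "norm (\<kappa> k) \<le> 20 * rem k"
proof -
  have n1: "k - 1 \<le> n" "k - 2 \<le> n" using assms by auto
  note a = a_bounds[OF assms] a_bounds[OF n1(1)] a_bounds[OF n1(2)]
  note nn = nonneg[OF assms] nonneg[OF n1(1)]
  have 1: "norm (A3 k * \<psi> (k-1)) \<le> c k * (10/9)"
    by (intro norm_mult_le_mult norm_A3 norm_psi assms n1)
  have 2: "norm (of_real (b k / 2) * (\<theta> (k-1) * \<psi> (k-1))) \<le> b k / 2 * (5 * a (k-1))"
    by (intro norm_mult_le_mult norm_theta_psi n1 norm_of_real_le) (use nn in auto)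
  have 3: "norm (of_real (a k) * of_real (a (k-1)) * (\<theta> (k-1) * \<psi> (k-1))) \<le> a k * a (k-1) * (5 * a (k-1))"
    by (intro norm_mult_le_mult norm_theta_psi n1 norm_of_real_le) (use a in auto)
  have l2: "k - 1 - 1 = k - 2" by simp
  have 4: "norm (of_real (a k) * (\<eta> (k-1) * \<psi> (k-1)))
      \<le> a k * ((5/9 * b (k-1) + 100/21 * (a (k-1) * a (k-2)) + 100/21 * e (k-1)) * (10/9))"
    by (intro norm_mult_le_mult norm_eta[OF n1(1), unfolded l2] norm_psi n1 norm_of_real_le) (use a in auto)
  have 5: "norm (of_real (e k) * (\<theta> (k-2) * \<psi> (k-2) * \<psi> (k-1) + \<theta> (k-1) * \<psi> (k-1)))
      \<le> e k * (5 * a (k-2) * (10/9) + 5 * a (k-1))"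
    by (intro norm_mult_le_mult norm_triangle_mono norm_theta_psi norm_psi n1 norm_of_real_le) (use nn in auto)
  have 6: "norm (B3 k * (\<psi> (k-2) * \<psi> (k-1))) \<le> d k * ((10/9) * (10/9))"
    by (intro norm_mult_le_mult norm_B3 norm_psi assms n1)
  have 7: "norm (\<Sum>j<k - 1. M3 j k * \<Psi> j k) \<le> 6 * t k"
  proof (cases "k \<ge> 1")
    case True
    have "norm (\<Sum>j<k + 1 - 2. M3 j k * \<Psi> j k) \<le> (10/9) ^ 2 * (30/7) * t k"
      by (rule norm_sum_Psi_le) (use norm_psi nonneg norm_M3 assms True in auto)
    also have "\<dots> \<le> 6 * t k" using nn by (simp add: power2_eq_square)
    finally show ?thesis by (simp add: numeral_2_eq_2)
  qed (use nn in simp)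
  have "norm (\<kappa> k) \<le> c k * (10/9) + b k / 2 * (5 * a (k-1)) + a k * a (k-1) * (5 * a (k-1))
     + a k * ((5/9 * b (k-1) + 100/21 * (a (k-1) * a (k-2)) + 100/21 * e (k-1)) * (10/9))
     + e k * (5 * a (k-2) * (10/9) + 5 * a (k-1)) + d k * ((10/9) * (10/9)) + 6 * t k"
    unfolding \<kappa>_def
    by (intro norm_triangle_mono order_trans[OF norm_triangle_ineq4] add_mono 1 2 3 4 5 6 7)
  also have "\<dots> \<le> 20 * rem k"
    unfolding rem_def by (rule remainder_bound1) (use a nn in auto)
  finally show ?thesis .
qed

text \<open>Chosen, because its cofactors are known only from existential statements. The norm bound
  and the expansion must hold for the same element, so both stand inside the choice.\<close>

definition "\<sigma> k = (SOME s. exp (of_real (- a k) * u) * \<phi> k = 1 + u * u * s \<and>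
   norm s \<le> 103/100 * norm (\<eta> k) + 27/50 * (a k)\<^sup>2 \<and>
   (\<exists>\<rho>. s = of_real (\<gamma> k - (a k)\<^sup>2 / 2) + u * \<rho> \<and> norm \<rho> \<le> 30 * rem k))"

text \<open>With \<phi> = 1 + a u + u^2 \<eta> inserted, exp (-a u) (1 + a u) has no first-order
  term. In 27/50 = 1/2 + 1/25 the second part absorbs the cubic term, as \<open>a k\<close> is at
  most 1/100.\<close>

lemma sigma:
  assumes "k \<le> n" "k \<ge> 1"
  shows "exp (of_real (- a k) * u) * \<phi> k = 1 + u * u * \<sigma> k \<and>
   norm (\<sigma> k) \<le> 103/100 * norm (\<eta> k) + 27/50 * (a k)\<^sup>2 \<and>
   (\<exists>\<rho>. \<sigma> k = of_real (\<gamma> k - (a k)\<^sup>2 / 2) + u * \<rho> \<and> norm \<rho> \<le> 30 * rem k)"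
  unfolding \<sigma>_def
proof (rule someI_ex)
  have n1: "k - 1 \<le> n" "k - 2 \<le> n" using assms by auto
  note a = a_bounds[OF assms(1)] a_bounds[OF n1(1)] a_bounds[OF n1(2)]
  note nn = nonneg[OF assms(1)] nonneg[OF n1(1)]
  have ak: "0 \<le> a k" "a k \<le> 1/100" using a by auto
  let ?E = "exp (of_real (- a k) * u)"
  note ex = exp_neg_small[OF norm_u ak]
  obtain w where w: "?E = 1 + u * (of_real (a k) * w)" "norm w \<le> 103/100" using ex(2) by blast
  obtain v where v: "(1 + of_real (a k) * u) * ?E = 1 - u * u * of_real ((a k)\<^sup>2 / 2) + u * u * u * (of_real (a k ^ 3) * v)"
    "norm v \<le> 2" using ex(3) by blast
  define s where "s = - of_real ((a k)\<^sup>2 / 2) + u * (of_real (a k ^ 3) * v) + ?E * \<eta> k"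
  have "?E * \<phi> k = (1 + of_real (a k) * u) * ?E + u * u * (?E * \<eta> k)"
    using assms by (simp add: phi_theta(1) theta_eta algebra_simps)
  also have "\<dots> = 1 + u * u * s"
    unfolding v(1) by (simp add: s_def algebra_simps)
  finally have 1: "?E * \<phi> k = 1 + u * u * s" .
  have v3: "norm (of_real (a k ^ 3) * v) \<le> a k ^ 3 * 2"
    by (intro norm_mult_le_mult norm_of_real_le v) (use ak in auto)
  have "norm (u * (of_real (a k ^ 3) * v)) \<le> 2 * (a k ^ 3 * 2)"
    by (intro norm_mult_le_mult norm_u v3)
  also have "\<dots> \<le> 1/25 * (a k)\<^sup>2"
    using mult_left_mono[OF ak(2), of "(a k)\<^sup>2"] by (simp add: power2_eq_square power3_eq_cube)
  finally have 2: "norm (u * (of_real (a k ^ 3) * v)) \<le> 1/25 * (a k)\<^sup>2" .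
  have 3: "norm (?E * \<eta> k) \<le> 103/100 * norm (\<eta> k)"
    by (intro norm_mult_le_mult ex) simp
  have 4: "norm (- of_real ((a k)\<^sup>2 / 2) :: 'a) \<le> (a k)\<^sup>2 / 2"
    unfolding norm_minus_cancel norm_of_real by simp
  have "norm s \<le> (a k)\<^sup>2 / 2 + 1/25 * (a k)\<^sup>2 + 103/100 * norm (\<eta> k)"
    unfolding s_def by (intro norm_triangle_mono 2 3 4)
  then have 5: "norm s \<le> 103/100 * norm (\<eta> k) + 27/50 * (a k)\<^sup>2" by simp
  define \<rho> where "\<rho> = of_real (a k ^ 3) * v + \<kappa> k + of_real (a k) * w * \<eta> k"
  have 6: "s = of_real (\<gamma> k - (a k)\<^sup>2 / 2) + u * \<rho>"
  proof -
    have "?E * \<eta> k = \<eta> k + u * (of_real (a k) * w) * \<eta> k" unfolding w(1) by (simp add: algebra_simps)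
    then show ?thesis using eta_kappa[OF assms] by (simp add: s_def \<rho>_def algebra_simps)
  qed
  have "norm (of_real (a k) * w * \<eta> k) \<le> a k * (103/100) * (5/9 * b k + 100/21 * (a k * a (k - 1)) + 100/21 * e k)"
    by (intro norm_mult_le_mult norm_of_real_le w norm_eta assms) (use ak in auto)
  then have "norm \<rho> \<le> a k ^ 3 * 2 + 20 * rem k + a k * (103/100) * (5/9 * b k + 100/21 * (a k * a (k - 1)) + 100/21 * e k)"
    unfolding \<rho>_def by (intro norm_triangle_mono v3 norm_kappa assms)
  also have "\<dots> \<le> 30 * rem k"
    unfolding rem_def by (rule remainder_bound2) (use a nn in auto)
  finally have 7: "norm \<rho> \<le> 30 * rem k" .
  show "\<exists>s. ?E * \<phi> k = 1 + u * u * s \<and> norm s \<le> 103/100 * norm (\<eta> k) + 27/50 * (a k)\<^sup>2 \<and>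
     (\<exists>\<rho>. s = of_real (\<gamma> k - (a k)\<^sup>2 / 2) + u * \<rho> \<and> norm \<rho> \<le> 30 * rem k)"
    using 1 5 6 7 by blast
qed

text \<open>103/180 and 103/21 are 103/100 times coefficients of \<open>norm_eta\<close>; splitting
  the product of two means into squares halves the latter to 103/42.\<close>

lemma norm_sigma:
  assumes "k \<le> n" "k \<ge> 1"
  shows "norm (\<sigma> k) \<le> 103/180 * b k + 103/42 * ((a k)\<^sup>2 + (a (k-1))\<^sup>2) + 103/21 * e k + 27/50 * (a k)\<^sup>2"
proof -
  have "2 * (a k * a (k-1)) \<le> (a k)\<^sup>2 + (a (k-1))\<^sup>2"
    using sum_squares_bound[of "a k" "a (k-1)"] by (simp add: mult.assoc)
  moreover have "s \<le> 103/180 * x + 103/42 * (A + A') + 103/21 * z + 27/50 * A"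
    if "2 * p \<le> A + A'" "s \<le> 103/100 * h + 27/50 * A" "h \<le> 5/9 * x + 100/21 * p + 100/21 * z"
    for s x A A' z p h :: real using that by argo
  ultimately show ?thesis using conjunct1[OF conjunct2[OF sigma[OF assms]]] norm_eta[OF assms(1)] by blast
qed

text \<open>By telescoping, \<open>F (j-2)\<close> equals \<open>F (k-1) * \<Psi> j k\<close>, so
  the renewal sum is \<open>F (k-1) * (\<phi> k - 1)\<close>. For \<open>j = 1\<close> truncated
  subtraction supplies \<open>F 0 = 1\<close> as the value at -1.\<close>

lemma renewal_product:
  fixes F :: "nat \<Rightarrow> 'a"
  assumes F0: "F 0 = 1" and m0: "\<And>k. 1 \<le> k \<Longrightarrow> k \<le> n \<Longrightarrow> m 0 k = 0"
    and rec: "\<And>k. 1 \<le> k \<Longrightarrow> k \<le> n \<Longrightarrow> F k = F (k-1) + (\<Sum>j=1..k. F (j-2) * m j k)"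
    and k: "k \<le> n"
  shows "F k = (\<Prod>i=1..k. \<phi> i)"
  using k
proof (induction k rule: less_induct)
  case (less k)
  show ?case
  proof (cases k)
    case 0 then show ?thesis by (simp add: F0)
  next
    case (Suc l)
    have Fj: "F (j - 2) = F l * \<Psi> j k" if j: "1 \<le> j" "j \<le> k" for j
    proof -
      have "F l = (\<Prod>i=1..l. \<phi> i)" using less Suc by simp
      also have "\<dots> = (\<Prod>i\<in>{..<k}. \<phi> i)"
        unfolding Suc lessThan_Suc_atMost by (simp add: prod.atMost_shift phi_0 prod.atLeast1_atMost_eq)
      also have "{..<k} = {..<j-1} \<union> {j-1..<k}" using j by auto
      also have "prod \<phi> \<dots> = prod \<phi> {..<j-1} * prod \<phi> {j-1..<k}"
        by (rule prod.union_disjoint) auto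
      finally have "F l * \<Psi> j k = prod \<phi> {..<j-1} * (\<Prod>i\<in>{j-1..<k}. \<phi> i * \<psi> i)"
        by (simp add: \<Psi>_def prod.distrib mult.assoc)
      also have "(\<Prod>i\<in>{j-1..<k}. \<phi> i * \<psi> i) = 1"
        using less.prems by (intro prod.neutral) (auto intro: phi_psi)
      also have "prod \<phi> {..<j-1} = F (j-2)"
      proof (cases "j = 1")
        case False
        then obtain i where i: "j = Suc (Suc i)" using j by (metis One_nat_def Suc_le_D not0_implies_Suc)
        have "F i = (\<Prod>i=1..i. \<phi> i)" using i j less by simp
        then show ?thesis
          using i by (simp add: lessThan_Suc_atMost prod.atMost_shift phi_0 prod.atLeast1_atMost_eq)
      qed (simp add: F0)
      finally show ?thesis by simp
    qed
    have "F k = F l + (\<Sum>j=1..k. F (j-2) * m j k)" using rec[of k] less.prems Suc by simp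
    also have "(\<Sum>j=1..k. F (j-2) * m j k) = (\<Sum>j=1..k. F l * (m j k * \<Psi> j k))"
      by (intro sum.cong) (auto simp: Fj algebra_simps)
    also have "\<dots> = (\<Sum>j\<le>k. F l * (m j k * \<Psi> j k))"
      using m0[of k] less.prems Suc by (intro sum.mono_neutral_left) (auto simp: Suc_le_eq)
    finally have "F k = F l * \<phi> k"
      by (simp add: phi_eq sum_distrib_left distrib_left)
    moreover have "F l = (\<Prod>i=1..l. \<phi> i)" using less Suc by simp
    ultimately show ?thesis using Suc by (simp add: mult.commute)
  qed
qed

lemma prod_phi:
  assumes "k \<le> n"
  shows "(\<Prod>i=1..k. \<phi> i) = exp (of_real (\<Sum>i=1..k. a i) * u) * (\<Prod>i=1..k. 1 + u * u * \<sigma> i)"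
  using assms
proof (induction k)
  case (Suc k)
  let ?x = "of_real (a (Suc k)) * u"
  have "exp ?x * exp (- ?x) = 1" by (metis exp_minus_inverse)
  then have "\<phi> (Suc k) = exp ?x * (exp (- ?x) * \<phi> (Suc k))" by (simp add: mult.assoc[symmetric])
  also have "exp (- ?x) * \<phi> (Suc k) = 1 + u * u * \<sigma> (Suc k)"
    using sigma[of "Suc k"] Suc.prems by simp
  finally have 1: "\<phi> (Suc k) = exp ?x * (1 + u * u * \<sigma> (Suc k))" .
  have "exp (of_real (\<Sum>i=1..Suc k. a i) * u) = exp (of_real (\<Sum>i=1..k. a i) * u + ?x)"
    by (simp add: algebra_simps)
  also have "\<dots> = exp (of_real (\<Sum>i=1..k. a i) * u) * exp ?x"
    by (rule exp_add_commuting) (rule mult.commute)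
  finally show ?case using Suc by (simp add: 1 algebra_simps)
qed simp

end

subsection \<open>Norm bounds for the accompanying expansions\<close>

text \<open>Makes the square root of (2r)!, divided by r!, at most 2^r: this is what renders the
  series over the powers of \<open>u^2\<close> geometric.\<close>

lemma fact_double_le: "fact (2 * r) \<le> ((2 ^ r * fact r)\<^sup>2 :: real)"
proof (induction r)
  case (Suc r)
  have "(fact (2 * Suc r) :: real) = (2 * real r + 2) * (2 * real r + 1) * fact (2 * r)"
    by (simp add: algebra_simps)
  also have "\<dots> \<le> (2 * real r + 2) * (2 * real r + 2) * (2 ^ r * fact r)\<^sup>2"
    by (intro mult_mono Suc) auto
  also have "\<dots> = (2 ^ Suc r * fact (Suc r))\<^sup>2"
    by (simp add: power2_eq_square algebra_simps)
  finally show ?case .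
qed simp

lemma power_2_le_fact: "2 ^ r \<le> (2 * fact r :: real)"
proof (induction r)
  case (Suc r)
  show ?case
  proof (cases r)
    case (Suc q)
    have "(2 :: real) ^ Suc r \<le> (real r + 1) * (2 * fact r)"
      using Suc.IH Suc mult_mono[of 2 "real r + 1" "2 ^ r" "2 * fact r :: real"] by simp
    then show ?thesis by (simp add: algebra_simps)
  qed simp
qed simp

text \<open>For \<open>r \<ge> 1\<close> the Charlier bound gives the ratio 2s/r. For
  \<open>r < 1\<close> the trivial bound is 4^i, of which a factor 2^i is absorbed by
  \<open>fact i\<close>; the ratio is then 2s, at the price of the leading 2.\<close>

lemma diffu_power_term_le:
  assumes r: "r > 0" and s: "s \<ge> 0"
  shows "s ^ i / fact i * norm (diffu ^ (2 * i) * poisson_l1 r) \<le> 2 * (2 * s * min 1 (1 / r)) ^ i"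
proof (cases "r \<ge> 1")
  case True
  have "norm (diffu ^ (2 * i) * poisson_l1 r) \<le> sqrt (fact (2 * i) / r ^ (2 * i))"
    by (rule norm_diffu_power_poisson_le[OF r])
  also have "\<dots> \<le> sqrt ((2 ^ i * fact i / r ^ i)\<^sup>2)"
    using divide_right_mono[OF fact_double_le, of "r ^ (2 * i)" i] r
    by (simp add: power_divide power_mult[symmetric] mult.commute)
  also have "\<dots> = 2 ^ i * fact i / r ^ i"
    unfolding real_sqrt_abs using r by simp
  finally have "s ^ i / fact i * norm (diffu ^ (2 * i) * poisson_l1 r) \<le> s ^ i / fact i * (2 ^ i * fact i / r ^ i)"
    using s by (intro mult_left_mono) auto
  also have "\<dots> = (2 * s * (1 / r)) ^ i"
    by (simp add: power_mult_distrib power_divide)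
  also have "1 / r = min 1 (1 / r)" using True by simp
  finally show ?thesis using s r by (smt (verit) min_def mult_nonneg_nonneg zero_le_power divide_nonneg_pos)
next
  case False
  have "s ^ i / fact i * norm (diffu ^ (2 * i) * poisson_l1 r) \<le> s ^ i / fact i * 2 ^ (2 * i)"
    using s r by (intro mult_left_mono norm_diffu_power_poisson_le') auto
  also have "\<dots> = (2 * s) ^ i * (2 ^ i / fact i)"
  proof -
    have "(2 :: real) ^ (2 * i) = 2 ^ i * 2 ^ i" by (simp only: mult_2 power_add)
    then show ?thesis by (simp only: power_mult_distrib) simp
  qed
  also have "\<dots> \<le> (2 * s) ^ i * 2"
    using s power_2_le_fact[of i] by (intro mult_left_mono) (auto simp: field_simps)
  also have "\<dots> = 2 * (2 * s * min 1 (1 / r)) ^ i"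
    using False r by simp
  finally show ?thesis .
qed

lemma sum_powers_le:
  assumes "0 \<le> x" "x \<le> (19/20 :: real)"
  shows "(\<Sum>i=q..n. x ^ i) \<le> 20 * x ^ q"
proof (cases "q \<le> n")
  case True
  have "1/20 * (\<Sum>i=q..n. x ^ i) \<le> (1 - x) * (\<Sum>i=q..n. x ^ i)"
    using assms by (intro mult_right_mono sum_nonneg) auto
  also have "\<dots> \<le> x ^ q"
    unfolding sum_gp_multiplied[OF True] using assms by simp
  finally show ?thesis by simp
qed (use assms in simp)

text \<open>The constant 8 serves both bounds: it is 2^3, and it exceeds the square root of
  3!.\<close>

lemma norm_diffu_cube_poisson_le:
  assumes r: "r > 0"
  shows "norm (diffu ^ 3 * poisson_l1 r) \<le> 8 * min 1 (r powr (-3/2))"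
proof -
  have "norm (diffu ^ 3 * poisson_l1 r) \<le> sqrt (fact 3 / r ^ 3)"
    by (rule norm_diffu_power_poisson_le[OF r])
  also have "\<dots> \<le> 8 * r powr (-3/2)"
  proof (rule real_le_lsqrt)
    have "(r powr (-3/2))\<^sup>2 = 1 / r ^ 3"
    proof -
      have "(r powr (-3/2))\<^sup>2 = r powr (- real 3)"
        unfolding power2_eq_square powr_add[symmetric] by simp
      then show ?thesis
        unfolding powr_minus using powr_realpow[OF r, of 3] by (simp only: divide_inverse)
    qed
    moreover have "fact 3 / r ^ 3 \<le> 64 * (1 / r ^ 3)"
      using r by (simp add: fact_numeral divide_right_mono)
    ultimately show "fact 3 / r ^ 3 \<le> (8 * r powr (-3/2))\<^sup>2"
      by (simp only: power_mult_distrib) simp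
  qed (use r in auto)
  finally show ?thesis using norm_diffu_power_poisson_le'[OF r, of 3] by (simp add: min_def)
qed

text \<open>\<open>G_large\<close> is the form in which the positivity of \<lambda> controls the
  ratio of the series.\<close>

locale poisson_expansion = expansion diffu n m M1 M2 M3 A2 A3 B3 a b c e d t
  for n m M1 M2 M3 A2 A3 B3 a b c e d t +
  fixes F :: "nat \<Rightarrow> l1" and G :: real
  assumes F0: "F 0 = 1" and m0: "\<And>k. 1 \<le> k \<Longrightarrow> k \<le> n \<Longrightarrow> m 0 k = 0"
    and rec: "\<And>k. 1 \<le> k \<Longrightarrow> k \<le> n \<Longrightarrow> F k = F (k-1) + (\<Sum>j=1..k. F (j-2) * m j k)"
    and G_eq: "G = (\<Sum>k=1..n. a k)"
    and G_pos: "G > 0"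
    and G_large: "1.52 * (\<Sum>k=1..n. b k) + 12 * (\<Sum>k=1..n. e k) \<le> G"
begin

definition "r0 = (\<Sum>k=1..n. b k + (a k)\<^sup>2 + e k)"
definition "s = (\<Sum>k=1..n. norm (\<sigma> k))"

lemma s_nonneg: "0 \<le> s"
  unfolding s_def by (intro sum_nonneg) auto

text \<open>The squares sum to at most G/100, so 2s is at most 103/90 B + 206/21 E + 0.11 G. As
  103/90 and 206/21 are below 0.82 times 1.52 and 12, this is at most 0.93 G.\<close>

lemma s_le: "s \<le> 6 * r0" "2 * s \<le> 19/20 * G"
proof -
  define A B E where "A = (\<Sum>k=1..n. (a k)\<^sup>2)" and "B = (\<Sum>k=1..n. b k)" and "E = (\<Sum>k=1..n. e k)"
  have nn: "0 \<le> A" "0 \<le> B" "0 \<le> E"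
    unfolding A_def B_def E_def using nonneg by (auto intro!: sum_nonneg)
  \<comment> \<open>The index shift is free because \<open>a 0 = 0\<close>.\<close>
  have "(\<Sum>k=1..n. (a (k-1))\<^sup>2) = (\<Sum>k<n. (a k)\<^sup>2)"
    using sum.atLeast1_atMost_eq[of "\<lambda>k. (a (k-1))\<^sup>2" n] by (simp only: One_nat_def diff_Suc_Suc diff_zero)
  also have "\<dots> \<le> (\<Sum>k\<in>insert 0 {1..n}. (a k)\<^sup>2)"
    by (intro sum_mono2) auto
  also have "\<dots> = A" using zero by (simp add: A_def)
  finally have A': "(\<Sum>k=1..n. (a (k-1))\<^sup>2) \<le> A" .
  have "s \<le> (\<Sum>k=1..n. 103/180 * b k + 103/42 * ((a k)\<^sup>2 + (a (k-1))\<^sup>2) + 103/21 * e k + 27/50 * (a k)\<^sup>2)"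
    unfolding s_def by (intro sum_mono norm_sigma) auto
  also have "\<dots> = 103/180 * B + 103/42 * (A + (\<Sum>k=1..n. (a (k-1))\<^sup>2)) + 103/21 * E + 27/50 * A"
    by (simp only: sum.distrib sum_distrib_left A_def B_def E_def distrib_left)
  finally have s: "s \<le> 103/180 * B + 103/42 * (A + A) + 103/21 * E + 27/50 * A" using A' by argo
  have r0: "r0 = B + A + E" by (simp add: r0_def sum.distrib A_def B_def E_def)
  show "s \<le> 6 * r0" unfolding r0 using s nn by argo
  have "A \<le> (\<Sum>k=1..n. 1/100 * a k)"
    unfolding A_def power2_eq_square by (intro sum_mono mult_right_mono) (use a_bounds in auto)
  then have "A \<le> G / 100" by (simp only: sum_distrib_left[symmetric] G_eq)
  moreover have "152 / 100 * B + 12 * E \<le> G" using G_large by (simp add: B_def E_def)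
  ultimately show "2 * s \<le> 19/20 * G" using s nn by argo
qed

text \<open>The term r = 0 is the Poisson law. The term r = 1 splits into the scalar correction and
  a part carrying \<open>u^3\<close>, and the rest is a geometric tail with constant 40 = 2 * 20.
  Thus 480 = 40 * 2 * 6, 5760 = 40 * 12^2 and 240 = 30 * 8.\<close>

lemma F_approx:
  defines "\<mu> \<equiv> min 1 (1 / G)"
  shows "norm (F n - poisson_l1 G) \<le> 480 * r0 * \<mu>"
    and "norm (F n - poisson_l1 G * (1 + of_real (\<Sum>k=1..n. \<gamma> k - (a k)\<^sup>2 / 2) * diffu ^ 2))
       \<le> 5760 * r0\<^sup>2 * \<mu>\<^sup>2 + 240 * (\<Sum>k=1..n. rem k) * min 1 (G powr (-3/2))"
proof -
  let ?P = "poisson_l1 G"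
  define x where "x = 2 * s * \<mu>"
  have \<mu>: "0 \<le> \<mu>" using G_pos by (simp add: \<mu>_def)
  have x: "0 \<le> x" using s_nonneg \<mu> by (simp add: x_def)
  have x1: "x \<le> 19/20"
  proof -
    have "x \<le> 19/20 * G * \<mu>" unfolding x_def by (intro mult_right_mono s_le \<mu>)
    also have "G * \<mu> \<le> 1" using G_pos by (simp add: \<mu>_def min_def field_simps)
    then have "19/20 * G * \<mu> \<le> 19/20" by simp
    finally show ?thesis .
  qed
  obtain f where f: "(\<Prod>k=1..n. 1 + diffu\<^sup>2 * \<sigma> k) = (\<Sum>r\<le>n. (diffu\<^sup>2) ^ r * f r)" "f 0 = 1"
    "f 1 = (\<Sum>k=1..n. \<sigma> k)" "\<And>r. r > n \<Longrightarrow> f r = 0" "\<And>r. norm (f r) \<le> s ^ r / fact r"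
    using prod_one_plus_expansion[of "diffu\<^sup>2" \<sigma> n] unfolding s_def by blast
  have F: "F n = (\<Sum>r\<le>n. f r * (diffu ^ (2 * r) * ?P))"
  proof -
    have "F n = (\<Prod>i=1..n. \<phi> i)" by (rule renewal_product[OF F0 m0 rec]) auto
    also have "\<dots> = ?P * (\<Sum>r\<le>n. (diffu\<^sup>2) ^ r * f r)"
      unfolding prod_phi[OF order_refl] G_eq[symmetric] f(1)[symmetric] by (simp add: power2_eq_square)
    finally show ?thesis unfolding power_mult sum_distrib_left by (simp only: mult.commute mult.left_commute)
  qed
  have tail: "norm (\<Sum>r=q..n. f r * (diffu ^ (2 * r) * ?P)) \<le> 40 * x ^ q" for q
  proof -
    have "norm (f r * (diffu ^ (2 * r) * ?P)) \<le> 2 * x ^ r" for r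
    proof -
      have "norm (f r * (diffu ^ (2 * r) * ?P)) \<le> s ^ r / fact r * norm (diffu ^ (2 * r) * ?P)"
        by (intro order_trans[OF norm_mult_ineq] mult_right_mono f) auto
      also have "\<dots> \<le> 2 * x ^ r"
        unfolding x_def \<mu>_def by (rule diffu_power_term_le[OF G_pos s_nonneg])
      finally show ?thesis .
    qed
    then have "norm (\<Sum>r=q..n. f r * (diffu ^ (2 * r) * ?P)) \<le> (\<Sum>r=q..n. 2 * x ^ r)"
      by (intro sum_norm_le)
    also have "\<dots> \<le> 2 * (20 * x ^ q)"
      unfolding sum_distrib_left[symmetric] by (intro mult_left_mono sum_powers_le x x1) auto
    finally show ?thesis by simp
  qed
  have F1: "F n = ?P + (\<Sum>r=1..n. f r * (diffu ^ (2 * r) * ?P))"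
    unfolding F by (simp add: sum.atMost_shift sum.atLeast1_atMost_eq f(2))
  have "norm (F n - ?P) \<le> 40 * x ^ 1"
    unfolding F1 using tail[of 1] by simp
  also have "\<dots> = 80 * \<mu> * s" by (simp add: x_def)
  also have "\<dots> \<le> 80 * \<mu> * (6 * r0)" using \<mu> by (intro mult_left_mono s_le) auto
  finally show "norm (F n - ?P) \<le> 480 * r0 * \<mu>" by (simp add: algebra_simps)
  have n: "1 \<le> n" using G_pos G_eq by (cases n) auto
  have F2: "F n = ?P + f 1 * (diffu ^ 2 * ?P) + (\<Sum>r=2..n. f r * (diffu ^ (2 * r) * ?P))"
    unfolding F1 using n by (simp add: sum.atLeast_Suc_atMost numeral_2_eq_2)
  have "\<forall>k\<in>{1..n}. \<exists>\<rho>. \<sigma> k = of_real (\<gamma> k - (a k)\<^sup>2 / 2) + diffu * \<rho> \<and> norm \<rho> \<le> 30 * rem k"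
    using sigma by auto
  then obtain \<rho> where \<rho>: "\<And>k. k \<in> {1..n} \<Longrightarrow> \<sigma> k = of_real (\<gamma> k - (a k)\<^sup>2 / 2) + diffu * \<rho> k"
    "\<And>k. k \<in> {1..n} \<Longrightarrow> norm (\<rho> k) \<le> 30 * rem k" by metis
  let ?g = "of_real (\<Sum>k=1..n. \<gamma> k - (a k)\<^sup>2 / 2) :: l1"
  have f1: "f 1 = ?g + diffu * (\<Sum>k=1..n. \<rho> k)"
    unfolding f(3) of_real_sum sum_distrib_left sum.distrib[symmetric] by (intro sum.cong \<rho>) auto
  have eq: "F n - ?P * (1 + ?g * diffu ^ 2)
     = (\<Sum>k=1..n. \<rho> k) * (diffu ^ 3 * ?P) + (\<Sum>r=2..n. f r * (diffu ^ (2 * r) * ?P))"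
    unfolding F2 f1 by (simp add: algebra_simps power2_eq_square power3_eq_cube)
  have "norm (\<Sum>k=1..n. \<rho> k) \<le> 30 * (\<Sum>k=1..n. rem k)"
    unfolding sum_distrib_left by (intro sum_norm_le \<rho>)
  then have "norm ((\<Sum>k=1..n. \<rho> k) * (diffu ^ 3 * ?P)) \<le> 30 * (\<Sum>k=1..n. rem k) * (8 * min 1 (G powr (-3/2)))"
    by (intro norm_mult_le_mult norm_diffu_cube_poisson_le G_pos)
  also have "\<dots> = 240 * (\<Sum>k=1..n. rem k) * min 1 (G powr (-3/2))" by simp
  finally have "norm ((\<Sum>k=1..n. \<rho> k) * (diffu ^ 3 * ?P)) \<le> 240 * (\<Sum>k=1..n. rem k) * min 1 (G powr (-3/2))" .
  moreover have "40 * x ^ 2 \<le> 5760 * r0\<^sup>2 * \<mu>\<^sup>2"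
  proof -
    have "x \<le> 2 * (6 * r0) * \<mu>" unfolding x_def by (intro mult_right_mono mult_left_mono s_le \<mu>) auto
    from power_mono[OF this x, of 2] show ?thesis by (simp add: power_mult_distrib mult.commute)
  qed
  ultimately show "norm (F n - ?P * (1 + ?g * diffu ^ 2))
       \<le> 5760 * r0\<^sup>2 * \<mu>\<^sup>2 + 240 * (\<Sum>k=1..n. rem k) * min 1 (G powr (-3/2))"
    unfolding eq using tail[of 2]
      norm_triangle_ineq[of "(\<Sum>k=1..n. \<rho> k) * (diffu ^ 3 * ?P)" "\<Sum>r=2..n. f r * (diffu ^ (2 * r) * ?P)"]
    by linarith
qed

end

subsection \<open>Factorial expansions and 1-dependence\<close>

text \<open>Iterated divided differences of \<open>x \<mapsto> shift ^ x\<close> with respect to the factor \<open>diffu\<close>.\<close>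

definition y1 :: "nat \<Rightarrow> l1" where "y1 x = (\<Sum>i<x. shift ^ i)"
definition y2 :: "nat \<Rightarrow> l1" where "y2 x = (\<Sum>i<x. y1 i)"
definition y3 :: "nat \<Rightarrow> l1" where "y3 x = (\<Sum>i<x. y2 i)"

lemma shift_power_eq: "shift ^ x = 1 + diffu * y1 x"
  using power_diff_1_eq[of shift x] by (simp add: diffu_def y1_def algebra_simps)

lemma y1_eq: "y1 x = of_real (real x) + diffu * y2 x"
proof -
  have "y1 x = (\<Sum>i<x. 1 + diffu * y1 i)" unfolding y1_def[of x] shift_power_eq ..
  then show ?thesis by (simp add: sum.distrib sum_distrib_left y2_def)
qed

lemma y2_eq: "y2 x = of_real (real x * (real x - 1) / 2) + diffu * y3 x"
proof (induction x)
  case (Suc x)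
  define A where "A = real x * (real x - 1) / 2"
  have e1: "real (Suc x) * (real (Suc x) - 1) / 2 = A + real x"
    by (simp add: A_def field_simps)
  have e2: "y2 (Suc x) = (of_real A + diffu * y3 x) + (of_real (real x) + diffu * y2 x)"
    using arg_cong2[where f = "(+)", OF Suc y1_eq[of x]] by (simp add: y2_def A_def)
  have e3: "y3 (Suc x) = y3 x + y2 x" by (simp add: y3_def)
  show ?case unfolding e1 e2 e3 of_real_add distrib_left
    by (simp only: add.assoc add.commute add.left_commute)
qed (simp add: y2_def y3_def)

lemma norm_y1: "norm (y1 x) \<le> real x"
proof -
  have "norm (y1 x) \<le> (\<Sum>i<x. 1)"
    unfolding y1_def by (intro sum_norm_le) (simp add: norm_shift_power)
  then show ?thesis by simp
qed

lemma norm_y2: "norm (y2 x) \<le> real x * (real x - 1) / 2"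
proof (induction x)
  case (Suc x)
  have "norm (y2 (Suc x)) \<le> norm (y2 x) + norm (y1 x)"
    by (simp add: y2_def norm_triangle_ineq)
  also have "\<dots> \<le> real x * (real x - 1) / 2 + real x"
    by (intro add_mono Suc norm_y1)
  finally show ?case by (simp add: field_simps)
qed (simp add: y2_def)

lemma falling_2: "falling 2 x = real x * (real x - 1)"
  by (simp add: falling_def numeral_2_eq_2)

lemma falling_3: "falling 3 x = real x * (real x - 1) * (real x - 2)"
  by (simp add: falling_def numeral_3_eq_3)

lemma falling_4: "falling 4 x = real x * (real x - 1) * (real x - 2) * (real x - 3)"
  by (simp add: falling_def eval_nat_numeral)

lemma norm_y3: "norm (y3 x) \<le> falling 3 x"
proof -
  have "norm (y3 x) \<le> falling 3 x / 6"
  proof (induction x)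
    case (Suc x)
    have "norm (y3 (Suc x)) \<le> norm (y3 x) + norm (y2 x)"
      by (simp add: y3_def norm_triangle_ineq)
    also have "\<dots> \<le> falling 3 x / 6 + real x * (real x - 1) / 2"
      by (intro add_mono Suc norm_y2)
    finally show ?case by (simp add: falling_3 field_simps)
  qed (simp add: y3_def falling_3)
  then show ?thesis using norm_ge_zero[of "y3 x"] by linarith
qed

lemma norm_shift_power_minus_1: "norm (shift ^ x - 1) \<le> 2 * (if x \<ge> 1 then 1 else 0)"
  using norm_triangle_ineq4[of "shift ^ x" 1] by (cases "x = 0") (auto simp: norm_shift_power)

text \<open>Turns the finite fourth factorial moment into integrable cubes, which dominate the
  integrands to come. From 4 on, the last three factors are at least x/2, x/4 and 1; up to 3 the
  falling factorial vanishes.\<close>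

lemma cube_le_falling_4: "real x ^ 3 \<le> 81 + 11 * falling 4 x"
proof (cases "x \<le> 3")
  case True
  then have "x = 0 \<or> x = 1 \<or> x = 2 \<or> x = 3" by auto
  then show ?thesis by (auto simp: falling_4)
next
  case False
  then have x: "real x \<ge> 4" by simp
  have "real x * (1/2 * real x) * (1/4 * real x) * 1 \<le> real x * (real x - 1) * (real x - 2) * (real x - 3)"
    using x by (intro mult_mono) auto
  then have "real x ^ 3 \<le> 8 * falling 4 x" by (simp add: falling_4 power3_eq_cube)
  moreover have "0 \<le> falling 4 x" using x unfolding falling_4 by (intro mult_nonneg_nonneg) auto
  ultimately show ?thesis by linarith
qed

lemma mult3_le_cubes:
  fixes x y z :: real
  assumes "0 \<le> x" "0 \<le> y" "0 \<le> z"
  shows "x * y * z \<le> x ^ 3 + y ^ 3 + z ^ 3"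
proof -
  define w where "w = max x (max y z)"
  have "x * y * z \<le> w * w * w" using assms by (intro mult_mono) (auto simp: w_def)
  also have "\<dots> = w ^ 3" by (simp add: power3_eq_cube)
  also have "\<dots> \<le> x ^ 3 + y ^ 3 + z ^ 3"
  proof -
    have "w = x \<or> w = y \<or> w = z" by (auto simp: w_def max_def)
    moreover have "0 \<le> x ^ 3" "0 \<le> y ^ 3" "0 \<le> z ^ 3" using assms by auto
    ultimately show ?thesis by auto
  qed
  finally show ?thesis .
qed

text \<open>For even \<open>p\<close> the left side is (1/5)^p; for odd \<open>p\<close> the halving
  rounds down and equality holds.\<close>

lemma decay_ge: "2 ^ p * (1/100) ^ (p div 2) \<le> decay p"
proof (cases "even p")
  case True
  then obtain h where h: "p = 2 * h" by auto
  have "(2 :: real) ^ p * (1/100) ^ (p div 2) = (4 * (1/100)) ^ h"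
    unfolding h power_mult_distrib by (simp add: power_mult)
  also have "\<dots> = (1/5) ^ p" unfolding h power_mult by (simp add: power2_eq_square)
  also have "\<dots> \<le> decay p" by (simp add: decay_def)
  finally show ?thesis .
next
  case False
  then obtain h where h: "p = 2 * h + 1" by (metis oddE)
  have "(2 :: real) ^ p * (1/100) ^ (p div 2) = 2 * (4 * (1/100)) ^ h"
    unfolding h power_mult_distrib by (simp add: power_mult)
  also have "\<dots> = 10 * (1/5) ^ p" unfolding h power_add power_mult by (simp add: power2_eq_square)
  also have "\<dots> = decay p" using h by (simp add: decay_def)
  finally show ?thesis by simp
qed

section \<open>1-dependence and blocks of consecutive factors\<close>

locale one_dependent_seq = prob_space M for M :: "'a measure" +
  fixes n :: nat and X :: "nat \<Rightarrow> 'a \<Rightarrow> nat"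
  assumes dep: "one_dependent M n X" and X0: "X 0 = (\<lambda>_. 0)"
    and nu1_le: "\<And>k. k \<in> {1..n} \<Longrightarrow> \<nu> M X 1 k \<le> 1/100"
    and falling4: "\<And>k. k \<in> {1..n} \<Longrightarrow> integrable M (\<lambda>\<omega>. falling 4 (X k \<omega>))"
begin

text \<open>A measure-space wrapper of \<open>generated_sigma\<close>, so that dependence on a block
  of indices becomes ordinary measurability.\<close>

definition subal :: "nat set \<Rightarrow> 'a measure" where
  "subal J = sigma (space M) {X i -` A \<inter> space M | i A. i \<in> J}"

lemma space_subal [simp]: "space (subal J) = space M"
  by (simp add: subal_def space_measure_of_conv)

lemma sets_subal: "sets (subal J) = generated_sigma M X J"
  unfolding subal_def generated_sigma_def by (rule sets_measure_of) auto

lemma X_subal: "i \<in> J \<Longrightarrow> X i \<in> measurable (subal J) (count_space UNIV)"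
  by (rule measurableI) (auto simp: sets_subal generated_sigma_def)

lemma X_meas: "k \<le> n \<Longrightarrow> X k \<in> measurable M (count_space UNIV)"
  using dep X0 by (cases k) (auto simp: one_dependent_def)

lemma subal_measurable:
  assumes "f \<in> measurable (subal J) N" "J \<subseteq> {..n}"
  shows "f \<in> measurable M N"
proof (rule measurable_from_subalg[OF _ assms(1)])
  have "generated_sigma M X J \<subseteq> sets M"
    unfolding generated_sigma_def
    using assms(2) X_meas by (intro sets.sigma_sets_subset) (auto intro!: measurable_sets[where A = "count_space UNIV"])
  then show "subalgebra M (subal J)" by (simp add: subalgebra_def sets_subal)
qed

lemma subal_compose: "i \<in> J \<Longrightarrow> (\<lambda>\<omega>. h (X i \<omega>)) \<in> borel_measurable (subal J)"
  using measurable_compose[OF X_subal, of i J h borel] by simp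

lemma borel_measurable_prod_l1:
  fixes f :: "nat \<Rightarrow> 'b \<Rightarrow> l1"
  assumes "\<And>i. i \<in> I \<Longrightarrow> f i \<in> borel_measurable N"
  shows "(\<lambda>\<omega>. \<Prod>i\<in>I. f i \<omega>) \<in> borel_measurable N"
  using assms by (induction I rule: infinite_finite_induct) (auto intro: borel_measurable_times)

lemma indep_real:
  fixes f g :: "'a \<Rightarrow> real"
  assumes f: "f \<in> borel_measurable (subal {1..s})" "integrable M f"
    and g: "g \<in> borel_measurable (subal {t..n})" "integrable M g"
    and st: "1 \<le> s" "s + 1 < t" "t \<le> n"
  shows "expectation (\<lambda>\<omega>. f \<omega> * g \<omega>) = expectation f * expectation g"
    and "integrable M (\<lambda>\<omega>. f \<omega> * g \<omega>)"
proof -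
  have ind: "indep_set (generated_sigma M X {1..s}) (generated_sigma M X {t..n})"
    using dep st by (auto simp: one_dependent_def)
  have sub: "sigma_sets (space M) {h -` A \<inter> space M |A. A \<in> sets borel} \<subseteq> generated_sigma M X J"
    if "h \<in> borel_measurable (subal J)" for h :: "'a \<Rightarrow> real" and J
  proof -
    have "{h -` A \<inter> space M |A. A \<in> sets borel} \<subseteq> sets (subal J)"
      using measurable_sets[OF that] by auto
    from sets.sigma_sets_subset[OF this] show ?thesis by (simp add: sets_subal)
  qed
  have "indep_var borel f borel g"
    unfolding indep_var_eq
    using sub[OF f(1)] sub[OF g(1)] ind f(2) g(2) unfolding indep_sets2_eq by blast
  from indep_var_lebesgue_integral[OF this f(2) g(2)] indep_var_integrable[OF this f(2) g(2)]
  show "expectation (\<lambda>\<omega>. f \<omega> * g \<omega>) = expectation f * expectation g"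
    "integrable M (\<lambda>\<omega>. f \<omega> * g \<omega>)" .
qed

lemma coord_expectation:
  assumes "integrable M f"
  shows "coord (integral\<^sup>L M f) i = expectation (\<lambda>\<omega>. coord (f \<omega>) i)"
    and "integrable M (\<lambda>\<omega>. coord (f \<omega>) i)"
  using integral_bounded_linear[OF bounded_linear_coord assms]
    integrable_bounded_linear[OF bounded_linear_coord assms] by auto

text \<open>A coordinate of a product is a finite sum of products of real coordinates, to which the
  product rule for real variables applies.\<close>

lemma indep_l1:
  fixes f g :: "'a \<Rightarrow> l1"
  assumes f: "f \<in> borel_measurable (subal {1..s})" "integrable M f"
    and g: "g \<in> borel_measurable (subal {t..n})" "integrable M g"
    and st: "1 \<le> s" "s + 1 < t" "t \<le> n"
    and fg: "integrable M (\<lambda>\<omega>. f \<omega> * g \<omega>)"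
  shows "integral\<^sup>L M (\<lambda>\<omega>. f \<omega> * g \<omega>) = integral\<^sup>L M f * integral\<^sup>L M g"
proof (rule l1_eqI)
  fix i
  have m: "(\<lambda>f. coord f j) \<in> borel_measurable borel" for j
    by (intro borel_measurable_continuous_onI linear_continuous_on bounded_linear_coord)
  have ind: "expectation (\<lambda>\<omega>. coord (f \<omega>) j * coord (g \<omega>) k)
      = expectation (\<lambda>\<omega>. coord (f \<omega>) j) * expectation (\<lambda>\<omega>. coord (g \<omega>) k)"
    "integrable M (\<lambda>\<omega>. coord (f \<omega>) j * coord (g \<omega>) k)" for j k
    by (rule indep_real[OF _ _ _ _ st]; use measurable_compose[OF f(1) m] measurable_compose[OF g(1) m]
        coord_expectation[OF f(2)] coord_expectation[OF g(2)] in auto)+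
  show "coord (integral\<^sup>L M (\<lambda>\<omega>. f \<omega> * g \<omega>)) i = coord (integral\<^sup>L M f * integral\<^sup>L M g) i"
    by (simp add: coord_expectation fg coord_mult f g ind)
qed

definition Z :: "nat \<Rightarrow> 'a \<Rightarrow> l1" where "Z i \<omega> = shift ^ X i \<omega> - 1"

text \<open>\<open>Z i\<close> vanishes where this indicator does, and the indicator has mean at
  most that of \<open>X i\<close>. Being at most 1, it may be dropped from products.\<close>

definition pos :: "nat \<Rightarrow> 'a \<Rightarrow> real" where "pos i \<omega> = (if X i \<omega> \<ge> 1 then 1 else 0)"

lemma Z_eq: "Z i \<omega> = diffu * y1 (X i \<omega>)"
  by (simp add: Z_def shift_power_eq)

lemma norm_Z: "norm (Z i \<omega>) \<le> 2 * pos i \<omega>"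
  unfolding Z_def pos_def by (rule norm_shift_power_minus_1)

lemma pos_bounds: "0 \<le> pos i \<omega>" "pos i \<omega> \<le> 1" "pos i \<omega> \<le> real (X i \<omega>)"
  by (auto simp: pos_def)

lemma pos_subal: "i \<in> J \<Longrightarrow> pos i \<in> borel_measurable (subal J)"
  unfolding pos_def[abs_def] by (rule subal_compose)

lemma Z_subal: "i \<in> J \<Longrightarrow> Z i \<in> borel_measurable (subal J)"
  unfolding Z_def[abs_def] by (rule subal_compose)

lemma prod_pos_subal: "I \<subseteq> J \<Longrightarrow> (\<lambda>\<omega>. \<Prod>i\<in>I. pos i \<omega>) \<in> borel_measurable (subal J)"
  by (intro borel_measurable_prod pos_subal) auto

lemma prod_Z_subal: "I \<subseteq> J \<Longrightarrow> (\<lambda>\<omega>. \<Prod>i\<in>I. Z i \<omega>) \<in> borel_measurable (subal J)"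
  by (intro borel_measurable_prod_l1 Z_subal) auto

lemma prod_pos_bounds: "0 \<le> (\<Prod>i\<in>I. pos i \<omega>)" "(\<Prod>i\<in>I. pos i \<omega>) \<le> 1"
  by (auto intro: prod_nonneg prod_le_1 pos_bounds)

lemma integrable_cube: "k \<le> n \<Longrightarrow> integrable M (\<lambda>\<omega>. real (X k \<omega>) ^ 3)"
proof (cases k)
  case (Suc l)
  assume k: "k \<le> n"
  show ?thesis
  proof (rule Bochner_Integration.integrable_bound)
    show "integrable M (\<lambda>\<omega>. 81 + 11 * falling 4 (X k \<omega>))"
      using falling4[of k] k Suc by auto
    show "(\<lambda>\<omega>. real (X k \<omega>) ^ 3) \<in> borel_measurable M"
      using measurable_compose[OF X_meas[OF k], of "\<lambda>x. real x ^ 3" borel] by simp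
    show "AE \<omega> in M. norm (real (X k \<omega>) ^ 3) \<le> norm (81 + 11 * falling 4 (X k \<omega>))"
    proof (rule AE_I2)
      fix \<omega>
      show "norm (real (X k \<omega>) ^ 3) \<le> norm (81 + 11 * falling 4 (X k \<omega>))"
        using cube_le_falling_4[of "X k \<omega>"] by (simp add: abs_if)
    qed
  qed
qed (simp add: X0)

lemma integrable_dominated:
  fixes f :: "'a \<Rightarrow> 'b::{banach, second_countable_topology}"
  assumes "f \<in> borel_measurable M" "i \<le> n" "j \<le> n" "k \<le> n"
    and "\<And>\<omega>. norm (f \<omega>) \<le> B * (1 + real (X i \<omega>) ^ 3 + real (X j \<omega>) ^ 3 + real (X k \<omega>) ^ 3)"
  shows "integrable M f"
proof (rule Bochner_Integration.integrable_bound)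
  show "integrable M (\<lambda>\<omega>. B * (1 + real (X i \<omega>) ^ 3 + real (X j \<omega>) ^ 3 + real (X k \<omega>) ^ 3))"
    using assms(2-4) by (intro integrable_mult_right Bochner_Integration.integrable_add integrable_cube) auto
  show "AE \<omega> in M. norm (f \<omega>) \<le> norm (B * (1 + real (X i \<omega>) ^ 3 + real (X j \<omega>) ^ 3 + real (X k \<omega>) ^ 3))"
    using assms(5) by (intro AE_I2) (simp add: order_trans[OF _ abs_ge_self])
qed (rule assms)

lemma integrable_bounded:
  fixes f :: "'a \<Rightarrow> 'b::{banach, second_countable_topology}"
  assumes "f \<in> borel_measurable M" "\<And>\<omega>. norm (f \<omega>) \<le> B"
  shows "integrable M f"
  using assms by (intro integrable_const_bound[of _ B]) auto

lemma X_integrable: "k \<le> n \<Longrightarrow> integrable M (\<lambda>\<omega>. real (X k \<omega>))"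
proof (rule integrable_dominated[of _ k k k 1])
  assume k: "k \<le> n"
  show "(\<lambda>\<omega>. real (X k \<omega>)) \<in> borel_measurable M"
    using measurable_compose[OF X_meas[OF k], of real borel] by simp
  fix \<omega>
  have "real (X k \<omega>) \<le> real (X k \<omega>) ^ 3"
    by (cases "X k \<omega>") (auto intro!: self_le_power)
  moreover have "0 \<le> real (X k \<omega>) ^ 3" by simp
  ultimately show "norm (real (X k \<omega>)) \<le> 1 * (1 + real (X k \<omega>) ^ 3 + real (X k \<omega>) ^ 3 + real (X k \<omega>) ^ 3)"
    unfolding real_norm_def abs_of_nat by argo
qed

lemma nu1_eq: "\<nu> M X 1 k = expectation (\<lambda>\<omega>. real (X k \<omega>))"
  by (simp add: \<nu>_def falling_def)

lemma expectation_pos_le: "i \<in> {1..n} \<Longrightarrow> expectation (pos i) \<le> 1/100"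
proof -
  assume i: "i \<in> {1..n}"
  have "expectation (pos i) \<le> expectation (\<lambda>\<omega>. real (X i \<omega>))"
  proof (rule integral_mono)
    show "integrable M (pos i)"
      by (rule integrable_bounded[of _ 1]) (use i pos_bounds in \<open>auto intro: subal_measurable[OF pos_subal[of _ "{i}"]]\<close>)
  qed (use i pos_bounds X_integrable in auto)
  then show ?thesis using nu1_le[OF i] unfolding nu1_eq by linarith
qed

text \<open>Every second factor is dropped, after which the remaining ones are independent.\<close>

lemma expectation_prod_pos_le:
  assumes "1 \<le> j" "j + p \<le> n" "\<xi> \<in> borel_measurable (subal {j+p..n})" "\<And>\<omega>. 0 \<le> \<xi> \<omega>" "integrable M \<xi>"
  shows "expectation (\<lambda>\<omega>. (\<Prod>i\<in>{j..<j+p}. pos i \<omega>) * \<xi> \<omega>) \<le> (1/100) ^ (p div 2) * expectation \<xi>"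
  using assms
proof (induction p arbitrary: \<xi> rule: less_induct)
  case (less p)
  have int: "integrable M (\<lambda>\<omega>. (\<Prod>i\<in>I. pos i \<omega>) * \<xi> \<omega>)" if "I \<subseteq> {..n}" for I
  proof (rule Bochner_Integration.integrable_bound[OF less.prems(5)])
    show "(\<lambda>\<omega>. (\<Prod>i\<in>I. pos i \<omega>) * \<xi> \<omega>) \<in> borel_measurable M"
      using less.prems(5) that by (intro borel_measurable_times subal_measurable[OF prod_pos_subal]) auto
    show "AE \<omega> in M. norm ((\<Prod>i\<in>I. pos i \<omega>) * \<xi> \<omega>) \<le> norm (\<xi> \<omega>)"
      using prod_pos_bounds less.prems(4) by (intro AE_I2) (auto simp: abs_mult mult_left_le_one_le)
  qed
  have nn: "0 \<le> expectation \<xi>" using less.prems(4) by simp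
  consider "p = 0" | "p = 1" | q where "p = q + 2"
    by (metis One_nat_def add_2_eq_Suc' not0_implies_Suc)
  then show ?case
  proof cases
    case 1 then show ?thesis by simp
  next
    case 2
    have "expectation (\<lambda>\<omega>. (\<Prod>i\<in>{j..<j+p}. pos i \<omega>) * \<xi> \<omega>) \<le> expectation \<xi>"
      using prod_pos_bounds less.prems(2,4)
      by (intro integral_mono less.prems(5) int) (auto simp: mult_left_le_one_le)
    then show ?thesis using 2 by simp
  next
    case (3 q)
    let ?s = "j + q"
    have int_pos: "integrable M (\<lambda>\<omega>. \<Prod>i\<in>I. pos i \<omega>)" if "I \<subseteq> {..n}" for I
      by (rule integrable_bounded[of _ 1])
        (use that prod_pos_bounds in \<open>auto intro: subal_measurable[OF prod_pos_subal]\<close>)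
    \<comment> \<open>Only the index \<open>?s + 1\<close> is dropped; it leaves the gap that
      1-dependence requires between \<open>?s\<close> and \<open>j + p = ?s + 2\<close>.\<close>
    have le: "(\<Prod>i\<in>{j..<j+p}. pos i \<omega>) \<le> (\<Prod>i\<in>{j..<Suc ?s}. pos i \<omega>)" for \<omega>
    proof -
      have "{j..<j+p} = insert (Suc ?s) {j..<Suc ?s}" using 3 by auto
      then show ?thesis using pos_bounds prod_pos_bounds by (simp add: mult_left_le_one_le)
    qed
    have "expectation (\<lambda>\<omega>. (\<Prod>i\<in>{j..<j+p}. pos i \<omega>) * \<xi> \<omega>)
        \<le> expectation (\<lambda>\<omega>. (\<Prod>i\<in>{j..<Suc ?s}. pos i \<omega>) * \<xi> \<omega>)"
      using less.prems 3 by (intro integral_mono int mult_right_mono le) auto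
    also have "\<dots> = expectation (\<lambda>\<omega>. \<Prod>i\<in>{j..<Suc ?s}. pos i \<omega>) * expectation \<xi>"
      using less.prems 3 by (intro indep_real(1)[where s = ?s and t = "j + p"] prod_pos_subal int_pos) auto
    also have "expectation (\<lambda>\<omega>. \<Prod>i\<in>{j..<Suc ?s}. pos i \<omega>)
        = expectation (\<lambda>\<omega>. (\<Prod>i\<in>{j..<j+q}. pos i \<omega>) * pos ?s \<omega>)"
      by (simp add: mult.commute)
    also have "\<dots> \<le> (1/100) ^ (q div 2) * expectation (pos ?s)"
      using less.prems 3 int_pos[of "{?s}"] by (intro less.IH pos_subal pos_bounds) auto
    also have "\<dots> \<le> (1/100) ^ (q div 2) * (1/100)"
      using less.prems 3 by (intro mult_left_mono expectation_pos_le) auto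
    finally show ?thesis using nn 3 by (simp add: mult_right_mono)
  qed
qed

lemma norm_prod_Z_le: "norm (\<Prod>i\<in>{j..<l}. Z i \<omega>) \<le> 2 ^ (l - j) * (\<Prod>i\<in>{j..<l}. pos i \<omega>)"
proof -
  have "norm (\<Prod>i\<in>{j..<l}. Z i \<omega>) \<le> (\<Prod>i\<in>{j..<l}. norm (Z i \<omega>))" by (rule norm_prod_le)
  also have "\<dots> \<le> (\<Prod>i\<in>{j..<l}. 2 * pos i \<omega>)" by (intro prod_mono) (auto simp: norm_Z)
  finally show ?thesis by (simp add: prod.distrib)
qed

lemma integrable_prod_Z_mult:
  assumes "l \<le> Suc n" "integrable M Y"
  shows "integrable M (\<lambda>\<omega>. (\<Prod>i\<in>{j..<l}. Z i \<omega>) * Y \<omega>)"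
proof (rule Bochner_Integration.integrable_bound)
  show "integrable M (\<lambda>\<omega>. 2 ^ (l - j) * norm (Y \<omega>))" using assms by auto
  show "(\<lambda>\<omega>. (\<Prod>i\<in>{j..<l}. Z i \<omega>) * Y \<omega>) \<in> borel_measurable M"
    using assms by (intro borel_measurable_times subal_measurable[OF prod_Z_subal]) auto
  have "norm ((\<Prod>i\<in>{j..<l}. Z i \<omega>) * Y \<omega>) \<le> 2 ^ (l - j) * norm (Y \<omega>)" for \<omega>
  proof (intro order_trans[OF norm_mult_ineq] mult_right_mono)
    have "norm (\<Prod>i\<in>{j..<l}. Z i \<omega>) \<le> 2 ^ (l - j) * (\<Prod>i\<in>{j..<l}. pos i \<omega>)" by (rule norm_prod_Z_le)
    also have "\<dots> \<le> 2 ^ (l - j) * 1" by (intro mult_left_mono prod_pos_bounds) auto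
    finally show "norm (\<Prod>i\<in>{j..<l}. Z i \<omega>) \<le> 2 ^ (l - j)" by simp
  qed auto
  then show "AE \<omega> in M. norm ((\<Prod>i\<in>{j..<l}. Z i \<omega>) * Y \<omega>) \<le> norm (2 ^ (l - j) * norm (Y \<omega>))"
    by simp
qed

text \<open>\<open>Y\<close> may look at all indices from \<open>l\<close> on, and \<open>Q\<close>
  is a majorant whose mean is a moment. The case \<open>j = 0\<close> is apart: \<open>Z 0\<close>
  vanishes, and the last hypothesis covers the empty block.\<close>

lemma norm_block_le:
  fixes Y :: "'a \<Rightarrow> l1"
  assumes "j \<le> l" "l \<le> n" and Y: "Y \<in> borel_measurable (subal {l..n})" "integrable M Y"
    and Q: "\<And>\<omega>. norm (Y \<omega>) \<le> Q \<omega>" "integrable M Q" and zero: "j = 0 \<Longrightarrow> l = 0 \<Longrightarrow> Y = (\<lambda>_. 0)"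
  shows "norm (integral\<^sup>L M (\<lambda>\<omega>. (\<Prod>i\<in>{j..<l}. Z i \<omega>) * Y \<omega>)) \<le> decay (l - j) * expectation Q"
proof (cases "j = 0")
  case True
  have "(\<Prod>i\<in>{0..<l}. Z i \<omega>) * Y \<omega> = 0" for \<omega>
  proof (cases "l = 0")
    case False
    then have "0 \<in> {0..<l}" "Z 0 \<omega> = 0" by (auto simp: Z_def X0)
    then have "(\<Prod>i\<in>{0..<l}. Z i \<omega>) = 0" by (intro prod_zero) auto
    then show ?thesis by simp
  qed (use zero True in simp)
  moreover have "0 \<le> expectation Q" using Q(1) by (intro integral_nonneg_AE AE_I2 order_trans[OF norm_ge_zero])
  ultimately show ?thesis using True decay_nonneg by simp
next
  case False
  have QY: "expectation (\<lambda>\<omega>. norm (Y \<omega>)) \<le> expectation Q"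
    using Q Y(2) by (intro integral_mono) auto
  have I: "integrable M (\<lambda>\<omega>. (\<Prod>i\<in>{j..<l}. Z i \<omega>) * Y \<omega>)"
    using assms by (intro integrable_prod_Z_mult) auto
  have I2: "integrable M (\<lambda>\<omega>. (\<Prod>i\<in>{j..<l}. pos i \<omega>) * norm (Y \<omega>))"
  proof (rule Bochner_Integration.integrable_bound)
    show "integrable M (\<lambda>\<omega>. norm (Y \<omega>))" using Y by simp
    show "(\<lambda>\<omega>. (\<Prod>i\<in>{j..<l}. pos i \<omega>) * norm (Y \<omega>)) \<in> borel_measurable M"
      using Y(2) assms(2) by (intro borel_measurable_times subal_measurable[OF prod_pos_subal]) auto
    show "AE \<omega> in M. norm ((\<Prod>i\<in>{j..<l}. pos i \<omega>) * norm (Y \<omega>)) \<le> norm (norm (Y \<omega>))"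
      using prod_pos_bounds by (intro AE_I2) (auto simp: abs_mult mult_left_le_one_le)
  qed
  have "norm (integral\<^sup>L M (\<lambda>\<omega>. (\<Prod>i\<in>{j..<l}. Z i \<omega>) * Y \<omega>))
      \<le> expectation (\<lambda>\<omega>. norm ((\<Prod>i\<in>{j..<l}. Z i \<omega>) * Y \<omega>))"
    by (rule integral_norm_bound)
  also have "\<dots> \<le> expectation (\<lambda>\<omega>. 2 ^ (l - j) * ((\<Prod>i\<in>{j..<l}. pos i \<omega>) * norm (Y \<omega>)))"
  proof (rule integral_mono)
    fix \<omega>
    have "norm ((\<Prod>i\<in>{j..<l}. Z i \<omega>) * Y \<omega>) \<le> (2 ^ (l - j) * (\<Prod>i\<in>{j..<l}. pos i \<omega>)) * norm (Y \<omega>)"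
      by (intro order_trans[OF norm_mult_ineq] mult_right_mono norm_prod_Z_le) auto
    then show "norm ((\<Prod>i\<in>{j..<l}. Z i \<omega>) * Y \<omega>) \<le> 2 ^ (l - j) * ((\<Prod>i\<in>{j..<l}. pos i \<omega>) * norm (Y \<omega>))"
      by (simp add: mult.assoc)
  qed (use I I2 in auto)
  also have "\<dots> = 2 ^ (l - j) * expectation (\<lambda>\<omega>. (\<Prod>i\<in>{j..<l}. pos i \<omega>) * norm (Y \<omega>))"
    by simp
  also have "expectation (\<lambda>\<omega>. (\<Prod>i\<in>{j..<l}. pos i \<omega>) * norm (Y \<omega>))
      \<le> (1/100) ^ ((l - j) div 2) * expectation (\<lambda>\<omega>. norm (Y \<omega>))"
    using expectation_prod_pos_le[of j "l - j" "\<lambda>\<omega>. norm (Y \<omega>)"] assms False by auto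
  also have "2 ^ (l - j) * ((1/100) ^ ((l - j) div 2) * expectation (\<lambda>\<omega>. norm (Y \<omega>)))
      = 2 ^ (l - j) * (1/100) ^ ((l - j) div 2) * expectation (\<lambda>\<omega>. norm (Y \<omega>))" by simp
  also have "\<dots> \<le> decay (l - j) * expectation (\<lambda>\<omega>. norm (Y \<omega>))"
    by (intro mult_right_mono decay_ge) auto
  also have "\<dots> \<le> decay (l - j) * expectation Q"
    by (intro mult_left_mono QY decay_nonneg)
  finally show ?thesis by simp
qed

section \<open>The renewal equation for the laws of the partial sums\<close>

definition "sft k \<omega> = shift ^ (\<Sum>i=1..k. X i \<omega>)"

lemma sft_0: "sft 0 \<omega> = 1"
  and sft_Suc: "sft (Suc k) \<omega> = sft k \<omega> * shift ^ X (Suc k) \<omega>"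
  by (simp_all add: sft_def power_add mult.commute)

lemma norm_sft: "norm (sft k \<omega>) = 1"
  by (simp add: sft_def norm_shift_power)

definition "pgf k = integral\<^sup>L M (\<lambda>\<omega>. sft k \<omega>)"
definition "mZ j k = integral\<^sup>L M (\<lambda>\<omega>. \<Prod>i\<in>{j..k}. Z i \<omega>)"

lemma shift_sum_subal: "{1..k} \<subseteq> J \<Longrightarrow> (\<lambda>\<omega>. sft k \<omega>) \<in> borel_measurable (subal J)"
  unfolding sft_def[abs_def] power_sum by (intro borel_measurable_prod_l1 subal_compose) auto

lemma integrable_shift_prod_Z:
  assumes "s \<le> n" "k \<le> n"
  shows "integrable M (\<lambda>\<omega>. sft s \<omega> * (\<Prod>i\<in>{j..k}. Z i \<omega>))"
proof -
  have 1: "integrable M (\<lambda>\<omega>. sft s \<omega>)"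
    by (rule integrable_bounded[of _ 1])
      (use assms in \<open>auto simp: norm_sft intro!: subal_measurable[OF shift_sum_subal[of s "{1..s}"]]\<close>)
  then show ?thesis
    using integrable_prod_Z_mult[OF _ 1, of "Suc k" j] assms by (simp add: atLeastLessThanSuc_atLeastAtMost mult.commute)
qed

lemma pgf_0: "pgf 0 = 1"
  by (simp add: pgf_def sft_0 prob_space)

text \<open>Writing the last unit mass in \<open>sft (Suc j)\<close> as 1 + \<open>Z (Suc j)\<close>
  either opens a gap at that index, where 1-dependence splits the mean, or lengthens the block of
  factors \<open>Z\<close>.\<close>

lemma pgf_step:
  assumes "j < k" "k \<le> n"
  shows "integral\<^sup>L M (\<lambda>\<omega>. sft j \<omega> * (\<Prod>i\<in>{Suc j..k}. Z i \<omega>))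
    = mZ 1 k + (\<Sum>i\<in>{2..Suc j}. pgf (i - 2) * mZ i k)"
  using assms
proof (induction j)
  case 0
  then show ?case by (simp add: mZ_def sft_0)
next
  case (Suc j)
  have "sft (Suc j) \<omega> * (\<Prod>i\<in>{Suc (Suc j)..k}. Z i \<omega>)
      = sft j \<omega> * (\<Prod>i\<in>{Suc (Suc j)..k}. Z i \<omega>) + sft j \<omega> * (\<Prod>i\<in>{Suc j..k}. Z i \<omega>)" for \<omega>
  proof -
    have "{Suc j..k} = insert (Suc j) {Suc (Suc j)..k}" using Suc.prems by auto
    then have "(\<Prod>i\<in>{Suc j..k}. Z i \<omega>) = (shift ^ X (Suc j) \<omega> - 1) * (\<Prod>i\<in>{Suc (Suc j)..k}. Z i \<omega>)"
      by (simp add: Z_def)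
    moreover have "(p * x) * q = p * q + p * ((x - 1) * q)" for p q x :: l1 by (simp add: algebra_simps)
    ultimately show ?thesis unfolding sft_Suc by presburger
  qed
  then have "integral\<^sup>L M (\<lambda>\<omega>. sft (Suc j) \<omega> * (\<Prod>i\<in>{Suc (Suc j)..k}. Z i \<omega>))
    = integral\<^sup>L M (\<lambda>\<omega>. sft j \<omega> * (\<Prod>i\<in>{Suc (Suc j)..k}. Z i \<omega>))
     + integral\<^sup>L M (\<lambda>\<omega>. sft j \<omega> * (\<Prod>i\<in>{Suc j..k}. Z i \<omega>))"
    using Suc.prems by (simp add: integrable_shift_prod_Z)
  also have "integral\<^sup>L M (\<lambda>\<omega>. sft j \<omega> * (\<Prod>i\<in>{Suc (Suc j)..k}. Z i \<omega>)) = pgf j * mZ (Suc (Suc j)) k"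
  proof (cases "j = 0")
    case True then show ?thesis by (simp add: mZ_def pgf_0 sft_0)
  next
    case False
    have "integrable M (sft j)" using integrable_shift_prod_Z[of j 0 1] Suc.prems by simp
    moreover have "integrable M (\<lambda>\<omega>. \<Prod>i\<in>{Suc (Suc j)..k}. Z i \<omega>)"
      using integrable_shift_prod_Z[of 0 k "Suc (Suc j)"] Suc.prems by (simp add: sft_0)
    ultimately show ?thesis
      unfolding pgf_def mZ_def using Suc.prems False
      by (intro indep_l1[where s = j and t = "Suc (Suc j)"] shift_sum_subal prod_Z_subal integrable_shift_prod_Z) auto
  qed
  also have "integral\<^sup>L M (\<lambda>\<omega>. sft j \<omega> * (\<Prod>i\<in>{Suc j..k}. Z i \<omega>)) = mZ 1 k + (\<Sum>i\<in>{2..Suc j}. pgf (i - 2) * mZ i k)"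
    using Suc by simp
  finally show ?case by (simp add: numeral_2_eq_2)
qed

lemma pgf_rec:
  assumes "1 \<le> k" "k \<le> n"
  shows "pgf k = pgf (k - 1) + (\<Sum>j=1..k. pgf (j - 2) * mZ j k)"
proof -
  obtain l where l: "k = Suc l" using assms by (cases k) auto
  \<comment> \<open>The empty product makes both summands instances of
    \<open>integrable_shift_prod_Z\<close>.\<close>
  have "sft k \<omega> = sft l \<omega> * (\<Prod>i\<in>{1..0}. Z i \<omega>) + sft l \<omega> * (\<Prod>i\<in>{Suc l..k}. Z i \<omega>)" for \<omega>
    by (simp add: l Z_def sft_Suc algebra_simps)
  then have "sft k = (\<lambda>\<omega>. sft l \<omega> * (\<Prod>i\<in>{1..0}. Z i \<omega>) + sft l \<omega> * (\<Prod>i\<in>{Suc l..k}. Z i \<omega>))" by blast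
  then have "pgf k = integral\<^sup>L M (\<lambda>\<omega>. sft l \<omega> * (\<Prod>i\<in>{1..0}. Z i \<omega>))
      + integral\<^sup>L M (\<lambda>\<omega>. sft l \<omega> * (\<Prod>i\<in>{Suc l..k}. Z i \<omega>))"
    unfolding pgf_def using assms l
    by (simp only: Bochner_Integration.integral_add integrable_shift_prod_Z Suc_leD)
  also have "\<dots> = pgf l + (mZ 1 k + (\<Sum>i\<in>{2..Suc l}. pgf (i - 2) * mZ i k))"
    using pgf_step[of l k] assms l by (simp add: pgf_def)
  also have "mZ 1 k + (\<Sum>i\<in>{2..Suc l}. pgf (i - 2) * mZ i k) = (\<Sum>j=1..k. pgf (j - 2) * mZ j k)"
  proof -
    have "{1..k} = insert 1 {2..Suc l}" using l by auto
    then show ?thesis by (simp add: pgf_0)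
  qed
  finally show ?thesis using l by simp
qed

lemma mZ_0: "mZ 0 k = 0"
proof -
  have "(\<Prod>i\<in>{0..k}. Z i \<omega>) = 0" for \<omega>
    by (rule prod_zero) (auto intro!: bexI[of _ 0] simp: Z_def X0)
  then show ?thesis by (simp add: mZ_def)
qed

end

subsection \<open>The approximation theorem on a fixed probability space\<close>

lemma tv_norm_eq_norm:
  assumes "\<And>k. g k = (if k < 0 then 0 else coord f (nat k))"
  shows "tv_norm g = norm f"
proof -
  have "tv_norm g = (\<Sum>\<^sub>\<infinity>k\<in>range int. \<bar>g k\<bar>)"
    unfolding tv_norm_def
  proof (rule infsum_cong_neutral)
    fix k assume "k \<in> UNIV - range int"
    then have "k < 0" by (metis DiffD2 nonneg_int_cases not_less rangeI)
    then show "\<bar>g k\<bar> = 0" by (simp add: assms)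
  qed auto
  also have "\<dots> = (\<Sum>\<^sub>\<infinity>k. \<bar>coord f k\<bar>)"
    by (subst infsum_reindex) (auto simp: assms o_def)
  also have "\<dots> = norm f"
  proof (rule infsumI, rule sums_nonneg_imp_has_sum)
    show "(\<lambda>k. \<bar>coord f k\<bar>) sums norm f"
      unfolding norm_l1_eq using summable_sums[OF summable_coord] .
  qed auto
  finally show ?thesis .
qed

lemma Pois_eq_coord: "Pois r k = (if k < 0 then 0 else coord (poisson_l1 r) (nat k))"
  by (simp add: Pois_eq coord_poisson_l1)

lemma Pois2_eq_coord:
  "Pois2 r g k = (if k < 0 then 0 else coord (poisson_l1 r * (1 + of_real g * diffu ^ 2)) (nat k))"
proof -
  define N where "N = (\<lambda>k. unit_mass 0 k + g * conv_power (\<lambda>i. unit_mass 1 i - unit_mass 0 i) 2 k)"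
  \<comment> \<open>The square of \<open>diffu\<close> has the masses 1, -2, 1, so the convolution
    with \<open>N\<close> collapses to three terms.\<close>
  have N: "N k = (if k = 0 then 1 + g else if k = 1 then - 2 * g else if k = 2 then g else 0)" for k
  proof -
    have c: "conv_power (\<lambda>i. unit_mass 1 i - unit_mass 0 i) 2 k
      = (if k < 0 then 0 else (-1) ^ nat k * real (2 choose nat k))"
      using conv_power_unit_diff[of 1 2 k] by (simp add: power_add)
    consider "k < 0" | "k = 0" | "k = 1" | "k = 2" | "k > 2" by linarith
    then show ?thesis
    proof cases
      case 5
      then have "2 choose nat k = 0" by (intro binomial_eq_0) auto
      then show ?thesis unfolding N_def c using 5 by (simp add: unit_mass_def)
    qed (unfold N_def c, auto simp: unit_mass_def numeral_2_eq_2)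
  qed
  have "Pois2 r g k = (\<Sum>\<^sub>\<infinity>j\<in>{k, k - 1, k - 2}. Pois r j * N (k - j))"
    unfolding Pois2_def conv_def N_def[symmetric]
    by (rule infsum_cong_neutral) (auto simp: N)
  also have "\<dots> = Pois r k * (1 + g) - 2 * g * Pois r (k - 1) + g * Pois r (k - 2)"
    by (simp add: N)
  finally have P: "Pois2 r g k = Pois r k * (1 + g) - 2 * g * Pois r (k - 1) + g * Pois r (k - 2)" .
  have e: "poisson_l1 r * (1 + of_real g * diffu ^ 2) = poisson_l1 r + g *\<^sub>R (diffu * (diffu * poisson_l1 r))"
    by (simp add: scaleR_conv_of_real power2_eq_square algebra_simps)
  show ?thesis
  proof (cases "k < 0")
    case False
    then obtain i where i: "k = int i" by (metis nonneg_int_cases not_less)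
    consider "i = 0" | "i = 1" | l where "i = Suc (Suc l)"
      by (metis One_nat_def not0_implies_Suc)
    then show ?thesis
    proof cases
      case 3
      then have l: "nat k = Suc (Suc l)" "nat (k - 1) = Suc l" "nat (k - 2) = l"
        "\<not> k < 0" "\<not> k - 1 < 0" "\<not> k - 2 < 0" using i by auto
      show ?thesis
        unfolding P e Pois_eq_coord using l by (simp add: coord_diffu_mult algebra_simps)
    next
      case 1
      show ?thesis unfolding P e Pois_eq_coord using 1 i by (simp add: coord_diffu_mult algebra_simps)
    next
      case 2
      show ?thesis unfolding P e Pois_eq_coord using 2 i by (simp add: coord_diffu_mult algebra_simps)
    qed
  qed (simp add: P Pois_eq_coord)
qed

lemma y1_0: "y1 0 = 0"
  by (simp add: y1_def)

lemma hatE_plus_pair: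
  "hatE_plus M [Y, Z] = prob_space.expectation M (\<lambda>\<omega>. Y \<omega> * Z \<omega>)
     + prob_space.expectation M Y * prob_space.expectation M Z"
  by (simp add: hatE_plus.simps[of M "[Y, Z]"] hatE_plus.simps[of M "[Y]"] mixed_moment_def)

lemma hatE_plus_triple:
  "hatE_plus M [Y, Z, V] = prob_space.expectation M (\<lambda>\<omega>. Y \<omega> * Z \<omega> * V \<omega>)
     + prob_space.expectation M Y * prob_space.expectation M (\<lambda>\<omega>. Z \<omega> * V \<omega>)
     + (prob_space.expectation M (\<lambda>\<omega>. Y \<omega> * Z \<omega>)
        + prob_space.expectation M Y * prob_space.expectation M Z) * prob_space.expectation M V"
proof -
  have "{1..<3} = {1, 2 :: nat}" by auto
  then show ?thesis
    by (simp add: hatE_plus.simps[of M "[Y, Z, V]"] hatE_plus_pair hatE_plus.simps[of M "[Y]"]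
        mixed_moment_def mult.assoc)
qed

lemma falling_nonneg: "0 \<le> falling j x"
proof (cases "j \<le> x")
  case True
  then show ?thesis unfolding falling_def by (intro prod_nonneg) auto
next
  case False
  then have "falling j x = 0" unfolding falling_def by (intro prod_zero bexI[of _ x]) auto
  then show ?thesis by simp
qed

lemma mult_minus_1_nonneg: "0 \<le> real x * (real x - 1)"
  by (cases x) auto

lemma falling_3_le: "falling 3 x \<le> real x ^ 3"
proof (cases "x \<le> 2")
  case True
  then have "x = 0 \<or> x = 1 \<or> x = 2" by auto
  then show ?thesis by (auto simp: falling_3)
next
  case False
  then show ?thesis unfolding falling_3 power3_eq_cube by (intro mult_mono) auto
qed

section \<open>Moments and the concrete coefficients of the expansion\<close>

context one_dependent_seq
begin

lemma X_compose: "k \<le> n \<Longrightarrow> (\<lambda>\<omega>. h (X k \<omega>)) \<in> borel_measurable M"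
  using measurable_compose[OF X_meas, of k h borel] by simp

lemma X3_le: "real (X i \<omega>) * real (X j \<omega>) * real (X k \<omega>)
   \<le> 1 + real (X i \<omega>) ^ 3 + real (X j \<omega>) ^ 3 + real (X k \<omega>) ^ 3"
  using mult3_le_cubes[of "real (X i \<omega>)" "real (X j \<omega>)" "real (X k \<omega>)"] by simp

lemma X2_le: "real (X i \<omega>) * real (X j \<omega>)
   \<le> 1 + real (X i \<omega>) ^ 3 + real (X j \<omega>) ^ 3 + real (X j \<omega>) ^ 3"
proof -
  have "real (X i \<omega>) * real (X j \<omega>) * 1 \<le> real (X i \<omega>) ^ 3 + real (X j \<omega>) ^ 3 + 1 ^ 3"
    by (rule mult3_le_cubes) auto
  moreover have "0 \<le> real (X j \<omega>) ^ 3" by simp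
  ultimately show ?thesis unfolding mult_1_right power_one by argo
qed

lemma integrable_X3:
  "i \<le> n \<Longrightarrow> j \<le> n \<Longrightarrow> k \<le> n \<Longrightarrow> integrable M (\<lambda>\<omega>. real (X i \<omega>) * real (X j \<omega>) * real (X k \<omega>))"
  by (rule integrable_dominated[of _ i j k 1])
    (use X3_le in \<open>auto intro!: borel_measurable_times X_compose simp: abs_mult\<close>)

lemma integrable_X2: "i \<le> n \<Longrightarrow> j \<le> n \<Longrightarrow> integrable M (\<lambda>\<omega>. real (X i \<omega>) * real (X j \<omega>))"
  by (rule integrable_dominated[of _ i j j 1])
    (use X2_le in \<open>auto intro!: borel_measurable_times X_compose simp: abs_mult\<close>)

lemma integrable_fall2: "k \<le> n \<Longrightarrow> integrable M (\<lambda>\<omega>. real (X k \<omega>) * (real (X k \<omega>) - 1))"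
  using Bochner_Integration.integrable_diff[OF integrable_X2[of k k] X_integrable[of k]]
  by (simp add: right_diff_distrib)

lemma integrable_fall2_mult:
  "i \<le> n \<Longrightarrow> k \<le> n \<Longrightarrow> integrable M (\<lambda>\<omega>. real (X i \<omega>) * (real (X i \<omega>) - 1) * real (X k \<omega>))"
  "i \<le> n \<Longrightarrow> k \<le> n \<Longrightarrow> integrable M (\<lambda>\<omega>. real (X i \<omega>) * (real (X k \<omega>) * (real (X k \<omega>) - 1)))"
  using Bochner_Integration.integrable_diff[OF integrable_X3[of i i k] integrable_X2[of i k]]
    Bochner_Integration.integrable_diff[OF integrable_X3[of i k k] integrable_X2[of i k]]
  by (simp_all add: algebra_simps)

lemma integrable_fall3: "k \<le> n \<Longrightarrow> integrable M (\<lambda>\<omega>. falling 3 (X k \<omega>))"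
proof (rule Bochner_Integration.integrable_bound[OF integrable_cube])
  show "AE \<omega> in M. norm (falling 3 (X k \<omega>)) \<le> norm (real (X k \<omega>) ^ 3)"
    using falling_nonneg falling_3_le by (intro AE_I2) simp
qed (auto intro: X_compose)

lemma integrable_via_norm:
  fixes f :: "'a \<Rightarrow> l1"
  assumes "f \<in> borel_measurable M" "integrable M g" "\<And>\<omega>. norm (f \<omega>) \<le> g \<omega>"
  shows "integrable M f" "norm (integral\<^sup>L M f) \<le> expectation g"
proof -
  show i: "integrable M f"
    by (rule Bochner_Integration.integrable_bound[OF assms(2,1)])
      (use assms(3) in \<open>auto intro!: AE_I2 order_trans[OF _ abs_ge_self]\<close>)
  show "norm (integral\<^sup>L M f) \<le> expectation g"
    using i assms by (intro order_trans[OF integral_norm_bound] integral_mono) auto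
qed

lemma y1_integrable: "k \<le> n \<Longrightarrow> integrable M (\<lambda>\<omega>. y1 (X k \<omega>))"
  by (rule integrable_via_norm(1)[OF _ X_integrable]) (auto intro: X_compose norm_y1)

lemma y2_integrable: "k \<le> n \<Longrightarrow> integrable M (\<lambda>\<omega>. y2 (X k \<omega>))"
  and norm_y2_integral: "k \<le> n \<Longrightarrow> norm (integral\<^sup>L M (\<lambda>\<omega>. y2 (X k \<omega>))) \<le> expectation (\<lambda>\<omega>. real (X k \<omega>) * (real (X k \<omega>) - 1)) / 2"
proof -
  assume k: "k \<le> n"
  have "integrable M (\<lambda>\<omega>. real (X k \<omega>) * (real (X k \<omega>) - 1) / 2)"
    by (intro integrable_divide integrable_fall2 k)
  note * = integrable_via_norm[OF X_compose[OF k, of y2] this norm_y2]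
  show "integrable M (\<lambda>\<omega>. y2 (X k \<omega>))" by (rule *)
  show "norm (integral\<^sup>L M (\<lambda>\<omega>. y2 (X k \<omega>))) \<le> expectation (\<lambda>\<omega>. real (X k \<omega>) * (real (X k \<omega>) - 1)) / 2"
    using *(2) unfolding integral_divide_zero .
qed

lemma y3_integrable: "k \<le> n \<Longrightarrow> integrable M (\<lambda>\<omega>. y3 (X k \<omega>))"
  and norm_y3_integral: "k \<le> n \<Longrightarrow> norm (integral\<^sup>L M (\<lambda>\<omega>. y3 (X k \<omega>))) \<le> expectation (\<lambda>\<omega>. falling 3 (X k \<omega>))"
  by (rule integrable_via_norm[OF X_compose integrable_fall3 norm_y3]; assumption)+

lemma norm_yy: "norm (y1 (X i \<omega>) * y1 (X k \<omega>)) \<le> real (X i \<omega>) * real (X k \<omega>)"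
  by (intro norm_mult_le_mult norm_y1)

lemma yy_integrable: "i \<le> n \<Longrightarrow> k \<le> n \<Longrightarrow> integrable M (\<lambda>\<omega>. y1 (X i \<omega>) * y1 (X k \<omega>))"
  by (rule integrable_via_norm(1)[OF _ integrable_X2[of i k] norm_yy])
    (auto intro!: borel_measurable_times X_compose)

lemma norm_yyy: "norm (y1 (X i \<omega>) * (y1 (X j \<omega>) * y1 (X k \<omega>))) \<le> real (X i \<omega>) * real (X j \<omega>) * real (X k \<omega>)"
  unfolding mult.assoc by (intro norm_mult_le_mult norm_y1)

lemma yyy_integrable:
  "i \<le> n \<Longrightarrow> j \<le> n \<Longrightarrow> k \<le> n \<Longrightarrow> integrable M (\<lambda>\<omega>. y1 (X i \<omega>) * (y1 (X j \<omega>) * y1 (X k \<omega>)))"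
  by (rule integrable_via_norm(1)[OF _ integrable_X3[of i j k] norm_yyy])
    (auto intro!: borel_measurable_times X_compose)

text \<open>At the last one, two or three indices of a block \<open>Z\<close> is replaced by its
  quotient \<open>y1\<close> by \<open>diffu\<close>; meant for \<open>j \<le> k\<close>,
  \<open>j < k\<close> and \<open>j + 1 < k\<close> respectively.\<close>

definition "M1 j k = integral\<^sup>L M (\<lambda>\<omega>. (\<Prod>i\<in>{j..<k}. Z i \<omega>) * y1 (X k \<omega>))"
definition "M2 j k = integral\<^sup>L M (\<lambda>\<omega>. (\<Prod>i\<in>{j..<k-1}. Z i \<omega>) * (y1 (X (k-1) \<omega>) * y1 (X k \<omega>)))"
definition "M3 j k = integral\<^sup>L M (\<lambda>\<omega>. (\<Prod>i\<in>{j..<k-2}. Z i \<omega>) *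
   (y1 (X (k-2) \<omega>) * (y1 (X (k-1) \<omega>) * y1 (X k \<omega>))))"
definition "A2 k = integral\<^sup>L M (\<lambda>\<omega>. y2 (X k \<omega>))"
definition "A3 k = integral\<^sup>L M (\<lambda>\<omega>. y3 (X k \<omega>))"
definition "B3 k = integral\<^sup>L M (\<lambda>\<omega>. of_real (real (X (k-1) \<omega>)) * y2 (X k \<omega>) + y2 (X (k-1) \<omega>) * y1 (X k \<omega>))"
definition "dd k = expectation (\<lambda>\<omega>. real (X (k-1) \<omega>) * (real (X (k-1) \<omega>) - 1) * real (X k \<omega>))
   + expectation (\<lambda>\<omega>. real (X (k-1) \<omega>) * (real (X k \<omega>) * (real (X k \<omega>) - 1)))"
definition "tt k = expectation (\<lambda>\<omega>. real (X (k-2) \<omega>) * real (X (k-1) \<omega>) * real (X k \<omega>))"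

lemma prod_Z_last:
  assumes "j < l"
  shows "(\<Prod>i\<in>{j..<l}. Z i \<omega>) = diffu * ((\<Prod>i\<in>{j..<l-1}. Z i \<omega>) * y1 (X (l-1) \<omega>))"
proof -
  have "{j..<l} = insert (l-1) {j..<l-1}" using assms by auto
  then show ?thesis by (simp add: Z_eq mult.left_commute)
qed

lemma integral_diffu_mult:
  "integrable M f \<Longrightarrow> integral\<^sup>L M (\<lambda>\<omega>. diffu * f \<omega>) = diffu * integral\<^sup>L M f"
  by simp

lemma mZ_eq: assumes "j \<le> k" "k \<le> n" shows "mZ j k = diffu * M1 j k"
proof -
  have "(\<Prod>i\<in>{j..k}. Z i \<omega>) = diffu * ((\<Prod>i\<in>{j..<k}. Z i \<omega>) * y1 (X k \<omega>))" for \<omega>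
    using prod_Z_last[of j "Suc k"] assms by (simp add: atLeastLessThanSuc_atLeastAtMost)
  then show ?thesis unfolding mZ_def M1_def using assms
    by (simp only: integral_diffu_mult integrable_prod_Z_mult y1_integrable le_SucI)
qed

lemma M1_eq: assumes "j < k" "k \<le> n" shows "M1 j k = diffu * M2 j k"
proof -
  have "(\<Prod>i\<in>{j..<k}. Z i \<omega>) * y1 (X k \<omega>)
      = diffu * ((\<Prod>i\<in>{j..<k-1}. Z i \<omega>) * (y1 (X (k-1) \<omega>) * y1 (X k \<omega>)))" for \<omega>
    unfolding prod_Z_last[OF assms(1)] by (simp only: mult.assoc)
  moreover have "integrable M (\<lambda>\<omega>. (\<Prod>i\<in>{j..<k-1}. Z i \<omega>) * (y1 (X (k-1) \<omega>) * y1 (X k \<omega>)))"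
    using assms by (intro integrable_prod_Z_mult yy_integrable) auto
  ultimately show ?thesis unfolding M1_def M2_def by (simp only: integral_diffu_mult)
qed

lemma M2_eq: assumes "j + 1 < k" "k \<le> n" shows "M2 j k = diffu * M3 j k"
proof -
  have *: "j < k - 1" "k - 1 - 1 = k - 2" using assms by auto
  have "(\<Prod>i\<in>{j..<k-1}. Z i \<omega>) * (y1 (X (k-1) \<omega>) * y1 (X k \<omega>))
      = diffu * ((\<Prod>i\<in>{j..<k-2}. Z i \<omega>) * (y1 (X (k-2) \<omega>) * (y1 (X (k-1) \<omega>) * y1 (X k \<omega>))))" for \<omega>
    unfolding prod_Z_last[OF *(1)] unfolding *(2) by (simp only: mult.assoc)
  moreover have "integrable M (\<lambda>\<omega>. (\<Prod>i\<in>{j..<k-2}. Z i \<omega>) * (y1 (X (k-2) \<omega>) * (y1 (X (k-1) \<omega>) * y1 (X k \<omega>))))"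
    using assms by (intro integrable_prod_Z_mult yyy_integrable) auto
  ultimately show ?thesis unfolding M2_def M3_def by (simp only: integral_diffu_mult)
qed

lemma integral_of_real_l1:
  "integrable M f \<Longrightarrow> integral\<^sup>L M (\<lambda>\<omega>. of_real (f \<omega>) :: l1) = of_real (expectation f)"
  "integrable M f \<Longrightarrow> integrable M (\<lambda>\<omega>. of_real (f \<omega>) :: l1)"
  using integral_bounded_linear[OF bounded_linear_of_real, of M f]
    integrable_bounded_linear[OF bounded_linear_of_real, of M f] by auto

lemma M1_diag: assumes "k \<le> n" shows "M1 k k = of_real (\<nu> M X 1 k) + diffu * A2 k"
proof -
  have "M1 k k = integral\<^sup>L M (\<lambda>\<omega>. of_real (real (X k \<omega>)) + diffu * y2 (X k \<omega>))"
    unfolding M1_def by (simp add: y1_eq)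
  also have "\<dots> = integral\<^sup>L M (\<lambda>\<omega>. of_real (real (X k \<omega>))) + integral\<^sup>L M (\<lambda>\<omega>. diffu * y2 (X k \<omega>))"
    using assms by (intro Bochner_Integration.integral_add integral_of_real_l1 X_integrable integrable_mult_right y2_integrable)
  also have "\<dots> = of_real (\<nu> M X 1 k) + diffu * A2 k"
    unfolding nu1_eq A2_def using assms by (simp only: integral_of_real_l1 X_integrable integral_diffu_mult y2_integrable)
  finally show ?thesis .
qed

lemma nu2_eq: "\<nu> M X 2 k = expectation (\<lambda>\<omega>. real (X k \<omega>) * (real (X k \<omega>) - 1))"
  by (simp add: \<nu>_def falling_2)

lemma A2_eq: assumes "k \<le> n" shows "A2 k = of_real (\<nu> M X 2 k / 2) + diffu * A3 k"
proof -
  have i: "integrable M (\<lambda>\<omega>. real (X k \<omega>) * (real (X k \<omega>) - 1) / 2)"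
    using integrable_fall2[OF assms] by simp
  have "A2 k = integral\<^sup>L M (\<lambda>\<omega>. of_real (real (X k \<omega>) * (real (X k \<omega>) - 1) / 2) + diffu * y3 (X k \<omega>))"
    unfolding A2_def y2_eq ..
  also have "\<dots> = integral\<^sup>L M (\<lambda>\<omega>. of_real (real (X k \<omega>) * (real (X k \<omega>) - 1) / 2)) + integral\<^sup>L M (\<lambda>\<omega>. diffu * y3 (X k \<omega>))"
    using assms by (intro Bochner_Integration.integral_add integral_of_real_l1 i integrable_mult_right y3_integrable)
  also have "\<dots> = of_real (expectation (\<lambda>\<omega>. real (X k \<omega>) * (real (X k \<omega>) - 1) / 2)) + diffu * A3 k"
    unfolding A3_def using assms i by (simp only: integral_of_real_l1 integral_diffu_mult y3_integrable)
  also have "expectation (\<lambda>\<omega>. real (X k \<omega>) * (real (X k \<omega>) - 1) / 2) = \<nu> M X 2 k / 2"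
    unfolding nu2_eq by simp
  finally show ?thesis .
qed

lemma B3_bound:
  assumes "k \<le> n"
  shows "integrable M (\<lambda>\<omega>. of_real (real (X (k-1) \<omega>)) * y2 (X k \<omega>) + y2 (X (k-1) \<omega>) * y1 (X k \<omega>))"
    and "norm (B3 k) \<le> dd k"
proof -
  let ?f = "\<lambda>\<omega>. of_real (real (X (k-1) \<omega>)) * y2 (X k \<omega>) + y2 (X (k-1) \<omega>) * y1 (X k \<omega>)"
  let ?g = "\<lambda>\<omega>. real (X (k-1) \<omega>) * (real (X (k-1) \<omega>) - 1) * real (X k \<omega>)
     + real (X (k-1) \<omega>) * (real (X k \<omega>) * (real (X k \<omega>) - 1))"
  have k: "k - 1 \<le> n" using assms by simp
  have m: "?f \<in> borel_measurable M"
    using assms k by (intro borel_measurable_add borel_measurable_times X_compose X_compose[where h = "\<lambda>x. of_real (real x)"])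
  have i: "integrable M ?g"
    using assms k by (intro Bochner_Integration.integrable_add integrable_fall2_mult)
  have l: "norm (?f \<omega>) \<le> ?g \<omega>" for \<omega>
  proof -
    have y2': "norm (y2 x) \<le> real x * (real x - 1)" for x
      using norm_y2[of x] mult_minus_1_nonneg[of x] by linarith
    have "norm (?f \<omega>) \<le> real (X (k-1) \<omega>) * (real (X k \<omega>) * (real (X k \<omega>) - 1))
       + real (X (k-1) \<omega>) * (real (X (k-1) \<omega>) - 1) * real (X k \<omega>)"
      by (intro norm_triangle_mono norm_mult_le_mult norm_of_real_le y2' norm_y1) simp
    then show ?thesis by simp
  qed
  from integrable_via_norm[OF m i l]
  show "integrable M ?f" "norm (B3 k) \<le> dd k"
    unfolding B3_def dd_def using assms k by (simp_all add: integrable_fall2_mult)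
qed

lemma M2_diag:
  assumes "Suc k \<le> n"
  shows "M2 k (Suc k) = of_real (EXX M X (Suc k)) + diffu * B3 (Suc k)"
proof -
  let ?f = "\<lambda>\<omega>. of_real (real (X k \<omega>)) * y2 (X (Suc k) \<omega>) + y2 (X k \<omega>) * y1 (X (Suc k) \<omega>)"
  have f: "integrable M ?f" using B3_bound(1)[OF assms] by simp
  have yy: "y1 a * y1 b = of_real (real a * real b) + diffu * (of_real (real a) * y2 b + y2 a * y1 b)" for a b
  proof -
    have "y1 a * y1 b = of_real (real a) * y1 b + diffu * (y2 a * y1 b)"
      using y1_eq[of a] by (simp add: algebra_simps)
    also have "of_real (real a) * y1 b = of_real (real a) * (of_real (real b) + diffu * y2 b)"
      using y1_eq[of b] by simp
    finally show ?thesis by (simp add: algebra_simps)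
  qed
  have "M2 k (Suc k) = integral\<^sup>L M (\<lambda>\<omega>. y1 (X k \<omega>) * y1 (X (Suc k) \<omega>))"
    by (simp add: M2_def)
  also have "\<dots> = integral\<^sup>L M (\<lambda>\<omega>. of_real (real (X k \<omega>) * real (X (Suc k) \<omega>)) + diffu * ?f \<omega>)"
    unfolding yy ..
  also have "\<dots> = integral\<^sup>L M (\<lambda>\<omega>. of_real (real (X k \<omega>) * real (X (Suc k) \<omega>))) + integral\<^sup>L M (\<lambda>\<omega>. diffu * ?f \<omega>)"
    using assms by (intro Bochner_Integration.integral_add integral_of_real_l1 integrable_X2 integrable_mult_right f) auto
  also have "\<dots> = of_real (expectation (\<lambda>\<omega>. real (X k \<omega>) * real (X (Suc k) \<omega>))) + diffu * integral\<^sup>L M ?f"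
    using assms by (simp only: integral_of_real_l1 integrable_X2 Suc_leD integral_diffu_mult f)
  finally show ?thesis by (simp add: EXX_def B3_def)
qed

lemma norm_M1: assumes "j \<le> k" "k \<le> n" shows "norm (M1 j k) \<le> decay (k - j) * \<nu> M X 1 k"
  unfolding M1_def nu1_eq
  by (rule norm_block_le)
    (use assms in \<open>auto intro: subal_compose y1_integrable norm_y1 X_integrable simp: X0 y1_0\<close>)

lemma norm_M2: assumes "j < k" "k \<le> n" shows "norm (M2 j k) \<le> decay (k - j - 1) * EXX M X k"
proof -
  have "norm (M2 j k) \<le> decay (k - 1 - j) * EXX M X k"
    unfolding M2_def EXX_def
    by (rule norm_block_le)
      (use assms in \<open>auto intro!: borel_measurable_times subal_compose yy_integrable norm_yy integrable_X2 simp: X0 y1_0\<close>)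
  then show ?thesis by (simp add: diff_commute)
qed

lemma norm_M3: assumes "j + 1 < k" "k \<le> n" shows "norm (M3 j k) \<le> decay (k - j - 2) * tt k"
proof -
  have "norm (M3 j k) \<le> decay (k - 2 - j) * tt k"
    unfolding M3_def tt_def
    by (rule norm_block_le)
      (use assms in \<open>auto intro!: borel_measurable_times subal_compose yyy_integrable norm_yyy integrable_X3 simp: X0 y1_0\<close>)
  then show ?thesis by (simp add: diff_commute)
qed

lemma nu_nonneg: "0 \<le> \<nu> M X j k"
  unfolding \<nu>_def by (simp add: falling_nonneg)

lemma dd_nonneg: "0 \<le> dd k"
proof -
  have "0 \<le> real x * (real x - 1) * real y" "0 \<le> real x * (real y * (real y - 1))" for x y
    using mult_minus_1_nonneg by auto
  then show ?thesis unfolding dd_def by (intro add_nonneg_nonneg integral_nonneg_AE AE_I2)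
qed

lemma EXX_nonneg: "0 \<le> EXX M X k" and tt_nonneg: "0 \<le> tt k"
  unfolding EXX_def tt_def by simp_all

lemma zero_facts: "\<nu> M X 1 0 = 0" "\<nu> M X 2 0 = 0" "EXX M X 0 = 0" "EXX M X 1 = 0"
  by (simp_all add: \<nu>_def X0 falling_def EXX_def numeral_2_eq_2)

lemma sum_from_2: "f 1 = (0 :: real) \<Longrightarrow> n \<ge> 1 \<Longrightarrow> (\<Sum>k=2..n. f k) = (\<Sum>k=1..n. f k)"
proof -
  assume "f 1 = 0" "n \<ge> 1"
  moreover from this have "{1..n} = insert 1 {2..n}" by auto
  ultimately show ?thesis by simp
qed

lemma square_integrable: "k \<in> {1..n} \<Longrightarrow> integrable M (\<lambda>\<omega>. (real (X k \<omega>))\<^sup>2)"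
  using integrable_X2[of k k] by (simp add: power2_eq_square)

lemma expansion: "expansion diffu n mZ M1 M2 M3 A2 A3 B3 (\<nu> M X 1) (\<nu> M X 2) (\<nu> M X 3) (EXX M X) dd tt"
proof
  show "norm diffu \<le> 2" by (rule norm_diffu_le)
  show "norm (A2 k) \<le> \<nu> M X 2 k / 2" if "k \<le> n" for k
    unfolding A2_def nu2_eq using norm_y2_integral[OF that] .
  show "norm (A3 k) \<le> \<nu> M X 3 k" if "k \<le> n" for k
    unfolding A3_def \<nu>_def using norm_y3_integral[OF that] .
  show "0 \<le> \<nu> M X 1 k \<and> \<nu> M X 1 k \<le> 1/100" if "k \<le> n" for k
    using nu_nonneg nu1_le[of k] that zero_facts by (cases "k = 0") auto
qed (use mZ_eq M1_eq M2_eq M1_diag A2_eq M2_diag norm_M1 norm_M2 norm_M3 B3_bound nu_nonneg dd_nonneg EXX_nonneg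
      tt_nonneg zero_facts in auto)

text \<open>A coordinate of \<open>sft n\<close> is the indicator of a value of the sum, and taking
  coordinates commutes with the integral.\<close>

lemma F_n_eq_coord: "F_n M X n k = (if k < 0 then 0 else coord (pgf n) (nat k))"
proof -
  have "(\<lambda>\<omega>. real (S_n X n \<omega>)) \<in> borel_measurable M"
    unfolding S_n_def of_nat_sum by (intro borel_measurable_sum X_compose) auto
  then have S: "S_n X n -` {i} \<inter> space M \<in> sets M" for i
    using measurable_sets[of "\<lambda>\<omega>. real (S_n X n \<omega>)" M borel "{real i}"] by (simp add: vimage_def)
  then have "S_n X n \<in> measurable M (count_space UNIV)"
    by (subst measurable_count_space_eq2_countable) auto
  then have mi: "(\<lambda>\<omega>. int (S_n X n \<omega>)) \<in> measurable M (count_space UNIV)"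
    by (rule measurable_compose) simp
  have F: "F_n M X n k = prob ((\<lambda>\<omega>. int (S_n X n \<omega>)) -` {k} \<inter> space M)"
    unfolding F_n_def using mi by (subst measure_distr) auto
  show ?thesis
  proof (cases "k < 0")
    case True
    then have "(\<lambda>\<omega>. int (S_n X n \<omega>)) -` {k} = {}" by auto
    then show ?thesis using True F by simp
  next
    case False
    then obtain i where i: "k = int i" by (metis nonneg_int_cases not_less)
    have "integrable M (sft n)" using integrable_shift_prod_Z[of n 0 1] by simp
    then have "coord (pgf n) i = expectation (\<lambda>\<omega>. coord (sft n \<omega>) i)"
      unfolding pgf_def by (rule coord_expectation)
    also have "\<dots> = expectation (indicator (S_n X n -` {i} \<inter> space M))"
      by (intro Bochner_Integration.integral_cong) (auto simp: sft_def coord_shift_power S_n_def indicator_def)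
    also have "\<dots> = prob (S_n X n -` {i} \<inter> space M)" using S by simp
    also have "S_n X n -` {i} \<inter> space M = (\<lambda>\<omega>. int (S_n X n \<omega>)) -` {k} \<inter> space M"
      by (auto simp: i)
    finally show ?thesis using F i by simp
  qed
qed

lemma Gamma1_sum: "\<Gamma>1 M X n = (\<Sum>k=1..n. \<nu> M X 1 k)"
  by (rule \<Gamma>1_eq[OF dep square_integrable])

lemma approximation:
  assumes n: "n \<ge> 1" and lam: "lam M X n > 0"
  shows "tv_norm (\<lambda>k. F_n M X n k - Pois (\<Gamma>1 M X n) k) \<le> 480 * R0 M X n * min 1 (1 / \<Gamma>1 M X n)"
    and "tv_norm (\<lambda>k. F_n M X n k - Pois2 (\<Gamma>1 M X n) (\<Gamma>2 M X n) k)
      \<le> 5760 * (R0 M X n)\<^sup>2 * (min 1 (1 / \<Gamma>1 M X n))\<^sup>2 + 480 * R1 M X n * min 1 (\<Gamma>1 M X n powr (-3/2))"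
    and "0 < \<Gamma>1 M X n" "lam M X n \<le> \<Gamma>1 M X n" "0 \<le> R0 M X n" "0 \<le> R1 M X n"
proof -
  have E2: "(\<Sum>k=2..n. EXX M X k) = (\<Sum>k=1..n. EXX M X k)"
    by (rule sum_from_2[where f = "EXX M X", OF zero_facts(4) n])
  have nn: "0 \<le> (\<Sum>k=1..n. \<nu> M X 2 k)" "0 \<le> (\<Sum>k=1..n. EXX M X k)"
    by (intro sum_nonneg nu_nonneg EXX_nonneg)+
  have lam_eq: "lam M X n = \<Gamma>1 M X n - 1.52 * (\<Sum>k=1..n. \<nu> M X 2 k) - 12 * (\<Sum>k=1..n. EXX M X k)"
    unfolding lam_def Gamma1_sum E2 ..
  show le: "lam M X n \<le> \<Gamma>1 M X n" using lam_eq nn by simp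
  show pos: "0 < \<Gamma>1 M X n" using le lam by simp
  interpret expansion diffu n mZ M1 M2 M3 A2 A3 B3 "\<nu> M X 1" "\<nu> M X 2" "\<nu> M X 3" "EXX M X" dd tt
    by (rule expansion)
  interpret poisson_expansion n mZ M1 M2 M3 A2 A3 B3 "\<nu> M X 1" "\<nu> M X 2" "\<nu> M X 3" "EXX M X" dd tt pgf "\<Gamma>1 M X n"
    by standard (use pgf_0 mZ_0 pgf_rec Gamma1_sum pos lam_eq lam in auto)
  have r0: "r0 = R0 M X n" unfolding r0_def R0_def ..
  show "0 \<le> R0 M X n" unfolding R0_def by (intro sum_nonneg add_nonneg_nonneg nu_nonneg EXX_nonneg) auto
  \<comment> \<open>The covariance at \<open>k = 1\<close> vanishes because \<open>X 0\<close> does,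
    so the sums from 1 and from 2 agree.\<close>
  have g: "(\<Sum>k=1..n. \<gamma> k - (\<nu> M X 1 k)\<^sup>2 / 2) = \<Gamma>2 M X n"
  proof -
    let ?h = "\<lambda>k. EXX M X k - \<nu> M X 1 (k-1) * \<nu> M X 1 k"
    have "\<Gamma>2 M X n = 1/2 * (\<Sum>k=1..n. \<nu> M X 2 k - (\<nu> M X 1 k)\<^sup>2) + (\<Sum>k=2..n. ?h k)"
      using \<Gamma>2_eq[OF dep square_integrable] by (simp only: hatE_pair EXX_def nu1_eq)
    also have "(\<Sum>k=2..n. ?h k) = (\<Sum>k=1..n. ?h k)"
      using n zero_facts by (intro sum_from_2) auto
    finally show ?thesis
      unfolding \<gamma>_def by (simp add: sum.distrib sum_subtractf sum_divide_distrib algebra_simps diff_divide_distrib)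
  qed
  define r where "r k = (\<nu> M X 1 k)^3 + \<nu> M X 1 k * \<nu> M X 2 k + \<nu> M X 3 k
     + (\<nu> M X 1 (k-2) + \<nu> M X 1 (k-1) + \<nu> M X 1 k) * EXX M X k
     + hatE_plus2 M (X (k-1)) (X k)
     + hatE_plus M [\<lambda>\<omega>. real (X (k-2) \<omega>), \<lambda>\<omega>. real (X (k-1) \<omega>), \<lambda>\<omega>. real (X k \<omega>)]" for k
  have R1: "R1 M X n = (\<Sum>k=1..n. r k)" by (simp add: R1_def r_def)
  have h2: "hatE_plus2 M (X (k-1)) (X k) = dd k + \<nu> M X 2 (k-1) * \<nu> M X 1 k + \<nu> M X 1 (k-1) * \<nu> M X 2 k" for k
    by (simp only: hatE_plus2_def hatE_plus_pair dd_def nu1_eq nu2_eq add.assoc add.commute add.left_commute)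
  have h3: "hatE_plus M [\<lambda>\<omega>. real (X (k-2) \<omega>), \<lambda>\<omega>. real (X (k-1) \<omega>), \<lambda>\<omega>. real (X k \<omega>)]
     = tt k + \<nu> M X 1 (k-2) * EXX M X k + (EXX M X (k-1) + \<nu> M X 1 (k-2) * \<nu> M X 1 (k-1)) * \<nu> M X 1 k" for k
  proof -
    have "k - 1 - 1 = k - 2" by simp
    then show ?thesis by (simp only: hatE_plus_triple tt_def EXX_def nu1_eq)
  qed
  \<comment> \<open>The product \<open>\<nu> M X 1 (k-2) * EXX M X k\<close> occurs twice in
    \<open>r k\<close>, explicitly and inside the triple \<open>hatE_plus\<close>, but only once in
    \<open>rem k\<close>.\<close>
  have rem_r: "rem k \<le> r k + (\<nu> M X 1 (k-1)) ^ 3" for k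
  proof -
    have "rem k + \<nu> M X 1 (k-2) * EXX M X k = r k + (\<nu> M X 1 (k-1)) ^ 3"
      unfolding rem_def r_def h2 h3 by (simp add: algebra_simps)
    moreover have "0 \<le> \<nu> M X 1 (k-2) * EXX M X k" using nu_nonneg EXX_nonneg by simp
    ultimately show ?thesis by linarith
  qed
  have rn: "(\<nu> M X 1 k) ^ 3 \<le> r k" for k
  proof -
    have "0 \<le> \<nu> M X 1 k * \<nu> M X 2 k + \<nu> M X 3 k
     + (\<nu> M X 1 (k-2) + \<nu> M X 1 (k-1) + \<nu> M X 1 k) * EXX M X k
     + hatE_plus2 M (X (k-1)) (X k)
     + hatE_plus M [\<lambda>\<omega>. real (X (k-2) \<omega>), \<lambda>\<omega>. real (X (k-1) \<omega>), \<lambda>\<omega>. real (X k \<omega>)]"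
      unfolding h2 h3 by (intro add_nonneg_nonneg mult_nonneg_nonneg nu_nonneg EXX_nonneg dd_nonneg tt_nonneg)
    then show ?thesis unfolding r_def by linarith
  qed
  then have rnn: "0 \<le> r k" for k using nu_nonneg[of 1 k] order_trans[OF zero_le_power] by blast
  then show R1n: "0 \<le> R1 M X n" unfolding R1 by (intro sum_nonneg)
  \<comment> \<open>The shifted cubes sum to at most \<open>R1\<close>, since the mean at index 0 is
    0; hence the factor 2 and 480 = 2 * 240.\<close>
  have "(\<Sum>k=1..n. (\<nu> M X 1 (k-1)) ^ 3) = (\<Sum>k<n. (\<nu> M X 1 k) ^ 3)"
    using sum.atLeast1_atMost_eq[of "\<lambda>k. (\<nu> M X 1 (k-1)) ^ 3" n] by (simp only: One_nat_def diff_Suc_Suc diff_zero)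
  also have "\<dots> \<le> (\<Sum>k\<in>insert 0 {1..n}. (\<nu> M X 1 k) ^ 3)"
    using nu_nonneg by (intro sum_mono2) auto
  also have "\<dots> = (\<Sum>k=1..n. (\<nu> M X 1 k) ^ 3)" using zero_facts by simp
  also have "\<dots> \<le> R1 M X n" unfolding R1 by (intro sum_mono rn)
  finally have "(\<Sum>k=1..n. rem k) \<le> 2 * R1 M X n"
    using sum_mono[of "{1..n}" rem "\<lambda>k. r k + (\<nu> M X 1 (k-1)) ^ 3", OF rem_r] by (simp only: sum.distrib R1)
  then have rem2: "240 * (\<Sum>k=1..n. rem k) * min 1 (\<Gamma>1 M X n powr (-3/2)) \<le> 480 * R1 M X n * min 1 (\<Gamma>1 M X n powr (-3/2))"
    by (intro mult_right_mono) auto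
  have tv1: "tv_norm (\<lambda>k. F_n M X n k - Pois (\<Gamma>1 M X n) k) = norm (pgf n - poisson_l1 (\<Gamma>1 M X n))"
    by (rule tv_norm_eq_norm) (simp add: F_n_eq_coord Pois_eq_coord)
  have tv2: "tv_norm (\<lambda>k. F_n M X n k - Pois2 (\<Gamma>1 M X n) (\<Gamma>2 M X n) k)
      = norm (pgf n - poisson_l1 (\<Gamma>1 M X n) * (1 + of_real (\<Gamma>2 M X n) * diffu ^ 2))"
    by (rule tv_norm_eq_norm) (simp only: F_n_eq_coord Pois2_eq_coord coord_diff, simp)
  show "tv_norm (\<lambda>k. F_n M X n k - Pois (\<Gamma>1 M X n) k) \<le> 480 * R0 M X n * min 1 (1 / \<Gamma>1 M X n)"
    unfolding tv1 r0[symmetric] by (rule F_approx)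
  show "tv_norm (\<lambda>k. F_n M X n k - Pois2 (\<Gamma>1 M X n) (\<Gamma>2 M X n) k)
      \<le> 5760 * (R0 M X n)\<^sup>2 * (min 1 (1 / \<Gamma>1 M X n))\<^sup>2 + 480 * R1 M X n * min 1 (\<Gamma>1 M X n powr (-3/2))"
    using F_approx(2) rem2 unfolding tv2 g r0 by linarith
qed

end

text \<open>The minima decrease in their parameter, so passing from \<Gamma>1 to the smaller
  \<lambda> enlarges them, and the bracket is at least 1. The constant is the largest in
  \<open>approximation\<close>.\<close>

lemma valid_constant_5760: "valid_constant TYPE('a) 5760"
  unfolding valid_constant_def
proof (intro allI impI, elim conjE)
  fix n :: nat and M :: "'a measure" and X :: "nat \<Rightarrow> 'a \<Rightarrow> nat"
  assume n: "1 \<le> n" and ps: "prob_space M" and dep: "one_dependent M n X" and X0: "X 0 = (\<lambda>_. 0)"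
    and mom: "\<forall>k\<in>{1..n}. \<nu> M X 1 k \<le> 1/100 \<and> \<nu> M X 2 k \<le> \<nu> M X 1 k \<and> integrable M (\<lambda>\<omega>. falling 4 (X k \<omega>))"
    and lam: "0 < lam M X n"
  interpret prob_space M by (rule ps)
  interpret one_dependent_seq M n X
    by standard (use dep X0 mom in auto)
  note A = approximation[OF n lam]
  define G L where "G = \<Gamma>1 M X n" and "L = lam M X n"
  have GL: "0 < L" "L \<le> G" using lam A by (auto simp: G_def L_def)
  define F where "F = 1 + G * min 1 (1 / L)"
  have F: "1 \<le> F" using GL by (simp add: F_def)
  have m1: "min 1 (1 / G) \<le> min 1 (1 / L)"
    using GL by (intro min.mono) (auto simp: frac_le)
  have m2: "(min 1 (1 / G))\<^sup>2 \<le> min 1 (L powr (-2))"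
  proof (rule min.boundedI)
    show "(min 1 (1 / G))\<^sup>2 \<le> 1" using GL by (intro power_le_one) auto
    have "(min 1 (1 / G))\<^sup>2 \<le> (1 / L)\<^sup>2" using m1 GL by (intro power_mono) auto
    also have "\<dots> = L powr (-2)" using GL powr_realpow[of L 2] by (simp add: powr_minus power_inverse divide_inverse)
    finally show "(min 1 (1 / G))\<^sup>2 \<le> L powr (-2)" .
  qed
  have m3: "min 1 (G powr (-3/2)) \<le> min 1 (L powr (-3/2))"
    using GL powr_mono2'[of "-3/2" L G] by (intro min.mono) auto
  have "tv_norm (\<lambda>k. F_n M X n k - Pois (\<Gamma>1 M X n) k) \<le> 480 * R0 M X n * min 1 (1 / G)"
    using A by (simp add: G_def)
  also have "\<dots> \<le> (5760 * R0 M X n * F) * min 1 (1 / L)"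
  proof (rule mult_mono[OF _ m1])
    show "480 * R0 M X n \<le> 5760 * R0 M X n * F"
      using mult_left_mono[OF F, of "5760 * R0 M X n"] A(5) by linarith
  qed (use A GL F in auto)
  finally have 1: "tv_norm (\<lambda>k. F_n M X n k - Pois (\<Gamma>1 M X n) k) \<le> 5760 * R0 M X n * F * min 1 (1 / L)" .
  define W where "W = (R0 M X n)\<^sup>2 * min 1 (L powr (-2)) + R1 M X n * min 1 (L powr (-3/2))"
  have W: "0 \<le> W" unfolding W_def using A by (intro add_nonneg_nonneg mult_nonneg_nonneg) auto
  have "(R0 M X n)\<^sup>2 * (min 1 (1 / G))\<^sup>2 \<le> (R0 M X n)\<^sup>2 * min 1 (L powr (-2))"
    by (intro mult_left_mono m2) auto
  moreover have "R1 M X n * min 1 (G powr (-3/2)) \<le> R1 M X n * min 1 (L powr (-3/2))"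
    by (intro mult_left_mono m3 A)
  moreover have "0 \<le> R1 M X n * min 1 (L powr (-3/2))" using A by (intro mult_nonneg_nonneg) auto
  moreover have "tv_norm (\<lambda>k. F_n M X n k - Pois2 (\<Gamma>1 M X n) (\<Gamma>2 M X n) k)
      \<le> 5760 * ((R0 M X n)\<^sup>2 * (min 1 (1 / G))\<^sup>2) + 480 * (R1 M X n * min 1 (G powr (-3/2)))"
    using A(2) by (simp only: G_def mult.assoc)
  ultimately have "tv_norm (\<lambda>k. F_n M X n k - Pois2 (\<Gamma>1 M X n) (\<Gamma>2 M X n) k) \<le> 5760 * W"
    unfolding W_def by argo
  also have "\<dots> \<le> 5760 * (F * W)" using mult_right_mono[OF F W] by simp
  finally have 2: "tv_norm (\<lambda>k. F_n M X n k - Pois2 (\<Gamma>1 M X n) (\<Gamma>2 M X n) k) \<le> 5760 * F * W" by simp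
  show "tv_norm (\<lambda>k. F_n M X n k - Pois (\<Gamma>1 M X n) k)
         \<le> 5760 * R0 M X n * (1 + \<Gamma>1 M X n * min 1 (1 / lam M X n)) * min 1 (1 / lam M X n) \<and>
       tv_norm (\<lambda>k. F_n M X n k - Pois2 (\<Gamma>1 M X n) (\<Gamma>2 M X n) k)
         \<le> 5760 * (1 + \<Gamma>1 M X n * min 1 (1 / lam M X n)) *
           ((R0 M X n)^2 * min 1 (lam M X n powr (-2)) + R1 M X n * min 1 (lam M X n powr (-3/2)))"
    using 1 2 unfolding F_def W_def G_def L_def by blast
qed

subsection \<open>Independence of the probability space\<close>

text \<open>The joint law of \<open>X 1, \<dots>, X n\<close> is carried over to \<open>nat\<close> by encoding the list of the values.\<close>

lemma valid_constant_transfer: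
  assumes valid: "valid_constant TYPE(nat) C"
  shows "valid_constant TYPE('a) C"
  unfolding valid_constant_def
proof (intro allI impI, elim conjE)
  fix n :: nat and M :: "'a measure" and X :: "nat \<Rightarrow> 'a \<Rightarrow> nat"
  assume n: "1 \<le> n" and ps: "prob_space M" and dep: "one_dependent M n X" and X0: "X 0 = (\<lambda>_. 0)"
    and mom: "\<forall>k\<in>{1..n}. \<nu> M X 1 k \<le> 1/100 \<and> \<nu> M X 2 k \<le> \<nu> M X 1 k \<and> integrable M (\<lambda>\<omega>. falling 4 (X k \<omega>))"
    and lam: "0 < lam M X n"
  interpret M: prob_space M by (rule ps)
  define enc where "enc \<omega> = to_nat (map (\<lambda>k. X k \<omega>) [1..<Suc n])" for \<omega>
  \<comment> \<open>Position \<open>k - 1\<close> of the decoded list holds the value of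
    \<open>X k\<close>, and index 0 gives 0 as for \<open>X\<close>. Codes outside the range of
    \<open>enc\<close> do not matter, since everything on \<open>N\<close> is pulled back along
    \<open>enc\<close>.\<close>
  define X' where "X' k c = (if k \<in> {1..n} then (from_nat c :: nat list) ! (k - 1) else 0)" for k c
  define N where "N = distr M (count_space UNIV) enc"
  have X'_enc: "X' k (enc \<omega>) = X k \<omega>" if "k \<le> n" for k \<omega>
  proof (cases "k = 0")
    case False
    then have "k - 1 < length [1..<Suc n]" "[1..<Suc n] ! (k - 1) = k" using that by (auto simp del: upt_Suc)
    then show ?thesis using that False by (simp add: X'_def enc_def del: upt_Suc)
  qed (simp add: X'_def X0)
  have enc: "enc \<in> measurable M (count_space UNIV)"
  proof -
    \<comment> \<open>The encoding is injective on lists, so a nonempty fibre is a finite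
      intersection of events fixing one \<open>X k\<close> each; countability of the target makes
      fibres suffice.\<close>
    have "enc -` {c} \<inter> space M \<in> sets M" for c
    proof (cases "\<exists>\<omega>0. enc \<omega>0 = c")
      case True
      then obtain \<omega>0 where c: "c = enc \<omega>0" by auto
      have "enc -` {c} \<inter> space M = {\<omega>\<in>space M. \<forall>k\<in>{1..n}. X k \<omega> = X k \<omega>0}"
        by (auto simp: c enc_def atLeastLessThanSuc_atLeastAtMost simp del: upt_Suc)
      also have "\<dots> \<in> sets M"
      proof (intro sets.sets_Collect_finite_All)
        fix k assume "k \<in> {1..n}"
        then have "X k \<in> measurable M (count_space UNIV)" using dep by (simp add: one_dependent_def)
        from measurable_sets[OF this, of "{X k \<omega>0}"]
        show "{\<omega>\<in>space M. X k \<omega> = X k \<omega>0} \<in> sets M" by (simp add: vimage_def Int_def conj_commute)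
      qed simp
      finally show ?thesis .
    next
      case False
      then have "enc -` {c} = {}" by auto
      then show ?thesis by simp
    qed
    then show ?thesis by (subst measurable_count_space_eq2_countable) auto
  qed
  have psN: "prob_space N" unfolding N_def by (rule M.prob_space_distr[OF enc])
  interpret N: prob_space N by (rule psN)
  have E: "integral\<^sup>L N f = integral\<^sup>L M (\<lambda>\<omega>. f (enc \<omega>))" for f :: "nat \<Rightarrow> real"
    unfolding N_def by (rule integral_distr[OF enc]) simp
  have nu: "\<nu> N X' j k = \<nu> M X j k" if "k \<le> n" for j k
    using that by (simp add: \<nu>_def E X'_enc)
  have EXX: "EXX N X' k = EXX M X k" if "k \<le> n" for k
    using that by (simp add: EXX_def E X'_enc)
  have S: "S_n X' n (enc \<omega>) = S_n X n \<omega>" for \<omega>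
    by (simp add: S_n_def X'_enc)
  have G1: "\<Gamma>1 N X' n = \<Gamma>1 M X n" and G2: "\<Gamma>2 N X' n = \<Gamma>2 M X n"
    by (simp_all add: \<Gamma>1_def \<Gamma>2_def E S)
  have lam_eq: "lam N X' n = lam M X n"
    unfolding lam_def by (simp add: nu EXX)
  have R0: "R0 N X' n = R0 M X n"
    unfolding R0_def by (intro sum.cong) (auto simp: nu EXX)
  have hat: "hatE_plus2 N (X' (k-1)) (X' k) = hatE_plus2 M (X (k-1)) (X k)"
    "hatE_plus N [\<lambda>\<omega>. real (X' (k-2) \<omega>), \<lambda>\<omega>. real (X' (k-1) \<omega>), \<lambda>\<omega>. real (X' k \<omega>)]
     = hatE_plus M [\<lambda>\<omega>. real (X (k-2) \<omega>), \<lambda>\<omega>. real (X (k-1) \<omega>), \<lambda>\<omega>. real (X k \<omega>)]" if "k \<le> n" for k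
    using that by (simp_all add: hatE_plus2_def hatE_plus_pair hatE_plus_triple E X'_enc)
  have R1: "R1 N X' n = R1 M X n"
    unfolding R1_def
  proof (rule sum.cong[OF refl])
    fix k assume "k \<in> {1..n}"
    then have k: "k \<le> n" "k - 1 \<le> n" "k - 2 \<le> n" by auto
    show "(\<nu> N X' 1 k)^3 + \<nu> N X' 1 k * \<nu> N X' 2 k + \<nu> N X' 3 k
     + (\<nu> N X' 1 (k-2) + \<nu> N X' 1 (k-1) + \<nu> N X' 1 k) * EXX N X' k
     + hatE_plus2 N (X' (k-1)) (X' k)
     + hatE_plus N [\<lambda>\<omega>. real (X' (k-2) \<omega>), \<lambda>\<omega>. real (X' (k-1) \<omega>), \<lambda>\<omega>. real (X' k \<omega>)]
     = (\<nu> M X 1 k)^3 + \<nu> M X 1 k * \<nu> M X 2 k + \<nu> M X 3 k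
     + (\<nu> M X 1 (k-2) + \<nu> M X 1 (k-1) + \<nu> M X 1 k) * EXX M X k
     + hatE_plus2 M (X (k-1)) (X k)
     + hatE_plus M [\<lambda>\<omega>. real (X (k-2) \<omega>), \<lambda>\<omega>. real (X (k-1) \<omega>), \<lambda>\<omega>. real (X k \<omega>)]"
      by (simp only: hat[OF k(1)] nu[OF k(1)] nu[OF k(2)] nu[OF k(3)] EXX[OF k(1)])
  qed
  have F: "F_n N X' n = F_n M X n"
    unfolding F_n_def N_def by (subst distr_distr[OF _ enc]) (auto simp: o_def S)
  \<comment> \<open>Preimages commute with generation of sigma-algebras, and the generators for
    \<open>X'\<close> pull back to those for \<open>X\<close>.\<close>
  have gen: "enc -` A \<inter> space M \<in> generated_sigma M X J"
    if "A \<in> generated_sigma N X' J" "J \<subseteq> {1..n}" for A J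
  proof -
    have "{enc -` A \<inter> space M |A. A \<in> sigma_sets UNIV {X' i -` A \<inter> UNIV | i A. i \<in> J}}
        = sigma_sets (space M) {enc -` A \<inter> space M |A. A \<in> {X' i -` A \<inter> UNIV | i A. i \<in> J}}"
      by (rule sigma_sets_vimage_commute) simp
    also have "{enc -` A \<inter> space M |A. A \<in> {X' i -` A \<inter> UNIV | i A. i \<in> J}} = {X i -` A \<inter> space M | i A. i \<in> J}"
    proof -
      have eq: "enc -` (X' i -` A \<inter> UNIV) = X i -` A" if "i \<in> J" for i A
        using that \<open>J \<subseteq> {1..n}\<close> by (auto simp: X'_enc)
      show ?thesis
      proof (intro equalityI subsetI)
        fix B assume "B \<in> {enc -` A \<inter> space M |A. A \<in> {X' i -` A \<inter> UNIV | i A. i \<in> J}}"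
        then obtain i A where i: "i \<in> J" and B: "B = enc -` (X' i -` A \<inter> UNIV) \<inter> space M" by blast
        show "B \<in> {X i -` A \<inter> space M | i A. i \<in> J}" unfolding B eq[OF i] using i by blast
      next
        fix B assume "B \<in> {X i -` A \<inter> space M | i A. i \<in> J}"
        then obtain i A where i: "i \<in> J" and B: "B = X i -` A \<inter> space M" by blast
        show "B \<in> {enc -` A \<inter> space M |A. A \<in> {X' i -` A \<inter> UNIV | i A. i \<in> J}}"
          unfolding B eq[OF i, symmetric] using i by blast
      qed
    qed
    finally show ?thesis using that(1) unfolding generated_sigma_def by (auto simp: N_def)
  qed
  have dep': "one_dependent N n X'"
    unfolding one_dependent_def
  proof (intro conjI ballI allI impI)
    show "X' k \<in> measurable N (count_space UNIV)" for k by (simp add: N_def)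
    fix s t assume st: "1 \<le> s \<and> s + 1 < t \<and> t \<le> n"
    then have ind: "M.indep_set (generated_sigma M X {1..s}) (generated_sigma M X {t..n})"
      using dep by (auto simp: one_dependent_def)
    have pr: "measure N A = measure M (enc -` A \<inter> space M)" for A
      unfolding N_def by (rule measure_distr[OF enc]) simp
    show "N.indep_set (generated_sigma N X' {1..s}) (generated_sigma N X' {t..n})"
      unfolding N.indep_sets2_eq
    proof (intro conjI ballI)
      show "generated_sigma N X' {1..s} \<subseteq> N.events" "generated_sigma N X' {t..n} \<subseteq> N.events"
        by (auto simp: N_def)
      fix A B assume A: "A \<in> generated_sigma N X' {1..s}" and B: "B \<in> generated_sigma N X' {t..n}"
      have "enc -` A \<inter> space M \<in> generated_sigma M X {1..s}" "enc -` B \<inter> space M \<in> generated_sigma M X {t..n}"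
        by (rule gen[OF A] gen[OF B]; use st in simp)+
      with ind have "M.prob ((enc -` A \<inter> space M) \<inter> (enc -` B \<inter> space M))
         = M.prob (enc -` A \<inter> space M) * M.prob (enc -` B \<inter> space M)"
        unfolding M.indep_sets2_eq by blast
      moreover have "(enc -` A \<inter> space M) \<inter> (enc -` B \<inter> space M) = enc -` (A \<inter> B) \<inter> space M" by auto
      ultimately show "N.prob (A \<inter> B) = N.prob A * N.prob B" by (simp add: pr)
    qed
  qed
  have mom': "\<nu> N X' 1 k \<le> 1/100 \<and> \<nu> N X' 2 k \<le> \<nu> N X' 1 k \<and> integrable N (\<lambda>\<omega>. falling 4 (X' k \<omega>))"
    if "k \<in> {1..n}" for k
  proof -
    have "integrable N (\<lambda>\<omega>. falling 4 (X' k \<omega>)) \<longleftrightarrow> integrable M (\<lambda>\<omega>. falling 4 (X' k (enc \<omega>)))"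
      unfolding N_def by (rule integrable_distr_eq[OF enc]) simp
    then show ?thesis using that mom by (simp add: nu X'_enc)
  qed
  have X'0: "X' 0 = (\<lambda>_. 0)" by (rule ext) (simp add: X'_def)
  have "prob_space N \<and> one_dependent N n X' \<and> X' 0 = (\<lambda>_. 0) \<and>
       (\<forall>k\<in>{1..n}. \<nu> N X' 1 k \<le> 1/100 \<and> \<nu> N X' 2 k \<le> \<nu> N X' 1 k \<and>
                   integrable N (\<lambda>\<omega>. falling 4 (X' k \<omega>))) \<and> lam N X' n > 0"
    using psN dep' X'0 mom' lam lam_eq by simp
  then show "tv_norm (\<lambda>k. F_n M X n k - Pois (\<Gamma>1 M X n) k)
         \<le> C * R0 M X n * (1 + \<Gamma>1 M X n * min 1 (1 / lam M X n)) * min 1 (1 / lam M X n) \<and>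
       tv_norm (\<lambda>k. F_n M X n k - Pois2 (\<Gamma>1 M X n) (\<Gamma>2 M X n) k)
         \<le> C * (1 + \<Gamma>1 M X n * min 1 (1 / lam M X n)) *
           ((R0 M X n)^2 * min 1 (lam M X n powr (-2)) + R1 M X n * min 1 (lam M X n powr (-3/2)))"
    using valid[unfolded valid_constant_def, rule_format, OF n, of N X']
    unfolding F G1 G2 lam_eq R0 R1 by blast
qed

theorem theorem3p1:
  shows "(\<exists>C>0. valid_constant TYPE(nat) C) \<and>
         (\<forall>C. valid_constant TYPE(nat) C \<longrightarrow> valid_constant TYPE('a) C)"
proof
  show "\<exists>C>0. valid_constant TYPE(nat) C"
    using valid_constant_5760 by (intro exI[of _ 5760]) simp
  show "\<forall>C. valid_constant TYPE(nat) C \<longrightarrow> valid_constant TYPE('a) C"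
    using valid_constant_transfer by blast
qed

end
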